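(* Let $R$ be a nonzero ring. The following statements are equivalent. (1) The left $R$-module ${}_RR$ is a direct sum of virtually simple modules. (2) $R$ is a left completely virtually semisimple ring. (3) $R \cong \prod_{i=1}^{k} M_{n_i}(D_i)$ where $k, n_1,\ldots,n_k$ are positive integers and each $D_i$ is a principal left ideal domain. Moreover, in statement (3), the integers $k, n_1,\ldots,n_k$ and the principal left ideal domains $D_1,\ldots,D_k$ are uniquely determined by $R$ (up to isomorphism of the $D_i$ and up to simultaneous reordering of the pairs $(n_i,D_i)$).
   Context: All rings are associative with identity and all modules are unitary. An $R$-module $M$ is virtually simple if $M\neq 0$ and $N\cong M$ for every nonzero submodule $N$ of $M$. An $R$-module $M$ is virtually semisimple if each submodule of $M$ is isomorphic to a direct summand of $M$, and completely virtually semisimple if each submodule of $M$ is a virtually semisimple module. A ring $R$ is left completely virtually semisimple if the left module ${}_RR$ is completely virtually semisimple. A principal left ideal domain is a (not necessarily commutative) domain in which every left ideal is principal. $M_n(D)$ is the ring of $n\times n$ matrices over $D$. *)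

theory Defs
  imports "HOL-Algebra.Algebra"
begin

section \<open>Left modules over a not necessarily commutative ring\<close>

text \<open>
  The locale \<^locale>\<open>module\<close> of the library assumes a commutative ring; this one has the same
  axioms over an arbitrary ring. The library's \<^locale>\<open>submodule\<close> puts no condition on the
  ring and is used as it stands. A submodule \<open>N\<close> of \<open>M\<close>, regarded as a module, is
  \<open>M\<lparr>carrier := N\<rparr>\<close>.
\<close>

locale left_module = R?: ring R + M?: abelian_group M
    for R :: "('a, 'r) ring_scheme" (structure) and M :: "('a, 'b, 'm) module_scheme" (structure) +
  assumes smult_closed:
      "\<lbrakk>a \<in> carrier R; x \<in> carrier M\<rbrakk> \<Longrightarrow> a \<odot>\<^bsub>M\<^esub> x \<in> carrier M"
    and smult_l_distr:
      "\<lbrakk>a \<in> carrier R; b \<in> carrier R; x \<in> carrier M\<rbrakk> \<Longrightarrow>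
        (a \<oplus> b) \<odot>\<^bsub>M\<^esub> x = a \<odot>\<^bsub>M\<^esub> x \<oplus>\<^bsub>M\<^esub> b \<odot>\<^bsub>M\<^esub> x"
    and smult_r_distr:
      "\<lbrakk>a \<in> carrier R; x \<in> carrier M; y \<in> carrier M\<rbrakk> \<Longrightarrow>
        a \<odot>\<^bsub>M\<^esub> (x \<oplus>\<^bsub>M\<^esub> y) = a \<odot>\<^bsub>M\<^esub> x \<oplus>\<^bsub>M\<^esub> a \<odot>\<^bsub>M\<^esub> y"
    and smult_assoc1:
      "\<lbrakk>a \<in> carrier R; b \<in> carrier R; x \<in> carrier M\<rbrakk> \<Longrightarrow>
        (a \<otimes> b) \<odot>\<^bsub>M\<^esub> x = a \<odot>\<^bsub>M\<^esub> (b \<odot>\<^bsub>M\<^esub> x)"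
    and smult_one: "x \<in> carrier M \<Longrightarrow> \<one> \<odot>\<^bsub>M\<^esub> x = x"

definition regular_module :: "('a, 'r) ring_scheme \<Rightarrow> ('a, 'a) module" where
  "regular_module R =
    \<lparr>carrier = carrier R, monoid.mult = monoid.mult R, one = one R, ring.zero = ring.zero R, ring.add = ring.add R, smult = monoid.mult R\<rparr>"

lemma (in ring) regular_module_left_module: "left_module R (regular_module R)"
proof -
  have "abelian_group (regular_module R)"
    by (rule abelian_groupI)
       (auto simp: regular_module_def a_assoc a_comm a_lcomm intro: bexI[of _ "\<ominus> _"] l_neg)
  then show ?thesis
    by (intro left_module.intro left_module_axioms.intro ring_axioms)
       (auto simp: regular_module_def l_distr r_distr m_assoc)
qed

definition module_isomorphic ::
    "('a, 'r) ring_scheme \<Rightarrow> ('a, 'b, 'm) module_scheme \<Rightarrow> ('a, 'c, 'n) module_scheme \<Rightarrow> bool" where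
  "module_isomorphic R M N \<longleftrightarrow>
    (\<exists>h \<in> iso (add_monoid M) (add_monoid N).
      \<forall>a \<in> carrier R. \<forall>x \<in> carrier M. h (a \<odot>\<^bsub>M\<^esub> x) = a \<odot>\<^bsub>N\<^esub> h x)"

definition direct_summand ::
    "('a, 'r) ring_scheme \<Rightarrow> ('a, 'b, 'm) module_scheme \<Rightarrow> 'b set \<Rightarrow> bool" where
  "direct_summand R M N \<longleftrightarrow> submodule N R M \<and>
    (\<exists>K. submodule K R M \<and> N <+>\<^bsub>M\<^esub> K = carrier M \<and> N \<inter> K = {\<zero>\<^bsub>M\<^esub>})"

text \<open>
  \<open>M\<close> is the (internal) direct sum of the possibly infinite set \<open>S\<close> of submodules. Indexing the
  summands by themselves loses nothing when they are nonzero, since nonzero summands of a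
  direct sum are pairwise distinct.
\<close>

definition internal_direct_sum ::
    "('a, 'r) ring_scheme \<Rightarrow> ('a, 'b, 'm) module_scheme \<Rightarrow> 'b set set \<Rightarrow> bool" where
  "internal_direct_sum R M S \<longleftrightarrow> (\<forall>N \<in> S. submodule N R M) \<and>
    (\<forall>x \<in> carrier M. \<exists>!f. f \<in> (\<Pi>\<^sub>E N \<in> S. N) \<and> finite {N \<in> S. f N \<noteq> \<zero>\<^bsub>M\<^esub>} \<and>
      x = (\<Oplus>\<^bsub>M\<^esub>N \<in> {N \<in> S. f N \<noteq> \<zero>\<^bsub>M\<^esub>}. f N))"

definition virtually_simple ::
    "('a, 'r) ring_scheme \<Rightarrow> ('a, 'b, 'm) module_scheme \<Rightarrow> bool" where
  "virtually_simple R M \<longleftrightarrow> left_module R M \<and> carrier M \<noteq> {\<zero>\<^bsub>M\<^esub>} \<and>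
    (\<forall>N. submodule N R M \<and> N \<noteq> {\<zero>\<^bsub>M\<^esub>} \<longrightarrow> module_isomorphic R (M\<lparr>carrier := N\<rparr>) M)"

definition virtually_semisimple ::
    "('a, 'r) ring_scheme \<Rightarrow> ('a, 'b, 'm) module_scheme \<Rightarrow> bool" where
  "virtually_semisimple R M \<longleftrightarrow> left_module R M \<and>
    (\<forall>N. submodule N R M \<longrightarrow>
      (\<exists>K. direct_summand R M K \<and> module_isomorphic R (M\<lparr>carrier := N\<rparr>) (M\<lparr>carrier := K\<rparr>)))"

definition completely_virtually_semisimple ::
    "('a, 'r) ring_scheme \<Rightarrow> ('a, 'b, 'm) module_scheme \<Rightarrow> bool" where
  "completely_virtually_semisimple R M \<longleftrightarrow> left_module R M \<and>
    (\<forall>N. submodule N R M \<longrightarrow> virtually_semisimple R (M\<lparr>carrier := N\<rparr>))"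

definition direct_sum_of_virtually_simples ::
    "('a, 'r) ring_scheme \<Rightarrow> ('a, 'b, 'm) module_scheme \<Rightarrow> bool" where
  "direct_sum_of_virtually_simples R M \<longleftrightarrow>
    (\<exists>S. internal_direct_sum R M S \<and> (\<forall>N \<in> S. virtually_simple R (M\<lparr>carrier := N\<rparr>)))"

definition left_completely_virtually_semisimple_ring :: "('a, 'r) ring_scheme \<Rightarrow> bool" where
  "left_completely_virtually_semisimple_ring R \<longleftrightarrow>
    completely_virtually_semisimple R (regular_module R)"

section \<open>Principal left ideal domains and matrix rings\<close>

locale left_ideal = additive_subgroup I R + ring R for I and R (structure) +
  assumes I_l_closed: "\<lbrakk>a \<in> I; x \<in> carrier R\<rbrakk> \<Longrightarrow> x \<otimes> a \<in> I"

text \<open>The library's \<^locale>\<open>domain\<close> is commutative, so the domain axioms are restated.\<close>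

locale principal_left_ideal_domain = ring R for R (structure) +
  assumes one_not_zero: "\<one> \<noteq> \<zero>"
    and integral: "\<lbrakk>a \<otimes> b = \<zero>; a \<in> carrier R; b \<in> carrier R\<rbrakk> \<Longrightarrow> a = \<zero> \<or> b = \<zero>"
    and principal: "left_ideal I R \<Longrightarrow> \<exists>a \<in> carrier R. I = {x \<otimes> a | x. x \<in> carrier R}"

definition matrix_ring :: "nat \<Rightarrow> ('d, 'r) ring_scheme \<Rightarrow> (nat \<times> nat \<Rightarrow> 'd) ring" where
  "matrix_ring n D =
    \<lparr>carrier = {..<n} \<times> {..<n} \<rightarrow>\<^sub>E carrier D,
     monoid.mult = (\<lambda>A B. \<lambda>(i, j) \<in> {..<n} \<times> {..<n}. \<Oplus>\<^bsub>D\<^esub>l \<in> {..<n}. A (i, l) \<otimes>\<^bsub>D\<^esub> B (l, j)),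
     one = (\<lambda>(i, j) \<in> {..<n} \<times> {..<n}. if i = j then \<one>\<^bsub>D\<^esub> else \<zero>\<^bsub>D\<^esub>),
     ring.zero = (\<lambda>(i, j) \<in> {..<n} \<times> {..<n}. \<zero>\<^bsub>D\<^esub>),
     ring.add = (\<lambda>A B. \<lambda>(i, j) \<in> {..<n} \<times> {..<n}. A (i, j) \<oplus>\<^bsub>D\<^esub> B (i, j))\<rparr>"

definition plid_matrix_decomposition ::
    "('a, 'r) ring_scheme \<Rightarrow> nat \<Rightarrow> (nat \<Rightarrow> nat) \<Rightarrow> (nat \<Rightarrow> 'd ring) \<Rightarrow> bool" where
  "plid_matrix_decomposition R k n D \<longleftrightarrow> k > 0 \<and>
    (\<forall>i < k. n i > 0 \<and> principal_left_ideal_domain (D i)) \<and>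
    R \<simeq> RDirProd_list (map (\<lambda>i. matrix_ring (n i) (D i)) [0..<k])"

end

theory Submission
  imports Defs
begin

text \<open>
  Direct summands of \<open>R\<close> are left ideals \<open>Re\<close> with \<open>e\<close> idempotent, and homomorphisms \<open>Re \<rightarrow> Rf\<close> are right
  multiplications by elements of \<open>eRf\<close>. Each of the three conditions says that \<open>1\<close> is a finite sum of
  orthogonal idempotents \<open>e\<close> with \<open>Re\<close> virtually simple.

  The key point is that a nonzero map \<open>Re \<rightarrow> Rf\<close> between virtually simple modules is injective: its image
  is isomorphic to \<open>Rf\<close>, hence projective, so the kernel splits off, and a nonzero kernel would put
  two independent copies of \<open>Re\<close> inside \<open>Re\<close>, hence infinitely many, although every left ideal in \<open>Re\<close>
  is principal. So there are no nonzero maps between nonisomorphic summands, and \<open>R\<close> is a product of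
  matrix rings over corners \<open>eRe\<close>, one for each isomorphism class of summands.

  If every left ideal is isomorphic to a direct summand, then all left ideals are principal, so \<open>1\<close> is a
  sum of orthogonal indecomposable idempotents, and an indecomposable virtually semisimple module is
  virtually simple. Conversely, cutting a submodule of \<open>Re\<^sub>1 \<oplus> \<dots> \<oplus> Re\<^sub>m\<close> along the partial sums leaves
  at each step \<open>0\<close> or a projective copy of \<open>Re\<^sub>i\<close>, so it is isomorphic to a partial sum.

  The corners are determined by the isomorphism classes of the summands, and the sizes are ranks, which
  are well defined because a principal left ideal domain satisfies the left Ore condition.
\<close>

section \<open>Left ideals and virtually simple idempotents\<close>

text \<open>A homomorphism out of Re is given by any element x with ex = x, and it is injective
  exactly when rx = 0 forces re = 0. Projectivity, injectivity and isomorphism of summands thus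
  become identities between ring elements, and module maps survive only at the boundary, where the
  definitions in terms of submodules are translated. The domains have no commutativity and no
  fractions at hand, so ranks cannot be taken from linear algebra over a field; what is available is
  principality of left ideals, which yields common left multiples. Another obstacle is that a
  product of matrix rings consists of lists of functions, remote from idempotents. Matrix frames
  bridge this: a frame is a system of columns and rows inside R itself, one can be built from
  orthogonal idempotents as well as from a given isomorphism onto a product, and uniqueness becomes
  a comparison of two frames in the same ring, with every domain replaced by a corner of R.\<close>

no_notation Sum_Type.Plus (infixr \<open><+>\<close> 65)

lemma mem_set_add_iff: "z \<in> A <+>\<^bsub>G\<^esub> B \<longleftrightarrow> (\<exists>a\<in>A. \<exists>b\<in>B. z = a \<oplus>\<^bsub>G\<^esub> b)"
  by (auto simp: set_add_def')

context ring
begin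

lemma left_idealI:
  assumes "I \<subseteq> carrier R" "\<zero> \<in> I" "\<And>x y. x \<in> I \<Longrightarrow> y \<in> I \<Longrightarrow> x \<oplus> y \<in> I"
    and mult: "\<And>r x. r \<in> carrier R \<Longrightarrow> x \<in> I \<Longrightarrow> r \<otimes> x \<in> I"
  shows "left_ideal I R"
proof -
  have "\<ominus> x \<in> I" if "x \<in> I" for x
    using mult[of "\<ominus> \<one>" x] that assms(1) by (auto simp: l_minus subset_iff)
  then have "subgroup I (add_monoid R)"
    using assms by (intro subgroup.intro) (auto simp: a_inv_def)
  then show ?thesis
    using mult by (intro left_ideal.intro additive_subgroup.intro left_ideal_axioms.intro ring_axioms)
qed

lemma left_idealD:
  assumes "left_ideal I R"
  shows "I \<subseteq> carrier R" "\<zero> \<in> I" "\<And>x y. x \<in> I \<Longrightarrow> y \<in> I \<Longrightarrow> x \<oplus> y \<in> I"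
    "\<And>r x. r \<in> carrier R \<Longrightarrow> x \<in> I \<Longrightarrow> r \<otimes> x \<in> I"
    "\<And>x y. x \<in> I \<Longrightarrow> y \<in> I \<Longrightarrow> x \<ominus> y \<in> I"
proof -
  interpret left_ideal I R by fact
  show "I \<subseteq> carrier R" "\<zero> \<in> I" "\<And>x y. x \<in> I \<Longrightarrow> y \<in> I \<Longrightarrow> x \<oplus> y \<in> I"
    "\<And>r x. r \<in> carrier R \<Longrightarrow> x \<in> I \<Longrightarrow> r \<otimes> x \<in> I"
    "\<And>x y. x \<in> I \<Longrightarrow> y \<in> I \<Longrightarrow> x \<ominus> y \<in> I"
    by (auto simp: a_subset zero_closed I_l_closed a_minus_def)
qed

lemma left_ideal_carrier: "left_ideal (carrier R) R"
  by (rule left_idealI) auto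

lemma left_ideal_zero: "left_ideal {\<zero>} R"
  by (rule left_idealI) auto

lemma left_ideal_set_add:
  assumes "left_ideal I R" "left_ideal J R" shows "left_ideal (I <+> J) R"
proof -
  note I = left_idealD[OF assms(1)] and J = left_idealD[OF assms(2)]
  show ?thesis
  proof (rule left_idealI)
    show "I <+> J \<subseteq> carrier R" using subsetD[OF I(1)] subsetD[OF J(1)] by (auto simp: mem_set_add_iff)
    have "\<zero> = \<zero> \<oplus> \<zero>" by simp
    then show "\<zero> \<in> I <+> J" unfolding mem_set_add_iff using I(2) J(2) by blast
    show "x \<oplus> y \<in> I <+> J" if "x \<in> I <+> J" "y \<in> I <+> J" for x y
    proof -
      obtain a b a' b' where *: "a \<in> I" "b \<in> J" "x = a \<oplus> b" "a' \<in> I" "b' \<in> J" "y = a' \<oplus> b'"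
        using \<open>x \<in> I <+> J\<close> \<open>y \<in> I <+> J\<close> unfolding mem_set_add_iff by blast
      then have "a \<in> carrier R" "b \<in> carrier R" "a' \<in> carrier R" "b' \<in> carrier R" using I(1) J(1) by auto
      then have "x \<oplus> y = (a \<oplus> a') \<oplus> (b \<oplus> b')" using * by (simp add: a_ac)
      then show ?thesis unfolding mem_set_add_iff using * I(3) J(3) by blast
    qed
    show "r \<otimes> x \<in> I <+> J" if "r \<in> carrier R" "x \<in> I <+> J" for r x
    proof -
      obtain a b where *: "a \<in> I" "b \<in> J" "x = a \<oplus> b"
        using \<open>x \<in> I <+> J\<close> unfolding mem_set_add_iff by blast
      then have "a \<in> carrier R" "b \<in> carrier R" using I(1) J(1) by auto
      then have "r \<otimes> x = r \<otimes> a \<oplus> r \<otimes> b" using * that by (simp add: r_distr)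
      then show ?thesis unfolding mem_set_add_iff using * that I(4) J(4) by blast
    qed
  qed
qed

lemma left_ideal_mult_right:
  assumes "left_ideal J R" "c \<in> carrier R" shows "left_ideal ((\<lambda>y. y \<otimes> c) ` J) R"
proof -
  note J = left_idealD[OF assms(1)]
  show ?thesis
  proof (rule left_idealI)
    show "(\<lambda>y. y \<otimes> c) ` J \<subseteq> carrier R" using J(1) assms(2) by auto
    show "\<zero> \<in> (\<lambda>y. y \<otimes> c) ` J" using J(2) assms(2) by (auto intro!: rev_image_eqI)
    show "x \<oplus> y \<in> (\<lambda>y. y \<otimes> c) ` J" if "x \<in> (\<lambda>y. y \<otimes> c) ` J" "y \<in> (\<lambda>y. y \<otimes> c) ` J" for x y
      using that J(1,3) assms(2) by (auto simp: subset_iff simp flip: l_distr intro!: imageI)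
    show "r \<otimes> x \<in> (\<lambda>y. y \<otimes> c) ` J" if "r \<in> carrier R" "x \<in> (\<lambda>y. y \<otimes> c) ` J" for r x
      using that J(1,4) assms(2) by (auto simp: subset_iff simp flip: m_assoc intro!: imageI)
  qed
qed

text \<open>The set \<open>PIdl a\<close> consists of the products \<open>r \<otimes> a\<close> with
  the factor \<open>r\<close> on the left, so over a noncommutative ring it is Ra.\<close>

lemma left_ideal_PIdl:
  assumes "a \<in> carrier R" shows "left_ideal (PIdl a) R"
proof -
  have "PIdl a = (\<lambda>r. r \<otimes> a) ` carrier R" by (auto simp: cgenideal_def)
  then show ?thesis using left_ideal_mult_right[OF left_ideal_carrier assms] by simp
qed

lemma mem_PIdlI: "r \<in> carrier R \<Longrightarrow> r \<otimes> a \<in> PIdl a"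
  unfolding cgenideal_def by blast

lemma mem_PIdlE:
  assumes "x \<in> PIdl a" obtains r where "r \<in> carrier R" "x = r \<otimes> a"
  using assms unfolding cgenideal_def by blast

lemma self_mem_PIdl: "a \<in> carrier R \<Longrightarrow> a \<in> PIdl a"
  using mem_PIdlI[of \<one> a] by simp

lemma PIdl_subset_iff:
  assumes "left_ideal I R" "a \<in> carrier R"
  shows "PIdl a \<subseteq> I \<longleftrightarrow> a \<in> I"
  using self_mem_PIdl[OF assms(2)] left_idealD(4)[OF assms(1)] by (blast elim: mem_PIdlE)

lemma mem_PIdl_idem_iff:
  assumes "e \<in> carrier R" "e \<otimes> e = e"
  shows "x \<in> PIdl e \<longleftrightarrow> x \<in> carrier R \<and> x \<otimes> e = x"
  using assms mem_PIdlI[of x e] by (auto elim!: mem_PIdlE simp: m_assoc)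

text \<open>This makes principality a finiteness condition: if the union is principal, its generator
  lies in some \<open>I n\<close>, and the chain stops there.\<close>

lemma left_ideal_Union_chain:
  assumes I: "\<And>n::nat. left_ideal (I n) R" and mono: "\<And>n. I n \<subseteq> I (Suc n)"
  shows "left_ideal (\<Union>n. I n) R"
proof (rule left_idealI)
  show "(\<Union>n. I n) \<subseteq> carrier R" "\<zero> \<in> (\<Union>n. I n)"
    using left_idealD(1,2)[OF I] by blast+
  show "x \<oplus> y \<in> (\<Union>n. I n)" if xy: "x \<in> (\<Union>n. I n)" "y \<in> (\<Union>n. I n)" for x y
  proof -
    obtain m n where "x \<in> I m" "y \<in> I n" using xy by blast
    then have "x \<in> I (max m n)" "y \<in> I (max m n)"
      using lift_Suc_mono_le[of I, OF mono] by (meson max.cobounded1 max.cobounded2 subsetD)+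
    then show ?thesis using left_idealD(3)[OF I] by blast
  qed
  show "r \<otimes> x \<in> (\<Union>n. I n)" if "r \<in> carrier R" "x \<in> (\<Union>n. I n)" for r x
    using that left_idealD(4)[OF I] by blast
qed

text \<open>The idempotents \<open>e\<close> such that the left module \<open>Re\<close> is virtually simple: an isomorphism from
  \<open>Re\<close> onto \<open>N\<close> is right multiplication by the image \<open>d\<close> of \<open>e\<close>.\<close>

definition virtually_simple_idem :: "'a \<Rightarrow> bool" where
  "virtually_simple_idem e \<longleftrightarrow> e \<in> carrier R \<and> e \<otimes> e = e \<and> e \<noteq> \<zero> \<and>
    (\<forall>N. left_ideal N R \<and> N \<subseteq> PIdl e \<and> N \<noteq> {\<zero>} \<longrightarrow>
      (\<exists>d \<in> carrier R. e \<otimes> d = d \<and> N = PIdl d \<and> (\<forall>r \<in> carrier R. r \<otimes> d = \<zero> \<longrightarrow> r \<otimes> e = \<zero>)))"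

lemma virtually_simple_idemD:
  assumes "virtually_simple_idem e"
  shows "e \<in> carrier R" "e \<otimes> e = e" "e \<noteq> \<zero>"
  using assms by (auto simp: virtually_simple_idem_def)

text \<open>As \<open>N\<close> lies in Re, its generator satisfies \<open>d \<otimes> e = d\<close>
  as well. So \<open>d\<close> lies in the corner eRe, and right multiplication by it is an
  injective endomorphism of Re with image \<open>N\<close>.\<close>

lemma virtually_simple_idemE:
  assumes "virtually_simple_idem e" "left_ideal N R" "N \<subseteq> PIdl e" "N \<noteq> {\<zero>}"
  obtains d where "d \<in> carrier R" "e \<otimes> d = d" "d \<otimes> e = d" "N = PIdl d"
    "\<And>r. r \<in> carrier R \<Longrightarrow> r \<otimes> d = \<zero> \<Longrightarrow> r \<otimes> e = \<zero>"
proof -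
  obtain d where d: "d \<in> carrier R" "e \<otimes> d = d" "N = PIdl d"
      "\<forall>r \<in> carrier R. r \<otimes> d = \<zero> \<longrightarrow> r \<otimes> e = \<zero>"
    using assms unfolding virtually_simple_idem_def by blast
  moreover have "d \<otimes> e = d"
    using self_mem_PIdl[OF d(1)] d(3) assms(3) mem_PIdl_idem_iff virtually_simple_idemD[OF assms(1)]
    by blast
  ultimately show thesis using that by blast
qed

text \<open>Otherwise the sum of the left ideals \<open>R k c\<^sup>i\<close> would be direct, hence not principal.\<close>

lemma ore_of_virtually_simple_idem:
  assumes e: "virtually_simple_idem e" and k: "k \<in> carrier R" "k \<otimes> e = k"
    and c: "c \<in> carrier R" "e \<otimes> c = c" "c \<otimes> e = c" and "k \<noteq> \<zero>"
    and inj: "\<And>r. r \<in> carrier R \<Longrightarrow> r \<otimes> c = \<zero> \<Longrightarrow> r \<otimes> e = \<zero>"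
  shows "PIdl k \<inter> PIdl c \<noteq> {\<zero>}"
proof
  assume int: "PIdl k \<inter> PIdl c = {\<zero>}"
  note eD = virtually_simple_idemD[OF e]
  \<comment> \<open>\<open>I n\<close> is Rk + Rkc + ... + Rkc^(n-1) in Horner form: everything but
    the first summand is a multiple of \<open>c\<close>, so that one factor \<open>c\<close> can be
    cancelled at a time.\<close>
  define I where "I = rec_nat {\<zero>} (\<lambda>_ J. PIdl k <+> (\<lambda>y. y \<otimes> c) ` J)"
  have I0: "I 0 = {\<zero>}" and IS: "I (Suc n) = {x \<oplus> y \<otimes> c | x y. x \<in> PIdl k \<and> y \<in> I n}" for n
    by (auto simp: I_def set_add_def')
  note kI = left_idealD[OF left_ideal_PIdl[OF k(1)]]
  have lI: "left_ideal (I n) R" for n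
    by (induction n)
      (simp_all add: I_def left_ideal_zero left_ideal_set_add left_ideal_PIdl k(1) left_ideal_mult_right c(1))
  have mono: "I n \<subseteq> I (Suc n)" for n
  proof (induction n)
    case 0 show ?case using left_idealD(2)[OF lI] by (simp add: I0)
  next
    case (Suc n) then show ?case unfolding IS[of n] IS[of "Suc n"] by blast
  qed
  have sub: "I n \<subseteq> PIdl e" for n
  proof (induction n)
    case 0 show ?case using left_idealD(2)[OF left_ideal_PIdl] eD by (simp add: I0)
  next
    case (Suc n)
    have "x \<oplus> y \<otimes> c \<in> PIdl e" if xy: "x \<in> PIdl k" "y \<in> I n" for x y
    proof -
      have "x \<in> PIdl e"
        using xy(1) PIdl_subset_iff[OF left_ideal_PIdl[OF eD(1)] k(1)] k mem_PIdl_idem_iff[OF eD(1,2)] by blast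
      moreover have "y \<otimes> c \<in> PIdl e"
        using subsetD[OF left_idealD(1)[OF lI] xy(2)] c eD(1) mem_PIdl_idem_iff[OF eD(1,2)]
        by (simp add: m_assoc)
      ultimately show ?thesis using left_idealD(3)[OF left_ideal_PIdl[OF eD(1)]] by blast
    qed
    then show ?case by (auto simp: IS)
  qed
  \<comment> \<open>\<open>p n\<close> is kc^n, the generator of the summand that
    \<open>I (Suc n)\<close> has in addition to \<open>I n\<close>.\<close>
  define p where "p = rec_nat k (\<lambda>_ x. x \<otimes> c)"
  have p0: "p 0 = k" and pS: "p (Suc n) = p n \<otimes> c" for n by (simp_all add: p_def)
  have pI: "p n \<in> I (Suc n)" for n
  proof (induction n)
    case 0
    have "k = k \<oplus> \<zero> \<otimes> c" using k c by simp
    then show ?case unfolding IS p0 I0 using self_mem_PIdl[OF k(1)] by blast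
  next
    case (Suc n)
    then have "p n \<in> carrier R" using left_idealD(1)[OF lI] by blast
    then have "p n \<otimes> c = \<zero> \<oplus> p n \<otimes> c" using c by simp
    then show ?case unfolding IS[of "Suc n"] pS using Suc kI(2) by blast
  qed
  have pc: "p n \<in> carrier R" for n using pI left_idealD(1)[OF lI] by blast
  have pe: "p n \<otimes> e = p n" for n using pI[of n] sub mem_PIdl_idem_iff[OF eD(1,2)] by blast
  have pn: "p n \<notin> I n" for n
  proof (induction n)
    case 0 then show ?case using \<open>k \<noteq> \<zero>\<close> by (simp add: p0 I0)
  next
    case (Suc n)
    show ?case
    proof
      assume "p (Suc n) \<in> I (Suc n)"
      then obtain x y where xy: "p n \<otimes> c = x \<oplus> y \<otimes> c" "x \<in> PIdl k" "y \<in> I n" by (auto simp: IS pS)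
      have cl: "x \<in> carrier R" "y \<in> carrier R" using xy kI(1) left_idealD(1)[OF lI] by auto
      \<comment> \<open>The product \<open>(p n \<ominus> y) \<otimes> c\<close> equals the element
        \<open>x\<close> of Rk, hence lies in Rk \<inter> Rc = 0. Injectivity of \<open>c\<close>
        then gives \<open>p n = y\<close>, an element of \<open>I n\<close>.\<close>
      have "(p n \<ominus> y) \<otimes> c = p n \<otimes> c \<ominus> y \<otimes> c"
        using cl pc c by (simp add: a_minus_def l_distr l_minus)
      also have "\<dots> = x" using xy(1) cl c by (simp add: a_minus_def a_assoc r_neg)
      finally have *: "(p n \<ominus> y) \<otimes> c = x" .
      then have "x \<in> PIdl c" using mem_PIdlI[of "p n \<ominus> y" c] pc cl by simp
      then have "x = \<zero>" using int xy(2) by blast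
      then have "(p n \<ominus> y) \<otimes> e = \<zero>" using inj * pc cl by simp
      moreover have "y \<otimes> e = y" using xy(3) sub mem_PIdl_idem_iff[OF eD(1,2)] by blast
      ultimately have "p n \<ominus> y = \<zero>" using pe pc cl eD by (simp add: a_minus_def l_distr l_minus)
      then have "p n = y" using pc cl by (simp add: r_right_minus_eq)
      then show False using Suc xy(3) by blast
    qed
  qed
  have "left_ideal (\<Union>n. I n) R" using lI mono by (rule left_ideal_Union_chain)
  moreover have "k \<in> (\<Union>n. I n)" using pI[of 0] p0 by auto
  then have "(\<Union>n. I n) \<noteq> {\<zero>}" using \<open>k \<noteq> \<zero>\<close> by blast
  ultimately obtain d where d: "d \<in> carrier R" "(\<Union>n. I n) = PIdl d"
    using virtually_simple_idemE[OF e] sub by (metis UN_least)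
  then obtain n where "d \<in> I n" using self_mem_PIdl by blast
  then have "PIdl d \<subseteq> I n" using PIdl_subset_iff[OF lI d(1)] by blast
  then show False using pI[of n] pn[of n] d(2) by blast
qed

text \<open>Right multiplications by \<open>u\<close> and \<open>v\<close> are mutually inverse maps
  between Re and Rf, so this is isomorphism of the two modules, in the form of the algebraic
  Murray-von Neumann equivalence of idempotents.\<close>

definition iso_idem :: "'a \<Rightarrow> 'a \<Rightarrow> bool" where
  "iso_idem e f \<longleftrightarrow> (\<exists>u \<in> carrier R. \<exists>v \<in> carrier R. e \<otimes> u = u \<and> u \<otimes> f = u \<and> f \<otimes> v = v \<and> v \<otimes> e = v \<and>
    u \<otimes> v = e \<and> v \<otimes> u = f)"

lemma iso_idem_sym: "iso_idem e f \<Longrightarrow> iso_idem f e"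
  unfolding iso_idem_def by blast

lemma iso_idem_refl: "e \<in> carrier R \<Longrightarrow> e \<otimes> e = e \<Longrightarrow> iso_idem e e"
  unfolding iso_idem_def by blast

lemma iso_idem_trans:
  assumes "iso_idem e f" "iso_idem f g" shows "iso_idem e g"
proof -
  obtain u v where u: "u \<in> carrier R" "v \<in> carrier R" "e \<otimes> u = u" "u \<otimes> f = u" "f \<otimes> v = v" "v \<otimes> e = v"
    "u \<otimes> v = e" "v \<otimes> u = f" using assms(1) unfolding iso_idem_def by blast
  obtain u' v' where u': "u' \<in> carrier R" "v' \<in> carrier R" "f \<otimes> u' = u'" "u' \<otimes> g = u'" "g \<otimes> v' = v'"
    "v' \<otimes> f = v'" "u' \<otimes> v' = f" "v' \<otimes> u' = g" using assms(2) unfolding iso_idem_def by blast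
  have cl: "e \<in> carrier R" "f \<in> carrier R" "g \<in> carrier R" using u u' by auto
  have "(u \<otimes> u') \<otimes> (v' \<otimes> v) = u \<otimes> (u' \<otimes> v') \<otimes> v" using u(1,2) u'(1,2) by (simp add: m_assoc)
  also have "\<dots> = e" using u u' by simp
  finally have 1: "(u \<otimes> u') \<otimes> (v' \<otimes> v) = e" .
  have "(v' \<otimes> v) \<otimes> (u \<otimes> u') = v' \<otimes> (v \<otimes> u) \<otimes> u'" using u(1,2) u'(1,2) by (simp add: m_assoc)
  also have "\<dots> = g" using u u' by simp
  finally have 2: "(v' \<otimes> v) \<otimes> (u \<otimes> u') = g" .
  have "e \<otimes> (u \<otimes> u') = u \<otimes> u'" "g \<otimes> (v' \<otimes> v) = v' \<otimes> v"
    using u u' cl by (simp_all flip: m_assoc)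
  moreover have "(u \<otimes> u') \<otimes> g = u \<otimes> u'" "(v' \<otimes> v) \<otimes> e = v' \<otimes> v"
    using u u' cl by (simp_all add: m_assoc)
  ultimately show ?thesis unfolding iso_idem_def using 1 2 u(1,2) u'(1,2) m_closed by blast
qed

text \<open>If \<open>t\<close>, \<open>s\<close> split the map \<open>x\<close> from \<open>Re\<close> to \<open>Rf\<close> and its kernel is nonzero, then both the
  kernel and the complement \<open>Rs\<close> are isomorphic to \<open>Re\<close>, contradicting the Ore condition.\<close>

lemma virtually_simple_idem_hom:
  assumes e: "virtually_simple_idem e" and f: "virtually_simple_idem f"
    and x: "x \<in> carrier R" "e \<otimes> x = x" "x \<otimes> f = x" "x \<noteq> \<zero>"
  shows "iso_idem e f" and "\<And>r. r \<in> carrier R \<Longrightarrow> r \<otimes> x = \<zero> \<Longrightarrow> r \<otimes> e = \<zero>"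
proof -
  note eD = virtually_simple_idemD[OF e] and fD = virtually_simple_idemD[OF f]
  have xf: "PIdl x \<subseteq> PIdl f"
    using PIdl_subset_iff[OF left_ideal_PIdl[OF fD(1)] x(1)] mem_PIdl_idem_iff[OF fD(1,2)] x by blast
  have x0: "PIdl x \<noteq> {\<zero>}" using self_mem_PIdl[OF x(1)] x(4) by blast
  \<comment> \<open>The image Rx of the map is a nonzero submodule of Rf, hence a copy Rd of Rf.
    Comparing the generators \<open>x\<close> and \<open>d\<close> gives the factors
    \<open>s0\<close> and \<open>t0\<close>, which are then cut down to fRe and eRf.\<close>
  obtain d where d: "d \<in> carrier R" "f \<otimes> d = d" "d \<otimes> f = d" "PIdl x = PIdl d"
    and dinj: "\<And>r. r \<in> carrier R \<Longrightarrow> r \<otimes> d = \<zero> \<Longrightarrow> r \<otimes> f = \<zero>"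
    using virtually_simple_idemE[OF f left_ideal_PIdl[OF x(1)] xf x0] by blast
  obtain s0 where s0: "s0 \<in> carrier R" "d = s0 \<otimes> x" using self_mem_PIdl[OF d(1)] d(4) mem_PIdlE by metis
  obtain t0 where t0: "t0 \<in> carrier R" "x = t0 \<otimes> d" using self_mem_PIdl[OF x(1)] d(4) mem_PIdlE by metis
  define s where "s = f \<otimes> s0 \<otimes> e"
  define t where "t = e \<otimes> t0 \<otimes> f"
  have s: "s \<in> carrier R" "f \<otimes> s = s" "s \<otimes> e = s"
    unfolding s_def using s0(1) eD fD by (simp_all add: m_assoc) (simp flip: m_assoc)
  have t: "t \<in> carrier R" "e \<otimes> t = t" "t \<otimes> f = t"
    unfolding t_def using t0(1) eD fD by (simp_all add: m_assoc) (simp flip: m_assoc)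
  have sx: "s \<otimes> x = d"
    unfolding s_def using s0 eD fD x d by (metis m_assoc m_closed)
  have td: "t \<otimes> d = x"
    unfolding t_def using t0 eD fD x d by (metis m_assoc m_closed)
  \<comment> \<open>\<open>s \<otimes> t\<close> and \<open>f\<close> have the same product with
    \<open>d\<close>, and \<open>d\<close> acts injectively on Rf. So \<open>s\<close> followed by
    \<open>t\<close> is the identity of Rf, and \<open>t\<close> is a split surjection from Re to
    Rf.\<close>
  have "(s \<otimes> t \<ominus> f) \<otimes> d = s \<otimes> (t \<otimes> d) \<ominus> f \<otimes> d"
    using s t d fD by (simp add: a_minus_def l_distr l_minus m_assoc)
  also have "\<dots> = \<zero>" using td sx d by (simp add: a_minus_def r_neg)
  finally have "(s \<otimes> t \<ominus> f) \<otimes> f = \<zero>" using dinj s t fD by simp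
  then have "s \<otimes> t \<ominus> f = \<zero>" using s t fD by (simp add: a_minus_def l_distr l_minus m_assoc)
  then have st: "s \<otimes> t = f" using s t fD by (simp add: r_right_minus_eq)
  define K where "K = {r \<in> PIdl e. r \<otimes> x = \<zero>}"
  note eI = left_idealD[OF left_ideal_PIdl[OF eD(1)]]
  have lK: "left_ideal K R"
    by (rule left_idealI) (use eI x in \<open>auto simp: K_def l_distr m_assoc subset_iff\<close>)
  have xt: "r \<otimes> t = \<zero>" if "r \<in> carrier R" "r \<otimes> x = \<zero>" for r
  proof -
    have "r \<otimes> t \<otimes> d = \<zero>" using that t(1) d(1) td by (simp add: m_assoc)
    then have "r \<otimes> t \<otimes> f = \<zero>" using dinj that t by simp
    then show ?thesis using that t fD by (simp add: m_assoc)
  qed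
  have "K = {\<zero>}"
  proof (rule ccontr)
    assume "K \<noteq> {\<zero>}"
    then obtain k where k: "k \<in> K" "k \<noteq> \<zero>" using left_idealD(2)[OF lK] by blast
    then have k': "k \<in> carrier R" "k \<otimes> e = k" "k \<otimes> x = \<zero>"
      using mem_PIdl_idem_iff[OF eD(1,2)] by (auto simp: K_def)
    have "s \<noteq> \<zero>" using st fD t by auto
    then have s0': "PIdl s \<noteq> {\<zero>}" using self_mem_PIdl[OF s(1)] by blast
    have "PIdl s \<subseteq> PIdl e"
      using PIdl_subset_iff[OF left_ideal_PIdl[OF eD(1)] s(1)] mem_PIdl_idem_iff[OF eD(1,2)] s by blast
    then obtain c where c: "c \<in> carrier R" "e \<otimes> c = c" "c \<otimes> e = c" "PIdl s = PIdl c"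
      "\<And>r. r \<in> carrier R \<Longrightarrow> r \<otimes> c = \<zero> \<Longrightarrow> r \<otimes> e = \<zero>"
      using virtually_simple_idemE[OF e left_ideal_PIdl[OF s(1)] _ s0'] by blast
    \<comment> \<open>The copy Rs of Rf meets the kernel in 0, since \<open>t\<close> is injective
      on Rs and kills the kernel. The Ore condition for \<open>k\<close> and the generator
      \<open>c\<close> of Rs says the opposite.\<close>
    obtain z where z: "z \<in> PIdl k" "z \<in> PIdl c" "z \<noteq> \<zero>"
      using ore_of_virtually_simple_idem[OF e k'(1,2) c(1-3) k(2) c(5)]
        left_idealD(2)[OF left_ideal_PIdl] k'(1) c(1) by blast
    obtain a where a: "a \<in> carrier R" "z = a \<otimes> k" using z(1) mem_PIdlE by blast
    obtain b where b: "b \<in> carrier R" "z = b \<otimes> s" using z(2) c(4) mem_PIdlE by blast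
    have "z \<otimes> t = \<zero>" using a k' x(1) xt[of z] by (simp add: m_assoc)
    then have "b \<otimes> f = \<zero>" using b s t st by (simp add: m_assoc)
    then have "z = \<zero>" using b s fD by (metis m_assoc l_null)
    then show False using z by blast
  qed
  then show inj: "r \<otimes> e = \<zero>" if "r \<in> carrier R" "r \<otimes> x = \<zero>" for r
  proof -
    have "r \<otimes> e \<in> K" using that mem_PIdlI x eD by (auto simp: K_def m_assoc)
    then show ?thesis using \<open>K = {\<zero>}\<close> by blast
  qed
  \<comment> \<open>\<open>t \<otimes> s\<close> and \<open>e\<close> have the same product with
    \<open>x\<close>, so the injectivity just proved makes \<open>s\<close> a two-sided inverse of
    \<open>t\<close>.\<close>
  have "(e \<ominus> t \<otimes> s) \<otimes> x = \<zero>"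
    using eD s t x sx td by (simp add: a_minus_def l_distr l_minus m_assoc r_neg)
  then have "(e \<ominus> t \<otimes> s) \<otimes> e = \<zero>" using inj eD s t by simp
  then have "e \<ominus> t \<otimes> s = \<zero>" using eD s t by (simp add: a_minus_def l_distr l_minus m_assoc)
  then have "t \<otimes> s = e" using eD s t by (metis r_right_minus_eq m_closed)
  then show "iso_idem e f" unfolding iso_idem_def using s t st by blast
qed

end

section \<open>Corner rings and linear dependence\<close>

text \<open>Acting on Re by right multiplication, this is the endomorphism ring of Re, hence an
  invariant of its isomorphism class. The carrier eRe is given by fixed points, which spares
  existential witnesses.\<close>

definition corner :: "('a, 'r) ring_scheme \<Rightarrow> 'a \<Rightarrow> 'a ring" where
  "corner R e =
    \<lparr>carrier = {x \<in> carrier R. e \<otimes>\<^bsub>R\<^esub> x = x \<and> x \<otimes>\<^bsub>R\<^esub> e = x}, monoid.mult = monoid.mult R,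
     one = e, ring.zero = ring.zero R, ring.add = ring.add R\<rparr>"

lemma corner_simps [simp]:
  "carrier (corner R e) = {x \<in> carrier R. e \<otimes>\<^bsub>R\<^esub> x = x \<and> x \<otimes>\<^bsub>R\<^esub> e = x}"
  "x \<otimes>\<^bsub>corner R e\<^esub> y = x \<otimes>\<^bsub>R\<^esub> y" "\<one>\<^bsub>corner R e\<^esub> = e"
  "\<zero>\<^bsub>corner R e\<^esub> = \<zero>\<^bsub>R\<^esub>" "x \<oplus>\<^bsub>corner R e\<^esub> y = x \<oplus>\<^bsub>R\<^esub> y"
  by (simp_all add: corner_def)

context ring
begin

lemma corner_ring:
  assumes "e \<in> carrier R" "e \<otimes> e = e" shows "ring (corner R e)"
proof (rule ringI)
  show "abelian_group (corner R e)"
  proof (rule abelian_groupI)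
    show "\<exists>y\<in>carrier (corner R e). y \<oplus>\<^bsub>corner R e\<^esub> x = \<zero>\<^bsub>corner R e\<^esub>"
      if "x \<in> carrier (corner R e)" for x
      using that assms by (intro bexI[of _ "\<ominus> x"]) (auto simp: l_neg l_minus r_minus)
  qed (use assms in \<open>auto simp: a_assoc a_comm a_lcomm l_distr r_distr\<close>)
  show "monoid (corner R e)"
  proof (rule monoidI)
    show "x \<otimes>\<^bsub>corner R e\<^esub> y \<in> carrier (corner R e)"
      if "x \<in> carrier (corner R e)" "y \<in> carrier (corner R e)" for x y
    proof -
      have "e \<otimes> (x \<otimes> y) = x \<otimes> y" using that assms by (simp flip: m_assoc)
      moreover have "x \<otimes> y \<otimes> e = x \<otimes> y" using that assms by (simp add: m_assoc)
      ultimately show ?thesis using that by simp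
    qed
  qed (use assms in \<open>auto simp: m_assoc\<close>)
qed (auto simp: l_distr r_distr)

lemma finsum_corner:
  assumes "e \<in> carrier R" "e \<otimes> e = e" "finite A" "f \<in> A \<rightarrow> carrier (corner R e)"
  shows "finsum (corner R e) f A = finsum R f A"
proof -
  interpret C: ring "corner R e" by (rule corner_ring[OF assms(1,2)])
  show ?thesis using assms(3,4)
  proof (induction A)
    case empty then show ?case by simp
  next
    case (insert a A)
    then have "f \<in> A \<rightarrow> carrier R" "f a \<in> carrier R" by (auto simp: Pi_iff)
    then show ?case using insert by (simp add: Pi_iff)
  qed
qed

text \<open>Zero divisors are excluded since nonzero elements of eRe act injectively on Re. For a
  left ideal \<open>L\<close> of eRe, a generator is found for a left ideal of R inside Re and then
  brought back.\<close>

lemma corner_principal_left_ideal_domain: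
  assumes e: "virtually_simple_idem e"
  shows "principal_left_ideal_domain (corner R e)"
proof -
  note eD = virtually_simple_idemD[OF e]
  interpret C: ring "corner R e" by (rule corner_ring[OF eD(1,2)])
  note eI = left_idealD[OF left_ideal_PIdl[OF eD(1)]]
  show ?thesis
  proof (intro principal_left_ideal_domain.intro principal_left_ideal_domain_axioms.intro C.ring_axioms)
    show "\<one>\<^bsub>corner R e\<^esub> \<noteq> \<zero>\<^bsub>corner R e\<^esub>" using eD by simp
  next
    fix a b assume *: "a \<otimes>\<^bsub>corner R e\<^esub> b = \<zero>\<^bsub>corner R e\<^esub>" "a \<in> carrier (corner R e)" "b \<in> carrier (corner R e)"
    show "a = \<zero>\<^bsub>corner R e\<^esub> \<or> b = \<zero>\<^bsub>corner R e\<^esub>"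
      using virtually_simple_idem_hom(2)[OF e e, of b a] * by auto
  next
    fix L assume "left_ideal L (corner R e)"
    note L = C.left_idealD[OF this, simplified]
    \<comment> \<open>The largest left ideal of R inside Re with eN contained in \<open>L\<close>.
      It contains \<open>L\<close>, and unlike the left ideal generated by \<open>L\<close> it is
      described without sums of products.\<close>
    define N where "N = {y \<in> PIdl e. \<forall>r \<in> carrier R. e \<otimes> r \<otimes> y \<in> L}"
    have lN: "left_ideal N R"
    proof (rule left_idealI)
      show "N \<subseteq> carrier R" using eI(1) by (auto simp: N_def)
      show "\<zero> \<in> N" using eI(2) L(2) eD by (auto simp: N_def)
      show "x \<oplus> y \<in> N" if "x \<in> N" "y \<in> N" for x y
        using that eI(1,3) L(3) eD by (auto simp: N_def r_distr subset_iff)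
      fix r x assume *: "r \<in> carrier R" "x \<in> N"
      then have "e \<otimes> s \<otimes> (r \<otimes> x) \<in> L" if "s \<in> carrier R" for s
      proof -
        have "e \<otimes> s \<otimes> (r \<otimes> x) = e \<otimes> (s \<otimes> r) \<otimes> x" using * that eD eI(1) by (auto simp: N_def m_assoc subset_iff)
        then show ?thesis using * that by (simp add: N_def)
      qed
      then show "r \<otimes> x \<in> N" using * eI(4) by (auto simp: N_def)
    qed
    have LN: "l \<in> N" if l: "l \<in> L" for l
    proof -
      have lc: "l \<in> carrier R" "e \<otimes> l = l" "l \<otimes> e = l" using L(1) l by auto
      have "e \<otimes> r \<otimes> l \<in> L" if r: "r \<in> carrier R" for r
      proof -
        have "e \<otimes> r \<otimes> e \<in> carrier (corner R e)" using r eD by (simp add: m_assoc) (simp flip: m_assoc)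
        moreover have "e \<otimes> r \<otimes> e \<otimes> l = e \<otimes> r \<otimes> l" using r eD lc by (simp add: m_assoc)
        ultimately show ?thesis using L(4)[of "e \<otimes> r \<otimes> e" l] l by simp
      qed
      then show ?thesis unfolding N_def using lc mem_PIdl_idem_iff[OF eD(1,2)] by blast
    qed
    show "\<exists>a\<in>carrier (corner R e). L = {x \<otimes>\<^bsub>corner R e\<^esub> a |x. x \<in> carrier (corner R e)}"
    proof (cases "N = {\<zero>}")
      case True
      then have "L = {\<zero>}" using LN L(2) by blast
      then show ?thesis using eD by (intro bexI[of _ \<zero>]) (auto intro!: exI[of _ \<zero>])
    next
      case False
      have "N \<subseteq> PIdl e" by (auto simp: N_def)
      then obtain d where d: "d \<in> carrier R" "e \<otimes> d = d" "d \<otimes> e = d" "N = PIdl d"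
        using virtually_simple_idemE[OF e lN _ False] by blast
      have "d \<in> N" using d self_mem_PIdl by blast
      then have "e \<otimes> \<one> \<otimes> d \<in> L" unfolding N_def by blast
      then have dL: "d \<in> L" using d eD by simp
      have "\<exists>x. l = x \<otimes> d \<and> x \<in> carrier (corner R e)" if l: "l \<in> L" for l
      proof -
        have lc: "l \<in> carrier R" "e \<otimes> l = l" "l \<otimes> e = l" using L(1) l by auto
        obtain r where r: "r \<in> carrier R" "l = r \<otimes> d" using LN[OF l] d(4) mem_PIdlE by blast
        have "l = e \<otimes> r \<otimes> e \<otimes> d" using r lc d eD by (simp add: m_assoc)
        moreover have "e \<otimes> r \<otimes> e \<in> carrier (corner R e)" using r eD by (simp add: m_assoc) (simp flip: m_assoc)
        ultimately show ?thesis by blast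
      qed
      then show ?thesis using L(4) dL d by (intro bexI[of _ d]) auto
    qed
  qed
qed

end

section \<open>Common left multiples and linear dependence over a principal left ideal
  domain\<close>

context principal_left_ideal_domain
begin

text \<open>A nonzero left ideal Ra is a copy of R because right multiplication by \<open>a\<close>
  is injective in a domain. This makes the Ore argument available in the domain itself.\<close>

lemma virtually_simple_idem_one: "virtually_simple_idem \<one>"
  unfolding virtually_simple_idem_def
proof (intro conjI allI impI)
  fix N assume N: "left_ideal N R \<and> N \<subseteq> PIdl \<one> \<and> N \<noteq> {\<zero>}"
  then obtain a where a: "a \<in> carrier R" "N = PIdl a"
    using principal unfolding cgenideal_def by blast
  then have "a \<noteq> \<zero>" using N by (auto simp: cgenideal_def intro!: exI[of _ \<zero>])
  then show "\<exists>d\<in>carrier R. \<one> \<otimes> d = d \<and> N = PIdl d \<and> (\<forall>r\<in>carrier R. r \<otimes> d = \<zero> \<longrightarrow> r \<otimes> \<one> = \<zero>)"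
    using a integral by (intro bexI[of _ a]) auto
qed (use one_not_zero in auto)

text \<open>A nonzero common element of Ra and Rb has the form ca = db, and \<open>c\<close> is
  nonzero because the element is; the case \<open>a = \<zero>\<close> is settled by
  \<open>c = \<one>\<close>.\<close>

lemma left_common_multiple:
  assumes "a \<in> carrier R" "b \<in> carrier R" "b \<noteq> \<zero>"
  obtains c d where "c \<in> carrier R" "d \<in> carrier R" "c \<noteq> \<zero>" "c \<otimes> a = d \<otimes> b"
proof (cases "a = \<zero>")
  case True then show ?thesis using that[of \<one> \<zero>] assms one_not_zero by simp
next
  case False
  have "PIdl a \<inter> PIdl b \<noteq> {\<zero>}"
    using ore_of_virtually_simple_idem[OF virtually_simple_idem_one, of a b] assms False integral by auto
  then obtain z where "z \<in> PIdl a" "z \<in> PIdl b" "z \<noteq> \<zero>"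
    using left_idealD(2)[OF left_ideal_PIdl] assms by blast
  then show ?thesis using that assms by (metis mem_PIdlE l_null)
qed

text \<open>Gaussian elimination in which common left multiples stand in for quotients: a pivot row
  clears the last column, and the rows so shortened are dependent by induction.\<close>

lemma linear_dependence:
  assumes "finite I" "m < card I" "\<And>a b. a \<in> I \<Longrightarrow> b < m \<Longrightarrow> A a b \<in> carrier R"
  shows "\<exists>x. x \<in> I \<rightarrow> carrier R \<and> (\<exists>a\<in>I. x a \<noteq> \<zero>) \<and> (\<forall>b<m. (\<Oplus>a\<in>I. x a \<otimes> A a b) = \<zero>)"
  using assms
proof (induction m arbitrary: I A)
  case 0
  then have "\<exists>a. a \<in> I" by (metis card_gt_0_iff equals0I)
  then show ?case using one_not_zero by (intro exI[of _ "\<lambda>_. \<one>"]) auto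
next
  case (Suc m)
  show ?case
  proof (cases "\<exists>p\<in>I. A p m \<noteq> \<zero>")
    case False
    obtain x where x: "x \<in> I \<rightarrow> carrier R" "\<exists>a\<in>I. x a \<noteq> \<zero>" "\<forall>b<m. (\<Oplus>a\<in>I. x a \<otimes> A a b) = \<zero>"
      using Suc.IH[of I A] Suc.prems by auto
    have "(\<Oplus>a\<in>I. x a \<otimes> A a m) = (\<Oplus>a\<in>I. \<zero>)"
      by (rule finsum_cong') (use False x in \<open>auto simp: Pi_iff\<close>)
    then have "\<forall>b<Suc m. (\<Oplus>a\<in>I. x a \<otimes> A a b) = \<zero>" using x by (simp add: less_Suc_eq)
    then show ?thesis using x by blast
  next
    case True
    then obtain p where p: "p \<in> I" "A p m \<noteq> \<zero>" by blast
    define J where "J = I - {p}"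
    have I: "I = insert p J" and J: "p \<notin> J" "finite J" "m < card J"
      using p Suc.prems(1,2) by (auto simp: J_def card_Diff_singleton)
    have Ac: "A a b \<in> carrier R" if "a \<in> I" "b \<le> m" for a b using Suc.prems(3) that by simp
    have "\<exists>c d. c \<in> carrier R \<and> d \<in> carrier R \<and> c \<noteq> \<zero> \<and> c \<otimes> A a m = d \<otimes> A p m" if "a \<in> I" for a
      using left_common_multiple[OF Ac[OF that order_refl] Ac[OF p(1) order_refl] p(2)] by metis
    then obtain c d where cd: "\<And>a. a \<in> I \<Longrightarrow> c a \<in> carrier R" "\<And>a. a \<in> I \<Longrightarrow> d a \<in> carrier R"
      "\<And>a. a \<in> I \<Longrightarrow> c a \<noteq> \<zero>" "\<And>a. a \<in> I \<Longrightarrow> c a \<otimes> A a m = d a \<otimes> A p m" by metis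
    define B where "B a b = c a \<otimes> A a b \<ominus> d a \<otimes> A p b" for a b
    obtain x where x: "x \<in> J \<rightarrow> carrier R" "\<exists>a\<in>J. x a \<noteq> \<zero>" "\<forall>b<m. (\<Oplus>a\<in>J. x a \<otimes> B a b) = \<zero>"
      using Suc.IH[of J B] J Ac cd I by (auto simp: B_def)
    have xJ: "x a \<in> carrier R" if "a \<in> J" for a using x that by blast
    \<comment> \<open>Back substitution: expanding a relation between the rows \<open>B a\<close>
      gives this relation between the rows of \<open>A\<close>. It stays nontrivial because the
      multipliers \<open>c a\<close> are nonzero in a domain.\<close>
    define y where "y a = (if a = p then \<ominus> (\<Oplus>a\<in>J. x a \<otimes> d a) else x a \<otimes> c a)" for a
    have yI: "y \<in> I \<rightarrow> carrier R" using x cd I J by (auto simp: y_def Pi_iff)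
    obtain q where q: "q \<in> J" "x q \<noteq> \<zero>" using x(2) by blast
    then have "y q \<noteq> \<zero>" "q \<in> I" using integral[of "x q" "c q"] cd xJ J I by (auto simp: y_def)
    then have "\<exists>a\<in>I. y a \<noteq> \<zero>" by blast
    moreover have "(\<Oplus>a\<in>I. y a \<otimes> A a b) = \<zero>" if b: "b < Suc m" for b
    proof -
      have bm: "b \<le> m" using b by simp
      have cl: "x a \<in> carrier R" "c a \<in> carrier R" "d a \<in> carrier R" "A a b \<in> carrier R" if "a \<in> J" for a
        using that xJ cd Ac I bm by auto
      have Ap: "A p b \<in> carrier R" using Ac I bm by auto
      have "(\<Oplus>a\<in>I. y a \<otimes> A a b) = y p \<otimes> A p b \<oplus> (\<Oplus>a\<in>J. y a \<otimes> A a b)"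
        unfolding I using J yI I cl Ap by (subst finsum_insert) (auto simp: Pi_iff)
      also have "(\<Oplus>a\<in>J. y a \<otimes> A a b) = (\<Oplus>a\<in>J. x a \<otimes> B a b \<oplus> x a \<otimes> d a \<otimes> A p b)"
      proof (rule finsum_cong'[OF refl])
        fix a assume a: "a \<in> J"
        then have "a \<noteq> p" using J by blast
        then show "y a \<otimes> A a b = x a \<otimes> B a b \<oplus> x a \<otimes> d a \<otimes> A p b"
          using cl[OF a] Ap
          by (simp add: y_def B_def a_minus_def r_distr r_minus m_assoc a_assoc l_neg)
      qed (use cl Ap in \<open>auto simp: B_def\<close>)
      also have "\<dots> = (\<Oplus>a\<in>J. x a \<otimes> B a b) \<oplus> (\<Oplus>a\<in>J. x a \<otimes> d a \<otimes> A p b)"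
        by (rule finsum_addf) (use cl Ap in \<open>auto simp: B_def\<close>)
      also have "(\<Oplus>a\<in>J. x a \<otimes> d a \<otimes> A p b) = (\<Oplus>a\<in>J. x a \<otimes> d a) \<otimes> A p b"
        by (rule finsum_ldistr[symmetric]) (use cl Ap J in auto)
      also have "(\<Oplus>a\<in>J. x a \<otimes> B a b) = \<zero>"
      \<comment> \<open>The last column lies outside the induction hypothesis, but there every entry
        of \<open>B\<close> vanishes by the choice of \<open>c\<close> and \<open>d\<close>.\<close>
      proof (cases "b = m")
        case True
        have "(\<Oplus>a\<in>J. x a \<otimes> B a b) = (\<Oplus>a\<in>J. \<zero>)"
          by (rule finsum_cong') (use cl cd I Ap True in \<open>auto simp: B_def a_minus_def r_neg\<close>)
        then show ?thesis by simp
      qed (use x(3) bm in auto)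
      finally show ?thesis using cl Ap by (simp add: y_def l_minus l_neg Pi_iff)
    qed
    ultimately show ?thesis using yI by blast
  qed
qed

end

section \<open>Decompositions of the identity\<close>

context ring
begin

definition virtually_simple_decomposition :: "'a set \<Rightarrow> bool" where
  "virtually_simple_decomposition E \<longleftrightarrow> finite E \<and> (\<forall>e\<in>E. virtually_simple_idem e) \<and>
    (\<forall>e\<in>E. \<forall>f\<in>E. e \<noteq> f \<longrightarrow> e \<otimes> f = \<zero>) \<and> (\<Oplus>e\<in>E. e) = \<one>"

lemma orthogonal_idem_sum:
  assumes "finite E" "E \<subseteq> carrier R" "\<And>e f. e \<in> E \<Longrightarrow> f \<in> E \<Longrightarrow> e \<otimes> f = (if e = f then e else \<zero>)" "f \<in> E"
  shows "f \<otimes> (\<Oplus>e\<in>E. e) = f" "(\<Oplus>e\<in>E. e) \<otimes> f = f"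
proof -
  have f: "f \<in> carrier R" using assms by blast
  have "f \<otimes> (\<Oplus>e\<in>E. e) = (\<Oplus>e\<in>E. f \<otimes> e)"
    by (rule finsum_rdistr) (use assms f in auto)
  also have "\<dots> = (\<Oplus>e\<in>E. if f = e then e else \<zero>)"
    by (rule finsum_cong') (use assms in auto)
  also have "\<dots> = f" by (rule finsum_singleton) (use assms in auto)
  finally show "f \<otimes> (\<Oplus>e\<in>E. e) = f" .
  have "(\<Oplus>e\<in>E. e) \<otimes> f = (\<Oplus>e\<in>E. e \<otimes> f)"
    by (rule finsum_ldistr) (use assms f in auto)
  also have "\<dots> = (\<Oplus>e\<in>E. if f = e then e else \<zero>)"
    by (rule finsum_cong') (use assms in auto)
  also have "\<dots> = f" by (rule finsum_singleton) (use assms in auto)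
  finally show "(\<Oplus>e\<in>E. e) \<otimes> f = f" .
qed

lemma virtually_simple_decompositionD:
  assumes "virtually_simple_decomposition E"
  shows "finite E" "\<And>e. e \<in> E \<Longrightarrow> virtually_simple_idem e" "E \<subseteq> carrier R"
    "\<And>e f. e \<in> E \<Longrightarrow> f \<in> E \<Longrightarrow> e \<otimes> f = (if e = f then e else \<zero>)" "(\<Oplus>e\<in>E. e) = \<one>"
  using assms virtually_simple_idemD unfolding virtually_simple_decomposition_def by auto

text \<open>The identity is multiplied out against \<open>x\<close>. In this shape a decomposition
  of the identity yields the faithfulness axioms of \<open>matrix_frame\<close>.\<close>

lemma sum_left_zeroI:
  assumes "(\<Oplus>e\<in>E. g e) = \<one>" "finite E" "g \<in> E \<rightarrow> carrier R" "x \<in> carrier R" "\<And>e. e \<in> E \<Longrightarrow> g e \<otimes> x = \<zero>"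
  shows "x = \<zero>"
proof -
  have "x = (\<Oplus>e\<in>E. g e) \<otimes> x" using assms by simp
  also have "\<dots> = (\<Oplus>e\<in>E. g e \<otimes> x)" by (rule finsum_ldistr) (use assms in auto)
  also have "\<dots> = (\<Oplus>e\<in>E. \<zero>)" by (rule finsum_cong') (use assms in auto)
  finally show ?thesis by simp
qed

lemma sum_right_zeroI:
  assumes "(\<Oplus>e\<in>E. g e) = \<one>" "finite E" "g \<in> E \<rightarrow> carrier R" "x \<in> carrier R" "\<And>e. e \<in> E \<Longrightarrow> x \<otimes> g e = \<zero>"
  shows "x = \<zero>"
proof -
  have "x = x \<otimes> (\<Oplus>e\<in>E. g e)" using assms by simp
  also have "\<dots> = (\<Oplus>e\<in>E. x \<otimes> g e)" by (rule finsum_rdistr) (use assms in auto)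
  also have "\<dots> = (\<Oplus>e\<in>E. \<zero>)" by (rule finsum_cong') (use assms in auto)
  finally show ?thesis by simp
qed

end

section \<open>Submodules of the regular module\<close>

lemma regular_module_simps [simp]:
  "carrier (regular_module R) = carrier R" "x \<oplus>\<^bsub>regular_module R\<^esub> y = x \<oplus>\<^bsub>R\<^esub> y"
  "\<zero>\<^bsub>regular_module R\<^esub> = \<zero>\<^bsub>R\<^esub>" "r \<odot>\<^bsub>regular_module R\<^esub> x = r \<otimes>\<^bsub>R\<^esub> x"
  "regular_module R\<lparr>carrier := carrier R\<rparr> = regular_module R"
  by (simp_all add: regular_module_def)

lemma finsum_regular_module [simp]: "finsum (regular_module R) f A = finsum R f A"
  by (simp add: finsum_def finprod_def regular_module_def)

context ring
begin

abbreviation as_module :: "'a set \<Rightarrow> ('a, 'a) module" where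
  "as_module N \<equiv> regular_module R\<lparr>carrier := N\<rparr>"

lemma left_ideal_Int:
  assumes "left_ideal I R" "left_ideal J R" shows "left_ideal (I \<inter> J) R"
  by (rule left_idealI) (use left_idealD[OF assms(1)] left_idealD[OF assms(2)] in auto)

lemma set_add_upper:
  assumes "left_ideal I R" "left_ideal J R" shows "I \<subseteq> I <+> J" "J \<subseteq> I <+> J"
proof -
  note I = left_idealD[OF assms(1)] and J = left_idealD[OF assms(2)]
  show "I \<subseteq> I <+> J"
  proof
    fix x assume "x \<in> I"
    moreover from this have "x = x \<oplus> \<zero>" using I(1) by auto
    ultimately show "x \<in> I <+> J" unfolding mem_set_add_iff using J(2) by blast
  qed
  show "J \<subseteq> I <+> J"
  proof
    fix x assume "x \<in> J"
    moreover from this have "x = \<zero> \<oplus> x" using J(1) by auto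
    ultimately show "x \<in> I <+> J" unfolding mem_set_add_iff using I(2) by blast
  qed
qed

lemma PIdl_zero: "PIdl \<zero> = {\<zero>}"
proof -
  have "\<zero> \<otimes> \<zero> = \<zero>" by simp
  then show ?thesis unfolding cgenideal_def by force
qed

text \<open>Dictionary between the definitions, which change the carrier of
  \<open>regular_module R\<close>, and left ideals of R, with which the argument works.\<close>

lemma submodule_regular_module_iff:
  assumes "left_ideal N R"
  shows "submodule K R (as_module N) \<longleftrightarrow> left_ideal K R \<and> K \<subseteq> N"
proof
  assume "submodule K R (as_module N)"
  then interpret K: submodule K R "regular_module R\<lparr>carrier := N\<rparr>" .
  have KN: "K \<subseteq> N" using K.subset by simp
  have "left_ideal K R"
  proof (rule left_idealI)
    show "K \<subseteq> carrier R" using KN left_idealD(1)[OF assms] by blast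
    show "\<zero> \<in> K" using K.one_closed by simp
    show "x \<oplus> y \<in> K" if "x \<in> K" "y \<in> K" for x y using K.m_closed[OF that] by simp
    show "r \<otimes> x \<in> K" if "r \<in> carrier R" "x \<in> K" for r x using K.smult_closed[OF that] by simp
  qed
  then show "left_ideal K R \<and> K \<subseteq> N" using KN by blast
next
  assume *: "left_ideal K R \<and> K \<subseteq> N"
  then have "subgroup K (add_monoid R)" "subgroup N (add_monoid R)"
    using assms by (auto simp: left_ideal_def additive_subgroup_def)
  then have "subgroup K (add_monoid R\<lparr>carrier := N\<rparr>)"
    using group.subgroup_incl[OF a_group] * by blast
  then have "subgroup K (add_monoid (as_module N))"
    by (simp add: subgroup_def m_inv_def)
  then show "submodule K R (as_module N)"
    using * left_idealD(4)[of K] by (intro submodule.intro submodule_axioms.intro) auto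
qed

lemma submodule_regular_module_iff':
  "submodule K R (regular_module R) \<longleftrightarrow> left_ideal K R"
  using submodule_regular_module_iff[OF left_ideal_carrier, of K] left_idealD(1)[of K]
  unfolding regular_module_simps by blast

lemma left_module_left_ideal:
  assumes "left_ideal N R" shows "left_module R (as_module N)"
proof -
  note N = left_idealD[OF assms]
  have "abelian_group (as_module N)"
  proof (rule abelian_groupI)
    fix x assume x: "x \<in> carrier (as_module N)"
    then have "x \<in> carrier R" using N(1) by auto
    then have "\<ominus> x \<in> N" "\<ominus> x \<oplus> x = \<zero>"
      using N(2) N(5)[of \<zero> x] x by (auto simp: l_neg a_minus_def)
    then show "\<exists>y\<in>carrier (as_module N). y \<oplus>\<^bsub>regular_module R\<lparr>carrier := N\<rparr>\<^esub> x
      = \<zero>\<^bsub>regular_module R\<lparr>carrier := N\<rparr>\<^esub>" by auto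
  qed (use N(1-3) in \<open>auto simp: subset_iff a_ac\<close>)
  then show ?thesis
    using N(1,4) by (intro left_module.intro left_module_axioms.intro ring_axioms)
      (auto simp: subset_iff l_distr r_distr m_assoc)
qed

text \<open>Isomorphisms are handled through their graphs, since sums of graphs need no well-definedness check.\<close>

definition iso_graph :: "('a \<times> 'a) set \<Rightarrow> 'a set \<Rightarrow> 'a set \<Rightarrow> bool" where
  "iso_graph G N K \<longleftrightarrow>
    (\<forall>a b. (a, b) \<in> G \<longrightarrow> a \<in> N \<and> b \<in> K) \<and> (\<forall>a\<in>N. \<exists>b. (a, b) \<in> G) \<and> (\<forall>b\<in>K. \<exists>a. (a, b) \<in> G) \<and>
    (\<forall>a b a' b'. (a, b) \<in> G \<longrightarrow> (a', b') \<in> G \<longrightarrow> (a \<oplus> a', b \<oplus> b') \<in> G) \<and>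
    (\<forall>r\<in>carrier R. \<forall>a b. (a, b) \<in> G \<longrightarrow> (r \<otimes> a, r \<otimes> b) \<in> G) \<and>
    (\<forall>a b. (a, b) \<in> G \<longrightarrow> (a = \<zero> \<longleftrightarrow> b = \<zero>))"

lemma iso_graphD:
  assumes "iso_graph G N K"
  shows "\<And>a b. (a, b) \<in> G \<Longrightarrow> a \<in> N \<and> b \<in> K" "\<And>a. a \<in> N \<Longrightarrow> \<exists>b. (a, b) \<in> G"
    "\<And>b. b \<in> K \<Longrightarrow> \<exists>a. (a, b) \<in> G"
    "\<And>a b a' b'. (a, b) \<in> G \<Longrightarrow> (a', b') \<in> G \<Longrightarrow> (a \<oplus> a', b \<oplus> b') \<in> G"
    "\<And>r a b. r \<in> carrier R \<Longrightarrow> (a, b) \<in> G \<Longrightarrow> (r \<otimes> a, r \<otimes> b) \<in> G"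
    "\<And>a b. (a, b) \<in> G \<Longrightarrow> a = \<zero> \<longleftrightarrow> b = \<zero>"
  using assms unfolding iso_graph_def by blast+

text \<open>Pairs of a graph can be subtracted, after scaling one of them by
  \<open>\<ominus> \<one>\<close>, and a pair vanishes in one component exactly when it does in the
  other. So the graph is single-valued and injective.\<close>

lemma iso_graph_functional:
  assumes "iso_graph G N K" "N \<subseteq> carrier R" "K \<subseteq> carrier R" "(a, b) \<in> G" "(a', b') \<in> G"
  shows "a = a' \<longleftrightarrow> b = b'"
proof -
  note G = iso_graphD[OF assms(1)]
  have cl: "a \<in> carrier R" "b \<in> carrier R" "a' \<in> carrier R" "b' \<in> carrier R"
    using G(1)[OF assms(4)] G(1)[OF assms(5)] assms(2,3) by auto
  have "(\<ominus> \<one> \<otimes> a', \<ominus> \<one> \<otimes> b') \<in> G" using G(5) assms(5) by simp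
  then have "(a \<oplus> \<ominus> a', b \<oplus> \<ominus> b') \<in> G" using G(4)[OF assms(4)] cl by (simp add: l_minus)
  then have "a \<ominus> a' = \<zero> \<longleftrightarrow> b \<ominus> b' = \<zero>" using G(6) by (simp add: a_minus_def)
  then show ?thesis using cl by simp
qed

lemma module_isomorphic_iff_iso_graph:
  assumes "left_ideal N R" "left_ideal K R"
  shows "module_isomorphic R (as_module N) (as_module K) \<longleftrightarrow>
    (\<exists>G. iso_graph G N K)"
proof
  note N = left_idealD[OF assms(1)] and K = left_idealD[OF assms(2)]
  assume "module_isomorphic R (as_module N) (as_module K)"
  then obtain h where h: "bij_betw h N K" "\<And>x y. x \<in> N \<Longrightarrow> y \<in> N \<Longrightarrow> h (x \<oplus> y) = h x \<oplus> h y"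
    "\<And>r x. r \<in> carrier R \<Longrightarrow> x \<in> N \<Longrightarrow> h (r \<otimes> x) = r \<otimes> h x"
    unfolding module_isomorphic_def by (auto simp: iso_def hom_def)
  have hK: "h x \<in> carrier R" if "x \<in> N" for x using h(1) that K(1) by (auto simp: bij_betw_def)
  have h0: "h \<zero> = \<zero>" using h(3)[of \<zero> \<zero>] N(2) hK by simp
  have "h x = \<zero> \<longleftrightarrow> x = \<zero>" if "x \<in> N" for x
    using h0 h(1) that N(2) unfolding bij_betw_def inj_on_def by metis
  then have "iso_graph ((\<lambda>x. (x, h x)) ` N) N K"
    unfolding iso_graph_def using h N(3,4) by (auto simp: bij_betw_def)
  then show "\<exists>G. iso_graph G N K" by blast
next
  note N = left_idealD[OF assms(1)] and K = left_idealD[OF assms(2)]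
  assume "\<exists>G. iso_graph G N K"
  then obtain G where iG: "iso_graph G N K" by blast
  note G = iso_graphD[OF iG] and Gf = iso_graph_functional[OF iG N(1) K(1)]
  obtain h where h: "\<And>a. a \<in> N \<Longrightarrow> (a, h a) \<in> G" using G(2) by metis
  have hG: "h a = b" if "(a, b) \<in> G" for a b using Gf[OF that h[of a]] G(1)[OF that] by auto
  have "bij_betw h N K"
  proof (rule bij_betw_imageI)
    show "inj_on h N" using h Gf by (metis inj_onI)
    show "h ` N = K"
    proof
      show "h ` N \<subseteq> K" using h G(1) by blast
      show "K \<subseteq> h ` N" using hG G(1,3) by (metis imageI subsetI)
    qed
  qed
  moreover have "h (x \<oplus> y) = h x \<oplus> h y" if "x \<in> N" "y \<in> N" for x y
    using hG G(4)[OF h[OF that(1)] h[OF that(2)]] by blast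
  moreover have "h (r \<otimes> x) = r \<otimes> h x" if "r \<in> carrier R" "x \<in> N" for r x
    using hG G(5)[OF that(1) h[OF that(2)]] by blast
  ultimately show "module_isomorphic R (as_module N) (as_module K)"
    unfolding module_isomorphic_def
    by (intro bexI[of _ h]) (auto simp: iso_def hom_def bij_betw_def)
qed

section \<open>Virtual semisimplicity in terms of left ideals\<close>

definition iso_to_summand :: "'a set \<Rightarrow> 'a set \<Rightarrow> bool" where
  "iso_to_summand N M \<longleftrightarrow> (\<exists>K K' G. left_ideal K R \<and> left_ideal K' R \<and>
    K <+> K' = M \<and> K \<inter> K' = {\<zero>} \<and> iso_graph G N K)"

lemma iso_to_summandE:
  assumes "iso_to_summand N M"
  obtains K K' G where "left_ideal K R" "left_ideal K' R" "K <+> K' = M" "K \<inter> K' = {\<zero>}" "iso_graph G N K"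
  using assms unfolding iso_to_summand_def by (elim exE conjE) (rule that)

lemma direct_summand_iff:
  assumes "left_ideal M R"
  shows "direct_summand R (as_module M) K \<longleftrightarrow> left_ideal K R \<and> K \<subseteq> M \<and>
    (\<exists>K'. left_ideal K' R \<and> K' \<subseteq> M \<and> K <+> K' = M \<and> K \<inter> K' = {\<zero>})"
proof -
  have "A <+>\<^bsub>regular_module R\<lparr>carrier := M\<rparr>\<^esub> B = A <+> B" for A B
    by (auto simp: set_add_def')
  then show ?thesis
    unfolding direct_summand_def submodule_regular_module_iff[OF assms] by simp
qed

lemma left_completely_virtually_semisimple_ringD:
  assumes "left_completely_virtually_semisimple_ring R" "left_ideal M R" "left_ideal N R" "N \<subseteq> M"
  shows "iso_to_summand N M"
proof -
  have "virtually_semisimple R (as_module M)"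
    using assms(1,2)
    by (simp add: left_completely_virtually_semisimple_ring_def completely_virtually_semisimple_def
        submodule_regular_module_iff')
  moreover have "submodule N R (as_module M)"
    using assms(3,4) submodule_regular_module_iff[OF assms(2)] by simp
  ultimately have "\<exists>K. direct_summand R (as_module M) K \<and>
      module_isomorphic R (as_module N) (as_module K)"
    by (simp add: virtually_semisimple_def)
  then obtain K where K: "direct_summand R (as_module M) K"
    "module_isomorphic R (as_module N) (as_module K)" by (elim exE conjE)
  from K(1)[unfolded direct_summand_iff[OF assms(2)]] obtain K' where
    K': "left_ideal K R" "left_ideal K' R" "K <+> K' = M" "K \<inter> K' = {\<zero>}" by (elim conjE exE)
  obtain G where "iso_graph G N K" using K(2) module_isomorphic_iff_iso_graph[OF assms(3) K'(1)] by blast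
  then show ?thesis unfolding iso_to_summand_def using K' by (intro exI conjI)
qed

lemma left_completely_virtually_semisimple_ringI:
  assumes "\<And>M N. \<lbrakk>left_ideal M R; left_ideal N R; N \<subseteq> M\<rbrakk> \<Longrightarrow> iso_to_summand N M"
  shows "left_completely_virtually_semisimple_ring R"
proof -
  have "\<exists>K. direct_summand R (as_module M) K \<and>
      module_isomorphic R (as_module N) (as_module K)"
    if M: "left_ideal M R" and N: "left_ideal N R" "N \<subseteq> M" for M N
  proof -
    obtain K K' G where K: "left_ideal K R" "left_ideal K' R" "K <+> K' = M" "K \<inter> K' = {\<zero>}" "iso_graph G N K"
      by (rule iso_to_summandE[OF assms[OF M N]])
    have "K \<subseteq> M" "K' \<subseteq> M" using set_add_upper[OF K(1,2)] K(3) by auto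
    then have "direct_summand R (as_module M) K"
      unfolding direct_summand_iff[OF M] using K(1-4) by (intro conjI exI[of _ K'])
    then show ?thesis using module_isomorphic_iff_iso_graph[OF N(1) K(1)] K(5) by blast
  qed
  then show ?thesis
    unfolding left_completely_virtually_semisimple_ring_def completely_virtually_semisimple_def virtually_semisimple_def
    by (simp add: regular_module_left_module submodule_regular_module_iff' submodule_regular_module_iff left_module_left_ideal)
qed

text \<open>\<open>d\<close> is the partner of \<open>e\<close> in the graph, and idempotence of
  \<open>e\<close> carries over to \<open>e \<otimes> d = d\<close>. Conversely the pairs (rd, re)
  form a graph: rd = (re)d gives one half of the zero condition, the annihilator hypothesis the
  other.\<close>

lemma iso_graph_PIdl_iff:
  assumes e: "e \<in> carrier R" "e \<otimes> e = e" and N: "left_ideal N R"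
  shows "(\<exists>G. iso_graph G N (PIdl e)) \<longleftrightarrow>
    (\<exists>d \<in> carrier R. e \<otimes> d = d \<and> N = PIdl d \<and> (\<forall>r \<in> carrier R. r \<otimes> d = \<zero> \<longrightarrow> r \<otimes> e = \<zero>))"
proof
  assume "\<exists>G. iso_graph G N (PIdl e)"
  then obtain G where iG: "iso_graph G N (PIdl e)" by blast
  note lI = left_ideal_PIdl[OF e(1)] and mI = mem_PIdl_idem_iff[OF e]
  note G = iso_graphD[OF iG]
    and Gf = iso_graph_functional[OF iG left_idealD(1)[OF N] left_idealD(1)[OF lI]]
  obtain d where d: "(d, e) \<in> G" using G(3) self_mem_PIdl[OF e(1)] by blast
  have dN: "d \<in> N" using G(1)[OF d] by blast
  then have dc: "d \<in> carrier R" using left_idealD(1)[OF N] by blast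
  have "e \<otimes> d = d" using Gf[OF G(5)[OF e(1) d] d] e by simp
  moreover have "N = PIdl d"
  proof
    show "PIdl d \<subseteq> N" using PIdl_subset_iff[OF N dc] dN by blast
    show "N \<subseteq> PIdl d"
    proof
      fix x assume "x \<in> N"
      then obtain y where y: "(x, y) \<in> G" using G(2) by blast
      then have "y \<in> carrier R" "y \<otimes> e = y" using G(1) mI by blast+
      then have "x = y \<otimes> d" using Gf[OF y G(5)[OF _ d]] by simp
      then show "x \<in> PIdl d" using mem_PIdlI \<open>y \<in> carrier R\<close> by simp
    qed
  qed
  moreover have "r \<otimes> e = \<zero>" if "r \<in> carrier R" "r \<otimes> d = \<zero>" for r
    using G(6)[OF G(5)[OF that(1) d]] that by simp
  ultimately show "\<exists>d \<in> carrier R. e \<otimes> d = d \<and> N = PIdl d \<and> (\<forall>r \<in> carrier R. r \<otimes> d = \<zero> \<longrightarrow> r \<otimes> e = \<zero>)"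
    using dc by blast
next
  assume "\<exists>d \<in> carrier R. e \<otimes> d = d \<and> N = PIdl d \<and> (\<forall>r \<in> carrier R. r \<otimes> d = \<zero> \<longrightarrow> r \<otimes> e = \<zero>)"
  then obtain d where d: "d \<in> carrier R" "e \<otimes> d = d" "N = PIdl d"
    "\<And>r. r \<in> carrier R \<Longrightarrow> r \<otimes> d = \<zero> \<Longrightarrow> r \<otimes> e = \<zero>" by blast
  have rd: "r \<otimes> d = (r \<otimes> e) \<otimes> d" if "r \<in> carrier R" for r using that d(1,2) e by (simp add: m_assoc)
  define G where "G = {(r \<otimes> d, r \<otimes> e) | r. r \<in> carrier R}"
  have "iso_graph G N (PIdl e)"
    unfolding iso_graph_def
  proof (intro conjI allI ballI impI)
    fix a b assume ab: "(a, b) \<in> G"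
    then obtain r where r: "r \<in> carrier R" "a = r \<otimes> d" "b = r \<otimes> e" by (auto simp: G_def)
    show "a \<in> N" "b \<in> PIdl e" unfolding r d(3) using r(1) by (auto intro: mem_PIdlI)
    show "a = \<zero> \<longleftrightarrow> b = \<zero>" unfolding r using d(4) rd[OF r(1)] l_null[OF d(1)] r(1) by auto
    have "s \<otimes> a = (s \<otimes> r) \<otimes> d" "s \<otimes> b = (s \<otimes> r) \<otimes> e" if "s \<in> carrier R" for s
      using that r d(1) e(1) by (auto simp: m_assoc)
    then show "(s \<otimes> a, s \<otimes> b) \<in> G" if "s \<in> carrier R" for s
      unfolding G_def using that r(1) by blast
    fix a' b' assume "(a', b') \<in> G"
    then obtain r' where r': "r' \<in> carrier R" "a' = r' \<otimes> d" "b' = r' \<otimes> e" by (auto simp: G_def)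
    have "a \<oplus> a' = (r \<oplus> r') \<otimes> d" "b \<oplus> b' = (r \<oplus> r') \<otimes> e"
      using r r' d(1) e(1) by (auto simp: l_distr)
    then show "(a \<oplus> a', b \<oplus> b') \<in> G" unfolding G_def using r(1) r'(1) by blast
  next
    show "\<exists>b. (a, b) \<in> G" if "a \<in> N" for a
      using that unfolding d(3) G_def by (blast elim: mem_PIdlE)
    show "\<exists>a. (a, b) \<in> G" if "b \<in> PIdl e" for b
      using that unfolding G_def by (blast elim: mem_PIdlE)
  qed
  then show "\<exists>G. iso_graph G N (PIdl e)" by blast
qed

text \<open>This justifies \<open>virtually_simple_idem\<close>: with submodules read as left
  ideals, and isomorphisms onto Re as generators \<open>d\<close>, the two definitions agree clause
  by clause.\<close>

lemma virtually_simple_PIdl_iff: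
  assumes e: "e \<in> carrier R" "e \<otimes> e = e"
  shows "virtually_simple R (as_module (PIdl e)) \<longleftrightarrow> virtually_simple_idem e"
proof -
  note lI = left_ideal_PIdl[OF e(1)]
  have e0: "PIdl e = {\<zero>} \<longleftrightarrow> e = \<zero>"
    using self_mem_PIdl[OF e(1)] PIdl_zero by auto
  have "(submodule N R (as_module (PIdl e)) \<and> N \<noteq> {\<zero>} \<longrightarrow>
      module_isomorphic R (as_module N) (as_module (PIdl e))) \<longleftrightarrow>
      (left_ideal N R \<and> N \<subseteq> PIdl e \<and> N \<noteq> {\<zero>} \<longrightarrow>
      (\<exists>d \<in> carrier R. e \<otimes> d = d \<and> N = PIdl d \<and> (\<forall>r \<in> carrier R. r \<otimes> d = \<zero> \<longrightarrow> r \<otimes> e = \<zero>)))" for N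
  proof (cases "left_ideal N R")
    case True
    show ?thesis
      unfolding submodule_regular_module_iff[OF lI] module_isomorphic_iff_iso_graph[OF True lI] iso_graph_PIdl_iff[OF e True]
      using True by simp
  next
    case False
    then show ?thesis unfolding submodule_regular_module_iff[OF lI] by simp
  qed
  then show ?thesis
    unfolding virtually_simple_def virtually_simple_idem_def
    using left_module_left_ideal[OF lI] e e0 by simp
qed

end

section \<open>Left ideals filtered by virtually simple modules\<close>

context ring
begin

text \<open>Since rx = (re)x, the condition on \<open>x\<close> says at once that Rx is a copy of Re
  and that it meets \<open>M\<close> in 0. So these are the finite direct sums of copies of
  virtually simple Re. The generators \<open>x\<close> may fail to be idempotent, which lets the
  class pass to smaller left ideals.\<close>

inductive virtually_simple_filtered :: "'a set \<Rightarrow> bool" where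
  zero: "virtually_simple_filtered {\<zero>}"
| step: "\<lbrakk>virtually_simple_filtered M; virtually_simple_idem e; x \<in> carrier R; e \<otimes> x = x;
    \<forall>r\<in>carrier R. r \<otimes> x \<in> M \<longrightarrow> r \<otimes> e = \<zero>\<rbrakk> \<Longrightarrow> virtually_simple_filtered (PIdl x <+> M)"

lemma left_ideal_filtered: "virtually_simple_filtered M \<Longrightarrow> left_ideal M R"
  by (induction rule: virtually_simple_filtered.induct)
     (auto intro: left_ideal_zero left_ideal_set_add left_ideal_PIdl)

lemma mem_PIdl_set_add_iff:
  "z \<in> PIdl x <+> M \<longleftrightarrow> (\<exists>r\<in>carrier R. \<exists>m\<in>M. z = r \<otimes> x \<oplus> m)"
  unfolding mem_set_add_iff cgenideal_def by blast

text \<open>A submodule of an extension of \<open>Re\<close> by \<open>M\<close> either lies in \<open>M\<close>, or its image in \<open>Re\<close> is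
  isomorphic to \<open>Re\<close> and, this being projective, splits off.\<close>

lemma left_ideal_of_step_cases:
  assumes M: "left_ideal M R" and e: "virtually_simple_idem e" and x: "x \<in> carrier R" "e \<otimes> x = x"
    and ind: "\<And>r. r \<in> carrier R \<Longrightarrow> r \<otimes> x \<in> M \<Longrightarrow> r \<otimes> e = \<zero>"
    and N: "left_ideal N R" "N \<subseteq> PIdl x <+> M"
  obtains "N \<subseteq> M"
  | y where "y \<in> N" "e \<otimes> y = y" "\<And>r. r \<in> carrier R \<Longrightarrow> r \<otimes> y \<in> M \<Longrightarrow> r \<otimes> e = \<zero>"
      "N = PIdl y <+> (N \<inter> M)"
proof -
  note eD = virtually_simple_idemD[OF e] and MI = left_idealD[OF M] and NI = left_idealD[OF N(1)]
  \<comment> \<open>The image of \<open>N\<close> under the projection of Rx \<oplus> M to Rx,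
    transported to Re.\<close>
  define L where "L = {r \<in> carrier R. r \<otimes> e = r \<and> r \<otimes> x \<in> N <+> M}"
  note NM = left_ideal_set_add[OF N(1) M]
  have lL: "left_ideal L R"
    by (rule left_idealI) (use left_idealD(2-4)[OF NM] x eD in \<open>auto simp: L_def l_distr m_assoc\<close>)
  have reL: "r \<otimes> e \<in> L" "r \<otimes> e \<otimes> x = r \<otimes> x" if r: "r \<in> carrier R" "m \<in> M" "r \<otimes> x \<oplus> m \<in> N" for r m
  proof -
    show *: "r \<otimes> e \<otimes> x = r \<otimes> x" using r x eD by (simp add: m_assoc)
    have "m \<in> carrier R" using r MI(1) by auto
    then have "r \<otimes> x = (r \<otimes> x \<oplus> m) \<oplus> (\<zero> \<ominus> m)" using r x(1) by (simp add: a_minus_def a_assoc r_neg)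
    then have "r \<otimes> x \<in> N <+> M" unfolding mem_set_add_iff using r(3) MI(5)[OF MI(2) r(2)] by blast
    then show "r \<otimes> e \<in> L" unfolding L_def using * r(1) eD by (simp add: m_assoc)
  qed
  show thesis
  proof (cases "L = {\<zero>}")
    case True
    have "N \<subseteq> M"
    proof
      fix n assume n: "n \<in> N"
      then obtain r m where rm: "r \<in> carrier R" "m \<in> M" "n = r \<otimes> x \<oplus> m"
        using N(2) unfolding subset_iff mem_PIdl_set_add_iff by blast
      then have "r \<otimes> e = \<zero>" "r \<otimes> e \<otimes> x = r \<otimes> x" using reL n True by blast+
      then have "n = m" using rm MI(1) x by auto
      then show "n \<in> M" using rm by simp
    qed
    then show ?thesis by (rule that(1))
  next
    case False
    have "L \<subseteq> PIdl e" using mem_PIdl_idem_iff[OF eD(1,2)] by (auto simp: L_def)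
    then obtain d where d: "d \<in> carrier R" "e \<otimes> d = d" "d \<otimes> e = d" "L = PIdl d"
      "\<And>r. r \<in> carrier R \<Longrightarrow> r \<otimes> d = \<zero> \<Longrightarrow> r \<otimes> e = \<zero>"
      using virtually_simple_idemE[OF e lL _ False] by blast
    then have "d \<in> L" using self_mem_PIdl by blast
    then obtain a m' where am: "a \<in> N" "m' \<in> M" "d \<otimes> x = a \<oplus> m'"
      unfolding L_def mem_set_add_iff by blast
    define m where "m = \<zero> \<ominus> m'"
    have "a \<in> carrier R" "m' \<in> carrier R" using am NI(1) MI(1) by auto
    then have "d \<otimes> x \<oplus> m = a" unfolding am(3) m_def by (simp add: a_minus_def a_assoc r_neg)
    then have m: "m \<in> M" "d \<otimes> x \<oplus> m \<in> N" using MI(5)[OF MI(2) am(2)] am(1) by (simp_all add: m_def)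
    have mc: "m \<in> carrier R" using m MI(1) by auto
    \<comment> \<open>\<open>d \<otimes> x \<oplus> m\<close> lifts the generator \<open>d\<close>
      of the image to \<open>N\<close>. Multiplying by \<open>e\<close> makes the lift fixed by
      \<open>e\<close>, so that re \<mapsto> ry is a map from Re to \<open>N\<close>; this is where
      projectivity of Re is used.\<close>
    define y where "y = e \<otimes> (d \<otimes> x \<oplus> m)"
    have yN: "y \<in> N" unfolding y_def using NI(4) m eD by blast
    have yc: "y \<in> carrier R" using yN NI(1) by auto
    have ey: "e \<otimes> y = y" unfolding y_def using eD d x mc by (simp flip: m_assoc)
    have y: "y = d \<otimes> x \<oplus> e \<otimes> m" unfolding y_def using eD d x mc by (simp add: r_distr flip: m_assoc)
    have sy: "s \<otimes> y = (s \<otimes> d) \<otimes> x \<oplus> (s \<otimes> e) \<otimes> m" if "s \<in> carrier R" for s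
      unfolding y using that d eD x mc by (simp add: r_distr m_assoc)
    have emM: "(s \<otimes> e) \<otimes> m \<in> M" if "s \<in> carrier R" for s using MI(4) m(1) that eD by blast
    have yind: "r \<otimes> e = \<zero>" if r: "r \<in> carrier R" "r \<otimes> y \<in> M" for r
    proof -
      have "r \<otimes> y \<ominus> (r \<otimes> e) \<otimes> m = (r \<otimes> d) \<otimes> x"
        unfolding sy[OF r(1)] using r(1) d(1) x(1) mc eD by (simp add: a_minus_def a_assoc r_neg)
      then have "(r \<otimes> d) \<otimes> x \<in> M" using MI(5)[OF r(2) emM[OF r(1)]] by simp
      then have "(r \<otimes> d) \<otimes> e = \<zero>" using ind r d by simp
      then have "r \<otimes> d = \<zero>" using r d eD by (simp add: m_assoc)
      then show ?thesis using d(5) r by blast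
    qed
    have "N = PIdl y <+> (N \<inter> M)"
    proof
      show "PIdl y <+> (N \<inter> M) \<subseteq> N"
        unfolding subset_iff mem_PIdl_set_add_iff using NI(3,4) yN by blast
      show "N \<subseteq> PIdl y <+> (N \<inter> M)"
      proof
        fix n assume n: "n \<in> N"
        then obtain r m' where rm: "r \<in> carrier R" "m' \<in> M" "n = r \<otimes> x \<oplus> m'"
          using N(2) unfolding subset_iff mem_PIdl_set_add_iff by blast
        have m'c: "m' \<in> carrier R" using rm MI(1) by auto
        \<comment> \<open>The first component of \<open>n\<close> is a multiple of \<open>d\<close>;
          subtracting the same multiple of \<open>y\<close> leaves an element of
          \<open>M\<close>.\<close>
        obtain s where s: "s \<in> carrier R" "r \<otimes> e = s \<otimes> d" using reL rm n d(4) mem_PIdlE by metis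
        have sdx: "(s \<otimes> d) \<otimes> x = r \<otimes> x" using reL(2) rm n s by metis
        have nc: "n \<in> carrier R" using n NI(1) by auto
        have syc: "s \<otimes> y \<in> carrier R" using s yc by simp
        have 1: "n = s \<otimes> y \<oplus> (n \<ominus> s \<otimes> y)"
          using nc syc by (simp add: a_minus_def a_lcomm r_neg)
        have "n \<ominus> s \<otimes> y = m' \<ominus> (s \<otimes> e) \<otimes> m"
          unfolding sy[OF s(1)] sdx rm(3) using rm(1) s(1) x(1) m'c mc eD
          by (simp add: a_minus_def minus_add a_ac r_neg2)
        then have "n \<ominus> s \<otimes> y \<in> M" using MI(5) rm(2) emM[OF s(1)] by simp
        moreover have "n \<ominus> s \<otimes> y \<in> N" using NI(5)[OF n] NI(4) s(1) yN by blast
        ultimately show "n \<in> PIdl y <+> (N \<inter> M)"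
          unfolding mem_PIdl_set_add_iff using 1 s(1) by blast
      qed
    qed
    then show ?thesis using that(2) yN ey yind by blast
  qed
qed

lemma set_add_assoc:
  assumes "A \<subseteq> carrier R" "B \<subseteq> carrier R" "C \<subseteq> carrier R"
  shows "(A <+> B) <+> C = A <+> (B <+> C)"
  using add.set_mult_assoc[of A B C] assms by (simp add: set_add_def)

text \<open>If \<open>N\<close> lies in the smaller \<open>M\<close>, the complement found there is
  enlarged by Rx. Otherwise \<open>N\<close> splits as Ry plus its part in \<open>M\<close>, and the
  matching summand is enlarged by Rx, a copy of Ry. The filtration of \<open>N\<close> is carried
  along so that the result can be applied again with \<open>N\<close> as the ambient left
  ideal.\<close>

lemma filtered_virtually_semisimple:
  assumes "virtually_simple_filtered M" "left_ideal N R" "N \<subseteq> M"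
  shows "virtually_simple_filtered N \<and> iso_to_summand N M"
  using assms
proof (induction arbitrary: N rule: virtually_simple_filtered.induct)
  case zero
  then have "N = {\<zero>}" using left_idealD(2) by blast
  then have "iso_graph {(\<zero>, \<zero>)} N {\<zero>}" by (simp add: iso_graph_def)
  moreover have "{\<zero>} <+> {\<zero>} = {\<zero>}" by (simp add: set_add_def')
  ultimately show ?case unfolding iso_to_summand_def
    using left_ideal_zero virtually_simple_filtered.zero \<open>N = {\<zero>}\<close> by (metis Int_absorb)
next
  case (step M e x)
  have lM: "left_ideal M R" using left_ideal_filtered step.hyps(1) .
  have ind: "\<And>r. r \<in> carrier R \<Longrightarrow> r \<otimes> x \<in> M \<Longrightarrow> r \<otimes> e = \<zero>" using step.hyps by blast
  note eD = virtually_simple_idemD[OF step.hyps(2)] and MI = left_idealD[OF lM]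
  note x = step.hyps(3,4) and lx = left_ideal_PIdl[OF step.hyps(3)]
  note xI = left_idealD[OF lx]
  have rx0: "r \<otimes> x = \<zero>" if "r \<in> carrier R" "r \<otimes> x \<in> M" for r
  proof -
    have "r \<otimes> x = r \<otimes> e \<otimes> x" using that x eD by (simp add: m_assoc)
    then show ?thesis using ind[OF that] x by simp
  qed
  \<comment> \<open>Directness of the sum Rx + M; it gives both trivial intersections below and half
    of the zero condition for the new graph.\<close>
  have rx0': "r \<otimes> x = \<zero> \<and> k = k'"
    if "r \<in> carrier R" "k \<in> M" "k' \<in> M" "r \<otimes> x \<oplus> k = k'" for r k k'
  proof -
    have c: "k \<in> carrier R" "k' \<in> carrier R" using that MI(1) by auto
    have "r \<otimes> x = k' \<ominus> k"
      unfolding that(4)[symmetric] using that(1) c x by (simp add: a_minus_def a_assoc r_neg)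
    then have "r \<otimes> x = \<zero>" using rx0 that(1) MI(5)[OF that(3,2)] by simp
    then show ?thesis using that(4) c by simp
  qed
  show ?case
  proof (rule left_ideal_of_step_cases[OF lM step.hyps(2-4) ind step.prems])
    assume "N \<subseteq> M"
    then have IH: "virtually_simple_filtered N" "iso_to_summand N M"
      using step.IH[OF step.prems(1)] by simp_all
    obtain K K' G where K: "left_ideal K R" "left_ideal K' R" "K <+> K' = M" "K \<inter> K' = {\<zero>}" "iso_graph G N K"
      by (rule iso_to_summandE[OF IH(2)])
    note KI = left_idealD[OF K(1)] and K'I = left_idealD[OF K(2)]
    have KM: "K \<subseteq> M" "K' \<subseteq> M" using set_add_upper[OF K(1,2)] K(3) by auto
    have "K <+> (PIdl x <+> K') = PIdl x <+> M"
      using set_add_assoc[OF xI(1) KI(1) K'I(1)] set_add_assoc[OF KI(1) xI(1) K'I(1)] set_add_comm[OF KI(1) xI(1)]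
      unfolding K(3)[symmetric] by simp
    moreover have "K \<inter> (PIdl x <+> K') = {\<zero>}"
    proof -
      have "k = \<zero>" if k: "k \<in> K" "k \<in> PIdl x <+> K'" for k
      proof -
        obtain r k' where r: "r \<in> carrier R" "k' \<in> K'" "k = r \<otimes> x \<oplus> k'"
          using k(2) unfolding mem_PIdl_set_add_iff by blast
        have "k' = k" using rx0'[OF r(1) subsetD[OF KM(2) r(2)] subsetD[OF KM(1) k(1)] r(3)[symmetric]] by simp
        then have "k \<in> K \<inter> K'" using k(1) r(2) by simp
        then show ?thesis using K(4) by simp
      qed
      then show ?thesis using KI(2) left_idealD(2)[OF left_ideal_set_add[OF lx K(2)]] by blast
    qed
    ultimately show ?thesis unfolding iso_to_summand_def using K(1,5) left_ideal_set_add[OF lx K(2)] IH(1) by blast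
  next
    fix y assume y: "y \<in> N" "e \<otimes> y = y" "\<And>r. r \<in> carrier R \<Longrightarrow> r \<otimes> y \<in> M \<Longrightarrow> r \<otimes> e = \<zero>"
      and Ny: "N = PIdl y <+> (N \<inter> M)"
    have "left_ideal (N \<inter> M) R" using left_ideal_Int[OF step.prems(1) lM] .
    then have IH: "virtually_simple_filtered (N \<inter> M)" "iso_to_summand (N \<inter> M) M"
      using step.IH[of "N \<inter> M"] by simp_all
    obtain K K' G where K: "left_ideal K R" "left_ideal K' R" "K <+> K' = M" "K \<inter> K' = {\<zero>}"
      "iso_graph G (N \<inter> M) K"
      by (rule iso_to_summandE[OF IH(2)])
    note KI = left_idealD[OF K(1)] and K'I = left_idealD[OF K(2)] and G = iso_graphD[OF K(5)]
    have KM: "K \<subseteq> M" "K' \<subseteq> M" using set_add_upper[OF K(1,2)] K(3) by auto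
    have yc: "y \<in> carrier R" using y(1) left_idealD(1)[OF step.prems(1)] by auto
    have "(PIdl x <+> K) <+> K' = PIdl x <+> M"
      using set_add_assoc[OF xI(1) KI(1) K'I(1)] unfolding K(3) .
    moreover have "(PIdl x <+> K) \<inter> K' = {\<zero>}"
    proof -
      have "k' = \<zero>" if k': "k' \<in> K'" "k' \<in> PIdl x <+> K" for k'
      proof -
        obtain r k where r: "r \<in> carrier R" "k \<in> K" "k' = r \<otimes> x \<oplus> k"
          using k'(2) unfolding mem_PIdl_set_add_iff by blast
        have "k = k'" using rx0'[OF r(1) subsetD[OF KM(1) r(2)] subsetD[OF KM(2) k'(1)] r(3)[symmetric]] by simp
        then have "k' \<in> K \<inter> K'" using k'(1) r(2) by simp
        then show ?thesis using K(4) by simp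
      qed
      then show ?thesis using K'I(2) left_idealD(2)[OF left_ideal_set_add[OF lx K(1)]] by blast
    qed
    \<comment> \<open>The sum of the graph ry \<mapsto> rx and the graph \<open>G\<close> obtained
      by induction.\<close>
    moreover have "iso_graph {(r \<otimes> y \<oplus> a, r \<otimes> x \<oplus> b) | r a b. r \<in> carrier R \<and> (a, b) \<in> G} N (PIdl x <+> K)"
      (is "iso_graph ?G _ _")
      unfolding iso_graph_def
    proof (intro conjI allI ballI impI)
      fix a b assume "(a, b) \<in> ?G"
      then obtain r a1 b1 where r: "r \<in> carrier R" "(a1, b1) \<in> G" "a = r \<otimes> y \<oplus> a1" "b = r \<otimes> x \<oplus> b1" by blast
      have ab: "a1 \<in> N \<inter> M" "b1 \<in> K" "a1 \<in> carrier R" "b1 \<in> carrier R"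
        using G(1)[OF r(2)] MI(1) KI(1) by auto
      have "a \<in> PIdl y <+> (N \<inter> M)" unfolding mem_PIdl_set_add_iff using r(1,3) ab(1) by blast
      then show "a \<in> N" by (rule subsetD[OF equalityD2[OF Ny]])
      show "b \<in> PIdl x <+> K" unfolding mem_PIdl_set_add_iff using r(1,4) ab(2) by blast
      show "a = \<zero> \<longleftrightarrow> b = \<zero>"
      proof
        assume "b = \<zero>"
        then have 1: "r \<otimes> x = \<zero>" "b1 = \<zero>" using rx0'[of r b1 \<zero>] r ab KM MI(2) by auto
        then have "r \<otimes> e = \<zero>" using ind r(1) MI(2) by simp
        then have "r \<otimes> y = \<zero>" using r(1) y(2) yc eD by (metis m_assoc l_null)
        then show "a = \<zero>" using r(3) 1 G(6)[OF r(2)] by simp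
      next
        assume "a = \<zero>"
        then have "r \<otimes> y = \<zero> \<ominus> a1"
          using r(1,3) ab yc by (metis a_minus_def l_zero minus_equality m_closed a_inv_closed)
        then have "r \<otimes> y \<in> M" using MI(5)[OF MI(2)] ab by simp
        then have re: "r \<otimes> e = \<zero>" using y(3) r(1) by blast
        then have "r \<otimes> y = \<zero>" "r \<otimes> x = \<zero>" using r(1) y(2) yc eD x by (metis m_assoc l_null)+
        then show "b = \<zero>" using r(3,4) \<open>a = \<zero>\<close> ab G(6)[OF r(2)] by simp
      qed
      show "(s \<otimes> a, s \<otimes> b) \<in> ?G" if s: "s \<in> carrier R" for s
      proof -
        have "s \<otimes> a = (s \<otimes> r) \<otimes> y \<oplus> s \<otimes> a1" "s \<otimes> b = (s \<otimes> r) \<otimes> x \<oplus> s \<otimes> b1"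
          using r s ab yc x by (auto simp: r_distr m_assoc)
        then show ?thesis using G(5)[OF s r(2)] s r(1) by blast
      qed
      fix a' b' assume "(a', b') \<in> ?G"
      then obtain r' a2 b2 where r': "r' \<in> carrier R" "(a2, b2) \<in> G" "a' = r' \<otimes> y \<oplus> a2" "b' = r' \<otimes> x \<oplus> b2" by blast
      have ab': "a2 \<in> carrier R" "b2 \<in> carrier R" using G(1)[OF r'(2)] MI(1) KI(1) by auto
      have "a \<oplus> a' = (r \<oplus> r') \<otimes> y \<oplus> (a1 \<oplus> a2)" "b \<oplus> b' = (r \<oplus> r') \<otimes> x \<oplus> (b1 \<oplus> b2)"
        unfolding r(3,4) r'(3,4) using r(1) r'(1) ab(3,4) ab' yc x(1)
        by (simp_all add: l_distr) (simp_all add: a_ac)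
      then show "(a \<oplus> a', b \<oplus> b') \<in> ?G" using G(4)[OF r(2) r'(2)] r(1) r'(1) a_closed by blast
    next
      show "\<exists>b. (a, b) \<in> ?G" if "a \<in> N" for a
        using subsetD[OF equalityD1[OF Ny] that] G(2) unfolding mem_PIdl_set_add_iff by blast
      show "\<exists>a. (a, b) \<in> ?G" if "b \<in> PIdl x <+> K" for b
        using that G(3) unfolding mem_PIdl_set_add_iff by blast
    qed
    moreover have "virtually_simple_filtered N"
      by (rule ssubst[OF Ny], rule virtually_simple_filtered.step[OF IH(1) step.hyps(2) yc y(2)])
        (use y(3) in auto)
    ultimately show ?thesis unfolding iso_to_summand_def using K(2) left_ideal_set_add[OF lx K(1)] by blast
  qed
qed

text \<open>The sum of the Re over \<open>e\<close> in \<open>F\<close> is described by equations,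
  as the set of elements whose products with the remaining idempotents vanish. Adding one idempotent
  to \<open>F\<close> is then a direct check, and \<open>F = E\<close> gives R.\<close>

lemma decomposition_imp_filtered:
  assumes "virtually_simple_decomposition E"
  shows "virtually_simple_filtered (carrier R)"
proof -
  note E = virtually_simple_decompositionD[OF assms]
  have "virtually_simple_filtered {x \<in> carrier R. \<forall>e\<in>E - F. x \<otimes> e = \<zero>}" if "finite F" "F \<subseteq> E" for F
    using that
  proof (induction F)
    case empty
    have "x = \<zero>" if "x \<in> carrier R" "\<forall>e\<in>E. x \<otimes> e = \<zero>" for x
      by (rule sum_right_zeroI[OF E(5,1) _ that(1)]) (use E(3) that(2) in auto)
    then have "{x \<in> carrier R. \<forall>e\<in>E - {}. x \<otimes> e = \<zero>} = {\<zero>}" using E(3) by auto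
    then show ?case using virtually_simple_filtered.zero by simp
  next
    case (insert e F)
    define M where "M F = {x \<in> carrier R. \<forall>e\<in>E - F. x \<otimes> e = \<zero>}" for F
    have e: "e \<in> E" "e \<in> carrier R" "e \<otimes> e = e" using insert.prems E(3) E(4)[of e e] by auto
    have ortho: "e \<otimes> f = \<zero>" "f \<in> carrier R" if "f \<in> E" "f \<noteq> e" for f using E(3,4) e(1) that by auto
    have "r \<otimes> e = \<zero>" if "r \<in> carrier R" "r \<otimes> e \<in> M F" for r
    proof -
      have "r \<otimes> e \<otimes> e = \<zero>" using that(2) e(1) insert.hyps(2) by (simp add: M_def)
      then show ?thesis using that(1) e by (simp add: m_assoc)
    qed
    then have "virtually_simple_filtered (PIdl e <+> M F)"
      using insert.IH insert.prems E(2) e by (intro virtually_simple_filtered.step) (auto simp: M_def)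
    moreover have "PIdl e <+> M F = M (insert e F)"
    proof
      have "(r \<otimes> e \<oplus> m) \<otimes> f = \<zero>"
        if "r \<in> carrier R" "m \<in> M F" "f \<in> E" "f \<notin> insert e F" for r m f
        using that e ortho[of f] by (auto simp: M_def l_distr m_assoc)
      then show "PIdl e <+> M F \<subseteq> M (insert e F)"
        unfolding subset_iff mem_PIdl_set_add_iff using e(2) by (auto simp: M_def)
      show "M (insert e F) \<subseteq> PIdl e <+> M F"
      proof
        fix x assume x: "x \<in> M (insert e F)"
        then have xc: "x \<in> carrier R" by (simp add: M_def)
        have "(x \<ominus> x \<otimes> e) \<otimes> f = \<zero>" if "f \<in> E - F" for f
          using that x xc e ortho[of f] by (cases "f = e") (auto simp: M_def a_minus_def l_distr l_minus m_assoc r_neg)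
        then have "x \<ominus> x \<otimes> e \<in> M F" using xc e(2) by (simp add: M_def)
        moreover have "x = x \<otimes> e \<oplus> (x \<ominus> x \<otimes> e)" using xc e(2) by (simp add: a_minus_def a_lcomm r_neg)
        ultimately show "x \<in> PIdl e <+> M F" unfolding mem_PIdl_set_add_iff using xc by blast
      qed
    qed
    ultimately show ?case by (simp add: M_def)
  qed
  from this[OF E(1) order_refl] show ?thesis by simp
qed

lemma decomposition_imp_left_completely_virtually_semisimple_ring:
  assumes "virtually_simple_decomposition E"
  shows "left_completely_virtually_semisimple_ring R"
proof (rule left_completely_virtually_semisimple_ringI)
  fix M N assume M: "left_ideal M R" and N: "left_ideal N R" "N \<subseteq> M"
  have "virtually_simple_filtered M"
    using filtered_virtually_semisimple[OF decomposition_imp_filtered[OF assms] M left_idealD(1)[OF M]] by simp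
  then show "iso_to_summand N M" using filtered_virtually_semisimple[OF _ N] by simp
qed

end

section \<open>Splitting the identity into virtually simple idempotents\<close>

context ring
begin

lemma minus_eq_minusI:
  assumes "a \<in> carrier R" "b \<in> carrier R" "c \<in> carrier R" "d \<in> carrier R" "a \<oplus> b = c \<oplus> d"
  shows "a \<ominus> c = d \<ominus> b"
proof -
  have "d = \<ominus> c \<oplus> (a \<oplus> b)" using assms by (simp add: r_neg1)
  then have "d \<ominus> b = \<ominus> c \<oplus> a" using assms(1-3) by (simp add: a_minus_def a_assoc r_neg)
  then show ?thesis using assms(1,3) by (simp add: a_minus_def a_comm)
qed

text \<open>\<open>a\<close> is the component of \<open>f\<close> in \<open>K\<close>. Components
  are unique, so x = xf = xa + xb forces x = xa for x in \<open>K\<close>, and f = ff = fa + fb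
  forces fa = a.\<close>

lemma idem_of_summand:
  assumes f: "f \<in> carrier R" "f \<otimes> f = f" and K: "left_ideal K R" "left_ideal K' R"
    and sum: "K <+> K' = PIdl f" and int: "K \<inter> K' = {\<zero>}"
  obtains a where "a \<in> carrier R" "a \<otimes> a = a" "f \<otimes> a = a" "a \<otimes> f = a" "K = PIdl a"
proof -
  note KI = left_idealD[OF K(1)] and K'I = left_idealD[OF K(2)]
  have KP: "K \<subseteq> PIdl f" using set_add_upper[OF K] sum by simp
  obtain a b where ab: "a \<in> K" "b \<in> K'" "f = a \<oplus> b"
    using self_mem_PIdl[OF f(1)] unfolding sum[symmetric] mem_set_add_iff by blast
  have c: "a \<in> carrier R" "b \<in> carrier R" using ab KI(1) K'I(1) by auto
  have eq: "x = x'" if "x \<in> K" "x' \<in> K" "y \<in> K'" "y' \<in> K'" "x \<oplus> y = x' \<oplus> y'" for x x' y y'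
  proof -
    have cl: "x \<in> carrier R" "x' \<in> carrier R" "y \<in> carrier R" "y' \<in> carrier R"
      using that KI(1) K'I(1) by auto
    have "x \<ominus> x' = y' \<ominus> y" using minus_eq_minusI[OF cl(1,3,2,4) that(5)] .
    then have "x \<ominus> x' \<in> K \<inter> K'" using KI(5)[OF that(1,2)] K'I(5)[OF that(4,3)] by simp
    then show ?thesis using int cl by simp
  qed
  have xa: "x = x \<otimes> a" if x: "x \<in> K" for x
  proof (rule eq)
    have xc: "x \<in> carrier R" using x KI(1) by auto
    show "x \<in> K" "x \<otimes> a \<in> K" "\<zero> \<in> K'" "x \<otimes> b \<in> K'" using KI(4) K'I(2,4) ab x xc by auto
    have "x \<otimes> f = x" using x KP mem_PIdl_idem_iff[OF f] by blast
    then show "x \<oplus> \<zero> = x \<otimes> a \<oplus> x \<otimes> b" using ab(3) xc c by (simp add: r_distr)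
  qed
  have "f \<otimes> a = a"
  proof (rule eq)
    show "f \<otimes> a \<in> K" "a \<in> K" "f \<otimes> b \<in> K'" "b \<in> K'" using KI(4) K'I(4) ab f by auto
    have "f \<otimes> a \<oplus> f \<otimes> b = f \<otimes> f" unfolding ab(3) using c by (simp add: r_distr)
    then show "f \<otimes> a \<oplus> f \<otimes> b = a \<oplus> b" using f(2) ab(3) by simp
  qed
  moreover have "a \<otimes> f = a" using ab(1) KP mem_PIdl_idem_iff[OF f] by blast
  moreover have "K = PIdl a"
  proof
    show "PIdl a \<subseteq> K" using PIdl_subset_iff[OF K(1) c(1)] ab(1) by simp
    show "K \<subseteq> PIdl a" using xa KI(1) mem_PIdlI by (metis subset_iff)
  qed
  ultimately show thesis using that c(1) xa[OF ab(1)] by simp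
qed

lemma PIdl_one: "PIdl \<one> = carrier R"
  by (auto simp: mem_PIdl_idem_iff)

text \<open>\<open>N\<close> is isomorphic to a summand Ra of R with \<open>a\<close> idempotent,
  and the partner of \<open>a\<close> in the graph generates \<open>N\<close>.\<close>

lemma left_ideals_principal:
  assumes "left_completely_virtually_semisimple_ring R" "left_ideal N R"
  shows "\<exists>c\<in>carrier R. N = PIdl c"
proof -
  obtain K K' G where K: "left_ideal K R" "left_ideal K' R" "K <+> K' = carrier R" "K \<inter> K' = {\<zero>}"
    and iG: "iso_graph G N K"
    by (rule iso_to_summandE[OF left_completely_virtually_semisimple_ringD[OF assms(1) left_ideal_carrier
          assms(2) left_idealD(1)[OF assms(2)]]])
  obtain a where a: "a \<in> carrier R" "a \<otimes> a = a" "K = PIdl a"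
    using idem_of_summand[OF one_closed l_one[OF one_closed] K(1,2)] K(3,4) PIdl_one by metis
  note G = iso_graphD[OF iG]
    and Gf = iso_graph_functional[OF iG left_idealD(1)[OF assms(2)] left_idealD(1)[OF K(1)]]
  obtain c where c: "(c, a) \<in> G" using G(3) self_mem_PIdl[OF a(1)] a(3) by blast
  have cN: "c \<in> N" using G(1)[OF c] by blast
  have cc: "c \<in> carrier R" using cN left_idealD(1)[OF assms(2)] by auto
  have "x \<in> PIdl c" if x: "x \<in> N" for x
  proof -
    obtain y where y: "(x, y) \<in> G" using G(2)[OF x] by blast
    then have "y \<in> carrier R" "y \<otimes> a = y" using G(1) a(3) mem_PIdl_idem_iff[OF a(1,2)] by blast+
    then have "x = y \<otimes> c" using Gf[OF y G(5)[OF _ c]] by simp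
    then show ?thesis using mem_PIdlI \<open>y \<in> carrier R\<close> by simp
  qed
  then have "N = PIdl c" using PIdl_subset_iff[OF assms(2) cc] cN by blast
  then show ?thesis using cc by blast
qed

text \<open>The left Noetherian property, oriented so that larger left ideals come lower in the
  relation and can serve as a termination measure.\<close>

lemma wf_left_ideals:
  assumes "\<And>N. left_ideal N R \<Longrightarrow> \<exists>c\<in>carrier R. N = PIdl c"
  shows "wf {(J, I). left_ideal I R \<and> left_ideal J R \<and> I \<subset> J}"
proof (rule ccontr)
  assume "\<not> ?thesis"
  then obtain F :: "nat \<Rightarrow> 'a set" where
    "\<And>n. (F (Suc n), F n) \<in> {(J, I). left_ideal I R \<and> left_ideal J R \<and> I \<subset> J}"
    unfolding wf_iff_no_infinite_down_chain by blast
  then have F: "\<And>n. left_ideal (F n) R" "\<And>n. F n \<subset> F (Suc n)" by auto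
  have "left_ideal (\<Union>n. F n) R" using F by (intro left_ideal_Union_chain) auto
  then obtain c where c: "c \<in> carrier R" "(\<Union>n. F n) = PIdl c" using assms by blast
  then obtain n where "c \<in> F n" using self_mem_PIdl by blast
  then have "PIdl c \<subseteq> F n" using PIdl_subset_iff F(1) c(1) by blast
  then show False using c(2) F(2)[of n] by blast
qed

text \<open>A nonzero left ideal in Rf is isomorphic to a nonzero summand of Rf, and
  indecomposability leaves only Rf itself.\<close>

lemma virtually_simple_idem_of_indecomposable:
  assumes R: "left_completely_virtually_semisimple_ring R"
    and f: "f \<in> carrier R" "f \<otimes> f = f" "f \<noteq> \<zero>"
    and ind: "\<And>a. a \<in> carrier R \<Longrightarrow> a \<otimes> a = a \<Longrightarrow> f \<otimes> a = a \<Longrightarrow> a \<otimes> f = a \<Longrightarrow> a = \<zero> \<or> a = f"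
  shows "virtually_simple_idem f"
proof -
  note lf = left_ideal_PIdl[OF f(1)]
  have "\<exists>G. iso_graph G N (PIdl f)" if N: "left_ideal N R" "N \<subseteq> PIdl f" "N \<noteq> {\<zero>}" for N
  proof -
    obtain K K' G where K: "left_ideal K R" "left_ideal K' R" "K <+> K' = PIdl f" "K \<inter> K' = {\<zero>}"
      and iG: "iso_graph G N K"
      by (rule iso_to_summandE[OF left_completely_virtually_semisimple_ringD[OF R lf N(1,2)]])
    obtain a where a: "a \<in> carrier R" "a \<otimes> a = a" "f \<otimes> a = a" "a \<otimes> f = a" "K = PIdl a"
      using idem_of_summand[OF f(1,2) K] by blast
    have "a \<noteq> \<zero>"
    proof
      assume "a = \<zero>"
      then have "b = \<zero>" if "b \<in> K" for b using a(5) PIdl_zero that by auto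
      then have "x = \<zero>" if "x \<in> N" for x using iso_graphD(1,2,6)[OF iG] that by blast
      then have "N = {\<zero>}" using left_idealD(2)[OF N(1)] by blast
      then show False using N(3) by simp
    qed
    then have "a = f" using ind a(1-4) by blast
    then show ?thesis using iG a(5) by auto
  qed
  then show ?thesis unfolding virtually_simple_idem_def using f iso_graph_PIdl_iff[OF f(1,2)] by blast
qed

text \<open>The chain condition concerns ascending chains, whereas splitting an idempotent produces
  smaller summands; passing to the complements R(1 - f) reverses the order.\<close>

lemma PIdl_complement_strict_mono:
  assumes "a \<in> carrier R" "f \<in> carrier R" "f \<otimes> f = f" "f \<otimes> a = a" "a \<otimes> f = a" "a \<otimes> a = a" "a \<noteq> f"
  shows "PIdl (\<one> \<ominus> f) \<subset> PIdl (\<one> \<ominus> a)"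
proof -
  have ca: "\<one> \<ominus> a \<in> carrier R" "\<one> \<ominus> f \<in> carrier R" using assms by auto
  have "(\<one> \<ominus> f) \<otimes> (\<one> \<ominus> a) = \<one> \<ominus> f"
    using assms by (simp add: a_minus_def l_distr r_distr l_minus r_minus a_assoc l_neg r_neg)
  then have "\<one> \<ominus> f \<in> PIdl (\<one> \<ominus> a)" using mem_PIdlI[OF ca(2), of "\<one> \<ominus> a"] by simp
  then have "PIdl (\<one> \<ominus> f) \<subseteq> PIdl (\<one> \<ominus> a)" using PIdl_subset_iff[OF left_ideal_PIdl] ca by blast
  moreover have "\<one> \<ominus> a \<notin> PIdl (\<one> \<ominus> f)"
  proof
    assume *: "\<one> \<ominus> a \<in> PIdl (\<one> \<ominus> f)"
    have "(\<one> \<ominus> f) \<otimes> (\<one> \<ominus> f) = \<one> \<ominus> f"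
      using assms by (simp add: a_minus_def l_distr r_distr l_minus r_minus a_assoc l_neg r_neg)
    then have "(\<one> \<ominus> a) \<otimes> (\<one> \<ominus> f) = \<one> \<ominus> a" using * mem_PIdl_idem_iff[OF ca(2)] by blast
    moreover have "(\<one> \<ominus> a) \<otimes> (\<one> \<ominus> f) = \<one> \<ominus> f"
      using assms by (simp add: a_minus_def l_distr r_distr l_minus r_minus a_assoc minus_add a_lcomm[of "\<ominus> a" "\<ominus> f"] l_neg r_neg)
    ultimately have "\<ominus> a = \<ominus> f" using assms by (simp add: a_minus_def)
    then show False using assms by (metis minus_minus)
  qed
  ultimately show ?thesis using self_mem_PIdl[OF ca(1)] by blast
qed

lemma idem_decomposition:
  assumes R: "left_completely_virtually_semisimple_ring R"
    and f: "f \<in> carrier R" "f \<otimes> f = f"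
  shows "\<exists>E. finite E \<and> (\<forall>e\<in>E. virtually_simple_idem e) \<and>
    (\<forall>e\<in>E. \<forall>e'\<in>E. e \<otimes> e' = (if e = e' then e else \<zero>)) \<and> (\<Oplus>e\<in>E. e) = f"
proof -
  have "wf (inv_image {(J, I). left_ideal I R \<and> left_ideal J R \<and> I \<subset> J} (\<lambda>f. PIdl (\<one> \<ominus> f)))"
    using wf_left_ideals[OF left_ideals_principal[OF R]] by (rule wf_inv_image)
  then show ?thesis using f
  proof (induction f rule: wf_induct_rule)
    case (less f)
    have IH: "\<exists>E. finite E \<and> (\<forall>e\<in>E. virtually_simple_idem e) \<and>
        (\<forall>e\<in>E. \<forall>e'\<in>E. e \<otimes> e' = (if e = e' then e else \<zero>)) \<and> (\<Oplus>e\<in>E. e) = a"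
      if "a \<in> carrier R" "f \<otimes> a = a" "a \<otimes> f = a" "a \<otimes> a = a" "a \<noteq> f" for a
      using less.IH[of a] PIdl_complement_strict_mono[OF that(1) less.prems that(2-5)] left_ideal_PIdl less.prems(1) that(1,4)
      by simp
    show ?case
    proof (cases "f = \<zero> \<or> virtually_simple_idem f")
      case True
      then show ?thesis
      proof
        assume "f = \<zero>" then show ?thesis by (intro exI[of _ "{}"]) simp
      next
        assume "virtually_simple_idem f"
        then show ?thesis using less.prems by (intro exI[of _ "{f}"]) simp
      qed
    next
      case False
      then obtain a where a: "a \<in> carrier R" "a \<otimes> a = a" "f \<otimes> a = a" "a \<otimes> f = a" "a \<noteq> \<zero>" "a \<noteq> f"
        using virtually_simple_idem_of_indecomposable[OF R less.prems] by blast
      \<comment> \<open>The complement of \<open>a\<close> inside \<open>f\<close>. It differs from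
        \<open>f\<close> because \<open>a\<close> is nonzero, so the induction hypothesis applies to
        both halves.\<close>
      define b where "b = f \<ominus> a"
      have b: "b \<in> carrier R" "b \<otimes> b = b" "f \<otimes> b = b" "b \<otimes> f = b" "a \<otimes> b = \<zero>" "b \<otimes> a = \<zero>"
        unfolding b_def using a less.prems
        by (simp_all add: a_minus_def l_distr r_distr l_minus r_minus a_assoc r_neg)
      have ab: "a \<oplus> b = f" unfolding b_def using a less.prems(1) by (simp add: a_minus_def a_lcomm[of a f] r_neg)
      then have "b \<noteq> f" using a(1,5) b(1) less.prems(1) by (metis add.r_cancel_one)
      obtain A where A: "finite A" "\<forall>e\<in>A. virtually_simple_idem e"
        "\<forall>e\<in>A. \<forall>e'\<in>A. e \<otimes> e' = (if e = e' then e else \<zero>)" "(\<Oplus>e\<in>A. e) = a"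
        using IH a by blast
      obtain B where B: "finite B" "\<forall>e\<in>B. virtually_simple_idem e"
        "\<forall>e\<in>B. \<forall>e'\<in>B. e \<otimes> e' = (if e = e' then e else \<zero>)" "(\<Oplus>e\<in>B. e) = b"
        using IH b \<open>b \<noteq> f\<close> by blast
      have Ac: "A \<subseteq> carrier R" "B \<subseteq> carrier R" using A(2) B(2) virtually_simple_idemD(1) by auto
      have Aa: "e \<otimes> a = e" "a \<otimes> e = e" if "e \<in> A" for e
        using orthogonal_idem_sum[OF A(1) Ac(1) _ that] A(3,4) by auto
      have Bb: "e \<otimes> b = e" "b \<otimes> e = e" if "e \<in> B" for e
        using orthogonal_idem_sum[OF B(1) Ac(2) _ that] B(3,4) by auto
      have AB: "e \<otimes> e' = \<zero>" "e' \<otimes> e = \<zero>" if e: "e \<in> A" "e' \<in> B" for e e'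
      proof -
        have c: "e \<in> carrier R" "e' \<in> carrier R" using e Ac by auto
        \<comment> \<open>Inserting \<open>a\<close> and \<open>b\<close> between elements of the
          two halves reduces their orthogonality to that of \<open>a\<close> and
          \<open>b\<close>.\<close>
        have "e \<otimes> e' = (e \<otimes> a) \<otimes> (b \<otimes> e')" using Aa Bb e by simp
        also have "\<dots> = e \<otimes> (a \<otimes> b) \<otimes> e'" using c a(1) b(1) by (simp add: m_assoc)
        finally show "e \<otimes> e' = \<zero>" using b(5) c by simp
        have "e' \<otimes> e = (e' \<otimes> b) \<otimes> (a \<otimes> e)" using Aa Bb e by simp
        also have "\<dots> = e' \<otimes> (b \<otimes> a) \<otimes> e" using c a(1) b(1) by (simp add: m_assoc)
        finally show "e' \<otimes> e = \<zero>" using b(6) c by simp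
      qed
      have disj: "A \<inter> B = {}"
      proof (rule ccontr)
        assume "A \<inter> B \<noteq> {}"
        then obtain e where e: "e \<in> A" "e \<in> B" by blast
        then have "e = \<zero>" using AB[OF e] A(3) by auto
        then show False using A(2) e virtually_simple_idemD(3) by blast
      qed
      have "(\<Oplus>e\<in>A \<union> B. e) = (\<Oplus>e\<in>A. e) \<oplus> (\<Oplus>e\<in>B. e)"
        by (rule finsum_Un_disjoint) (use A(1) B(1) disj Ac in auto)
      then have "(\<Oplus>e\<in>A \<union> B. e) = f" using ab A(4) B(4) by simp
      moreover have "\<forall>e\<in>A \<union> B. \<forall>e'\<in>A \<union> B. e \<otimes> e' = (if e = e' then e else \<zero>)"
        using A(3) B(3) AB disj by (auto simp: disjoint_iff)
      ultimately show ?thesis using A(1,2) B(1,2) by (intro exI[of _ "A \<union> B"]) auto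
    qed
  qed
qed

lemma left_completely_virtually_semisimple_ring_imp_decomposition:
  assumes "left_completely_virtually_semisimple_ring R"
  shows "\<exists>E. virtually_simple_decomposition E"
  using idem_decomposition[OF assms one_closed l_one[OF one_closed]]
  unfolding virtually_simple_decomposition_def by metis

section \<open>Direct sums of virtually simple left ideals\<close>

lemma finsum_support:
  assumes "finite S" "g \<in> S \<rightarrow> carrier R"
  shows "(\<Oplus>N\<in>{N\<in>S. g N \<noteq> \<zero>}. g N) = (\<Oplus>N\<in>S. g N)"
  by (rule add.finprod_mono_neutral_cong_left) (use assms in auto)

text \<open>The components \<open>f N\<close> of the identity are the idempotents. For
  \<open>x\<close> in \<open>N\<close>, multiplying the decomposition of 1 by \<open>x\<close> gives
  a second decomposition of \<open>x\<close> besides \<open>x\<close> itself; uniqueness yields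
  \<open>x \<otimes> f N = x\<close> and zero for the other summands.\<close>

lemma direct_sum_imp_decomposition:
  assumes "direct_sum_of_virtually_simples R (regular_module R)"
  shows "\<exists>E. virtually_simple_decomposition E"
proof -
  obtain S where S: "internal_direct_sum R (regular_module R) S"
    "\<forall>N\<in>S. virtually_simple R (as_module N)"
    using assms unfolding direct_sum_of_virtually_simples_def by blast
  have sub: "left_ideal N R" if "N \<in> S" for N
    using S(1) that by (simp add: internal_direct_sum_def submodule_regular_module_iff')
  have ex1: "\<exists>!f. f \<in> (\<Pi>\<^sub>E N \<in> S. N) \<and> finite {N \<in> S. f N \<noteq> \<zero>} \<and>
      x = (\<Oplus>N \<in> {N \<in> S. f N \<noteq> \<zero>}. f N)" if "x \<in> carrier R" for x
    using S(1) that by (simp add: internal_direct_sum_def)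
  have vs: "virtually_simple R (as_module N)" if "N \<in> S" for N
    using S(2) that by blast
  obtain f where f: "f \<in> (\<Pi>\<^sub>E N \<in> S. N)" "finite {N \<in> S. f N \<noteq> \<zero>}"
    and f1: "\<one> = (\<Oplus>N \<in> {N \<in> S. f N \<noteq> \<zero>}. f N)"
    using ex1[OF one_closed] by blast
  define T where "T = {N \<in> S. f N \<noteq> \<zero>}"
  have T: "finite T" "T \<subseteq> S" using f(2) by (auto simp: T_def)
  have fN: "f N \<in> N" "f N \<in> carrier R" if "N \<in> S" for N
    using f(1) that left_idealD(1)[OF sub[OF that]] by (auto simp: PiE_iff)
  have mult: "x \<otimes> f N' = (if N' = N then x else \<zero>)" if N: "N \<in> S" "x \<in> N" "N' \<in> S" for x N N'
  proof -
    have x: "x \<in> carrier R" using N left_idealD(1)[OF sub] by blast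
    define g where "g = (\<lambda>N'\<in>S. x \<otimes> f N')"
    define h where "h = (\<lambda>N'\<in>S. if N' = N then x else \<zero>)"
    have gS: "{N'\<in>S. g N' \<noteq> \<zero>} \<subseteq> T" using x by (auto simp: g_def T_def)
    have "x = x \<otimes> (\<Oplus>N\<in>T. f N)" using r_one[OF x] unfolding f1 T_def by simp
    also have "\<dots> = (\<Oplus>N\<in>T. x \<otimes> f N)" by (rule finsum_rdistr) (use T fN x in auto)
    also have "\<dots> = (\<Oplus>N\<in>{N'\<in>S. g N' \<noteq> \<zero>}. g N)"
      by (rule add.finprod_mono_neutral_cong_right) (use T fN x gS in \<open>auto simp: g_def\<close>)
    finally have g: "x = (\<Oplus>N\<in>{N'\<in>S. g N' \<noteq> \<zero>}. g N)" .
    have gP: "g \<in> (\<Pi>\<^sub>E N \<in> S. N)" using left_idealD(4)[OF sub] fN x by (auto simp: g_def)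
    have hP: "h \<in> (\<Pi>\<^sub>E N \<in> S. N)" using left_idealD(2)[OF sub] N by (auto simp: h_def)
    have hS: "{N'\<in>S. h N' \<noteq> \<zero>} = (if x = \<zero> then {} else {N})" using N by (auto simp: h_def)
    have h: "x = (\<Oplus>N\<in>{N'\<in>S. h N' \<noteq> \<zero>}. h N)" using x N unfolding hS by (simp add: h_def)
    have "finite {N'\<in>S. g N' \<noteq> \<zero>}" "finite {N'\<in>S. h N' \<noteq> \<zero>}"
      using finite_subset[OF gS T(1)] by (simp_all add: hS)
    then have "g = h" using ex1[OF x] g gP h hP by blast
    then have "g N' = h N'" by simp
    then show ?thesis using N(3) by (simp add: g_def h_def)
  qed
  have N0: "N \<noteq> {\<zero>}" if "N \<in> S" for N using vs[OF that] by (auto simp: virtually_simple_def)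
  have NP: "N = PIdl (f N)" if "N \<in> S" for N
  proof
    show "PIdl (f N) \<subseteq> N" using PIdl_subset_iff[OF sub[OF that] fN(2)[OF that]] fN(1)[OF that] by blast
    have "x \<in> PIdl (f N)" if x: "x \<in> N" for x
    proof -
      have "x \<otimes> f N = x" using mult[OF \<open>N \<in> S\<close> x \<open>N \<in> S\<close>] by simp
      then show ?thesis using mem_PIdlI[of x "f N"] left_idealD(1)[OF sub[OF \<open>N \<in> S\<close>]] x by auto
    qed
    then show "N \<subseteq> PIdl (f N)" by blast
  qed
  \<comment> \<open>Finiteness of the direct sum: a summand in which 1 has component 0 would be R0 =
    0, which virtual simplicity excludes.\<close>
  have ST: "S = T"
  proof
    show "S \<subseteq> T" using NP N0 PIdl_zero unfolding T_def by force
  qed (use T in blast)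
  have inj: "inj_on f S" using NP by (metis inj_onI)
  have "virtually_simple_decomposition (f ` S)"
    unfolding virtually_simple_decomposition_def
  proof (intro conjI ballI impI)
    show "finite (f ` S)" using T ST by simp
    show "virtually_simple_idem e" if e: "e \<in> f ` S" for e
    proof -
      obtain N where N: "N \<in> S" "e = f N" using e by blast
      have "virtually_simple R (as_module (PIdl e))" using vs[OF N(1)] NP[OF N(1)] N(2) by simp
      moreover have "e \<otimes> e = e" using mult[OF N(1) fN(1)[OF N(1)] N(1)] N(2) by simp
      ultimately show ?thesis using virtually_simple_PIdl_iff fN(2)[OF N(1)] N(2) by simp
    qed
    show "e \<otimes> e' = \<zero>" if "e \<in> f ` S" "e' \<in> f ` S" "e \<noteq> e'" for e e'
      using that mult fN(1) by auto
    have "(\<Oplus>e\<in>f ` S. e) = (\<Oplus>N\<in>S. f N)" by (rule finsum_reindex) (use fN inj in auto)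
    also have "\<dots> = (\<Oplus>N\<in>T. f N)" by (rule arg_cong[OF ST])
    also have "\<dots> = \<one>" unfolding T_def by (rule f1[symmetric])
    finally show "(\<Oplus>e\<in>f ` S. e) = \<one>" .
  qed
  then show ?thesis by blast
qed

lemma decomposition_imp_direct_sum:
  assumes "virtually_simple_decomposition E"
  shows "direct_sum_of_virtually_simples R (regular_module R)"
proof -
  note E = virtually_simple_decompositionD[OF assms]
  have Ec: "e \<in> carrier R" "e \<otimes> e = e" "e \<noteq> \<zero>" if "e \<in> E" for e
    using virtually_simple_idemD[OF E(2)[OF that]] by auto
  have injP: "inj_on (\<lambda>e. PIdl e) E"
  proof (rule inj_onI, rule ccontr)
    fix e e' assume e: "e \<in> E" "e' \<in> E" "PIdl e = PIdl e'" "e \<noteq> e'"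
    have "e \<in> PIdl e'" using self_mem_PIdl[OF Ec(1)[OF e(1)]] e(3) by simp
    then have "e \<otimes> e' = e" using mem_PIdl_idem_iff[OF Ec(1,2)[OF e(2)]] by simp
    then show False using E(4)[OF e(1,2)] e(4) Ec(3)[OF e(1)] by simp
  qed
  define S where "S = (\<lambda>e. PIdl e) ` E"
  \<comment> \<open>Summands are indexed by themselves, so the idempotent has to be recovered from
    Re. This is possible because distinct idempotents in \<open>E\<close> are orthogonal and
    nonzero, hence generate different left ideals.\<close>
  define \<epsilon> where "\<epsilon> = inv_into E (\<lambda>e. PIdl e)"
  have \<epsilon>E: "\<epsilon> N \<in> E" "PIdl (\<epsilon> N) = N" if "N \<in> S" for N
    using that unfolding S_def \<epsilon>_def by (simp_all add: inv_into_into f_inv_into_f)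
  have \<epsilon>P: "\<epsilon> (PIdl e) = e" if "e \<in> E" for e using injP that by (simp add: \<epsilon>_def)
  have finS: "finite S" using E(1) by (simp add: S_def)
  have ex: "\<exists>!f. f \<in> (\<Pi>\<^sub>E N \<in> S. N) \<and> finite {N \<in> S. f N \<noteq> \<zero>} \<and>
      x = (\<Oplus>N \<in> {N \<in> S. f N \<noteq> \<zero>}. f N)" if x: "x \<in> carrier R" for x
  proof (rule ex1I[of _ "\<lambda>N\<in>S. x \<otimes> \<epsilon> N"])
    define g where "g = (\<lambda>N\<in>S. x \<otimes> \<epsilon> N)"
    have gc: "g \<in> S \<rightarrow> carrier R" using Ec(1) \<epsilon>E(1) x by (auto simp: g_def)
    have "x = x \<otimes> (\<Oplus>e\<in>E. e)" using E(5) x by simp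
    also have "\<dots> = (\<Oplus>e\<in>E. x \<otimes> e)" by (rule finsum_rdistr) (use E(1) Ec x in auto)
    also have "\<dots> = (\<Oplus>e\<in>E. g (PIdl e))"
      by (rule finsum_cong') (use x Ec(1) \<epsilon>P in \<open>auto simp: g_def S_def\<close>)
    also have "\<dots> = (\<Oplus>N\<in>S. g N)" unfolding S_def
      by (rule finsum_reindex[symmetric]) (use gc injP in \<open>auto simp: S_def\<close>)
    also have "\<dots> = (\<Oplus>N \<in> {N \<in> S. g N \<noteq> \<zero>}. g N)" by (rule finsum_support[symmetric]) (use finS gc in auto)
    finally have "x = (\<Oplus>N \<in> {N \<in> S. g N \<noteq> \<zero>}. g N)" .
    moreover have "g N \<in> N" if N: "N \<in> S" for N
      using mem_PIdlI[OF x, of "\<epsilon> N"] \<epsilon>E(2)[OF N] N by (simp add: g_def)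
    then have "g \<in> (\<Pi>\<^sub>E N \<in> S. N)" by (auto simp: g_def)
    ultimately show "(\<lambda>N\<in>S. x \<otimes> \<epsilon> N) \<in> (\<Pi>\<^sub>E N \<in> S. N) \<and>
        finite {N \<in> S. (\<lambda>N\<in>S. x \<otimes> \<epsilon> N) N \<noteq> \<zero>} \<and>
        x = (\<Oplus>N \<in> {N \<in> S. (\<lambda>N\<in>S. x \<otimes> \<epsilon> N) N \<noteq> \<zero>}. (\<lambda>N\<in>S. x \<otimes> \<epsilon> N) N)"
      using finS unfolding g_def by simp
  next
    fix g assume g: "g \<in> (\<Pi>\<^sub>E N \<in> S. N) \<and> finite {N \<in> S. g N \<noteq> \<zero>} \<and> x = (\<Oplus>N \<in> {N \<in> S. g N \<noteq> \<zero>}. g N)"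
    have gN: "g N \<in> carrier R" "g N \<otimes> \<epsilon> N = g N" if "N \<in> S" for N
      using g \<epsilon>E[OF that] that mem_PIdl_idem_iff[OF Ec(1,2)[OF \<epsilon>E(1)[OF that]]] by (auto simp: PiE_iff)
    have xg: "x = (\<Oplus>N\<in>S. g N)" using g finsum_support[OF finS, of g] gN(1) by auto
    \<comment> \<open>The components of any decomposition are read off by right multiplication with
      the idempotents, which proves uniqueness.\<close>
    have "x \<otimes> \<epsilon> M = g M" if M: "M \<in> S" for M
    proof -
      have \<epsilon>M: "\<epsilon> M \<in> carrier R" using Ec(1) \<epsilon>E(1) M by blast
      have *: "g N \<otimes> \<epsilon> M = (if M = N then g N else \<zero>)" if N: "N \<in> S" for N
      proof -
        have "g N \<otimes> \<epsilon> M = g N \<otimes> (\<epsilon> N \<otimes> \<epsilon> M)"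
          using gN[OF N] \<epsilon>M Ec(1)[OF \<epsilon>E(1)[OF N]] by (metis m_assoc)
        moreover have "\<epsilon> N = \<epsilon> M \<longleftrightarrow> N = M" using \<epsilon>E(2) M N by metis
        ultimately show ?thesis using E(4)[OF \<epsilon>E(1)[OF N] \<epsilon>E(1)[OF M]] gN[OF N] by auto
      qed
      have "x \<otimes> \<epsilon> M = (\<Oplus>N\<in>S. g N \<otimes> \<epsilon> M)"
        unfolding xg by (rule finsum_ldistr) (use finS \<epsilon>M gN(1) in auto)
      also have "\<dots> = (\<Oplus>N\<in>S. if M = N then g N else \<zero>)"
        by (rule finsum_cong') (use * gN(1) in auto)
      also have "\<dots> = g M" by (rule finsum_singleton) (use M finS gN(1) in auto)
      finally show ?thesis .
    qed
    then show "g = (\<lambda>N\<in>S. x \<otimes> \<epsilon> N)" using g by (intro ext) (auto simp: PiE_iff extensional_def)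
  qed
  have lS: "left_ideal N R" if "N \<in> S" for N using left_ideal_PIdl Ec(1) that by (auto simp: S_def)
  have "internal_direct_sum R (regular_module R) S"
    unfolding internal_direct_sum_def using ex lS by (simp add: submodule_regular_module_iff')
  moreover have "virtually_simple R (as_module N)" if "N \<in> S" for N
    using that virtually_simple_PIdl_iff Ec(1,2) E(2) by (auto simp: S_def)
  ultimately show ?thesis unfolding direct_sum_of_virtually_simples_def by blast
qed

end

section \<open>Products of matrix rings in coordinates\<close>

lemma RDirProd_list_carrier_iff:
  "as \<in> carrier (RDirProd_list Rs) \<longleftrightarrow> length as = length Rs \<and> (\<forall>i<length Rs. as ! i \<in> carrier (Rs ! i))"
  using RDirProd_list_carrier_mem[of as Rs] RDirProd_list_carrier_memI[of as Rs] by auto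

text \<open>The isomorphism between the binary product of head and tail and the list product carries
  the induction, so the operations become componentwise.\<close>

lemma RDirProd_list_mult_add:
  assumes "as \<in> carrier (RDirProd_list Rs)" "bs \<in> carrier (RDirProd_list Rs)"
  shows "as \<otimes>\<^bsub>RDirProd_list Rs\<^esub> bs = map (\<lambda>i. as ! i \<otimes>\<^bsub>Rs ! i\<^esub> bs ! i) [0..<length Rs]"
    and "as \<oplus>\<^bsub>RDirProd_list Rs\<^esub> bs = map (\<lambda>i. as ! i \<oplus>\<^bsub>Rs ! i\<^esub> bs ! i) [0..<length Rs]"
  using assms
proof (induction Rs arbitrary: as bs)
  case Nil
  {
    case 1 then show ?case by (simp add: monoid.defs)
  next
    case 2 then show ?case by (simp add: monoid.defs)
  }
next
  case (Cons S Rs)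
  have split: "\<exists>a as'. as = a # as' \<and> a \<in> carrier S \<and> as' \<in> carrier (RDirProd_list Rs)"
    if "as \<in> carrier (RDirProd_list (S # Rs))" for as
    using that unfolding RDirProd_list_carrier by auto
  note hom = RDirProd_list_iso1[of S Rs, THEN ring_iso_memE(2)] RDirProd_list_iso1[of S Rs, THEN ring_iso_memE(3)]
  have upt: "[0..<length (S # Rs)] = 0 # map Suc [0..<length Rs]"
    by (simp add: upt_conv_Cons map_Suc_upt del: upt_Suc)
  {
    case 1
    obtain a as' b bs' where *: "as = a # as'" "a \<in> carrier S" "as' \<in> carrier (RDirProd_list Rs)"
      "bs = b # bs'" "b \<in> carrier S" "bs' \<in> carrier (RDirProd_list Rs)"
      using split 1 by metis
    have "as \<otimes>\<^bsub>RDirProd_list (S # Rs)\<^esub> bs = (a \<otimes>\<^bsub>S\<^esub> b) # (as' \<otimes>\<^bsub>RDirProd_list Rs\<^esub> bs')"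
      using hom(1)[of "(a, as')" "(b, bs')"] * by (simp add: RDirProd_def DirProd_def monoid.defs)
    then show ?case unfolding upt using Cons.IH(1)[of as' bs'] * by (simp add: comp_def)
  next
    case 2
    obtain a as' b bs' where *: "as = a # as'" "a \<in> carrier S" "as' \<in> carrier (RDirProd_list Rs)"
      "bs = b # bs'" "b \<in> carrier S" "bs' \<in> carrier (RDirProd_list Rs)"
      using split 2 by metis
    have "as \<oplus>\<^bsub>RDirProd_list (S # Rs)\<^esub> bs = (a \<oplus>\<^bsub>S\<^esub> b) # (as' \<oplus>\<^bsub>RDirProd_list Rs\<^esub> bs')"
      using hom(2)[of "(a, as')" "(b, bs')"] * by (simp add: RDirProd_def DirProd_def monoid.defs)
    then show ?case unfolding upt using Cons.IH(2)[of as' bs'] * by (simp add: comp_def)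
  }
qed

lemma RDirProd_list_one_eq: "\<one>\<^bsub>RDirProd_list Rs\<^esub> = map one Rs"
  unfolding RDirProd_list_one by (induction Rs) auto

lemma matrix_ring_simps:
  "carrier (matrix_ring n D) = {..<n} \<times> {..<n} \<rightarrow>\<^sub>E carrier D"
  "j < n \<Longrightarrow> l < n \<Longrightarrow> (A \<otimes>\<^bsub>matrix_ring n D\<^esub> B) (j, l) = (\<Oplus>\<^bsub>D\<^esub>m \<in> {..<n}. A (j, m) \<otimes>\<^bsub>D\<^esub> B (m, l))"
  "j < n \<Longrightarrow> l < n \<Longrightarrow> (A \<oplus>\<^bsub>matrix_ring n D\<^esub> B) (j, l) = A (j, l) \<oplus>\<^bsub>D\<^esub> B (j, l)"
  "j < n \<Longrightarrow> l < n \<Longrightarrow> \<one>\<^bsub>matrix_ring n D\<^esub> (j, l) = (if j = l then \<one>\<^bsub>D\<^esub> else \<zero>\<^bsub>D\<^esub>)"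
  "\<one>\<^bsub>matrix_ring n D\<^esub> \<in> extensional ({..<n} \<times> {..<n})"
  "A \<otimes>\<^bsub>matrix_ring n D\<^esub> B \<in> extensional ({..<n} \<times> {..<n})"
  "A \<oplus>\<^bsub>matrix_ring n D\<^esub> B \<in> extensional ({..<n} \<times> {..<n})"
  by (simp_all add: matrix_ring_def)

text \<open>An isomorphism onto a product of matrix rings, recorded through its entries:
  \<open>ent x i j l\<close> is entry (j, l) of block i. Lists and restricted functions are thereby
  confined to the two translation lemmas that follow.\<close>

locale matrix_coordinates = ring R for R :: "('a, 'r) ring_scheme" (structure) +
  fixes k :: nat and n :: "nat \<Rightarrow> nat" and D :: "nat \<Rightarrow> 'd ring" and ent :: "'a \<Rightarrow> nat \<Rightarrow> nat \<Rightarrow> nat \<Rightarrow> 'd"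
  assumes ring_D: "i < k \<Longrightarrow> ring (D i)"
    and size_pos: "i < k \<Longrightarrow> 0 < n i"
    and coord_closed: "\<lbrakk>x \<in> carrier R; i < k; j < n i; l < n i\<rbrakk> \<Longrightarrow> ent x i j l \<in> carrier (D i)"
    and coord_mult: "\<lbrakk>x \<in> carrier R; y \<in> carrier R; i < k; j < n i; l < n i\<rbrakk> \<Longrightarrow>
      ent (x \<otimes> y) i j l = (\<Oplus>\<^bsub>D i\<^esub>m \<in> {..<n i}. ent x i j m \<otimes>\<^bsub>D i\<^esub> ent y i m l)"
    and coord_add: "\<lbrakk>x \<in> carrier R; y \<in> carrier R; i < k; j < n i; l < n i\<rbrakk> \<Longrightarrow>
      ent (x \<oplus> y) i j l = ent x i j l \<oplus>\<^bsub>D i\<^esub> ent y i j l"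
    and coord_one: "\<lbrakk>i < k; j < n i; l < n i\<rbrakk> \<Longrightarrow> ent \<one> i j l = (if j = l then \<one>\<^bsub>D i\<^esub> else \<zero>\<^bsub>D i\<^esub>)"
    and coord_inj: "\<lbrakk>x \<in> carrier R; y \<in> carrier R; \<And>i j l. \<lbrakk>i < k; j < n i; l < n i\<rbrakk> \<Longrightarrow> ent x i j l = ent y i j l\<rbrakk> \<Longrightarrow> x = y"
    and coord_surj: "(\<And>i j l. \<lbrakk>i < k; j < n i; l < n i\<rbrakk> \<Longrightarrow> a i j l \<in> carrier (D i)) \<Longrightarrow>
      \<exists>x\<in>carrier R. \<forall>i<k. \<forall>j<n i. \<forall>l<n i. ent x i j l = a i j l"

lemma (in matrix_coordinates) iso_matrix_product:
  "R \<simeq> RDirProd_list (map (\<lambda>i. matrix_ring (n i) (D i)) [0..<k])"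
proof -
  define Rs where "Rs = map (\<lambda>i. matrix_ring (n i) (D i)) [0..<k]"
  define \<phi> where "\<phi> x = map (\<lambda>i. \<lambda>(j, l)\<in>{..<n i} \<times> {..<n i}. ent x i j l) [0..<k]" for x
  have Rs: "length Rs = k" "\<And>i. i < k \<Longrightarrow> Rs ! i = matrix_ring (n i) (D i)" by (simp_all add: Rs_def)
  have \<phi>i: "\<phi> x ! i = (\<lambda>(j, l)\<in>{..<n i} \<times> {..<n i}. ent x i j l)" "length (\<phi> x) = k" if "i < k" for x i
    using that by (simp_all add: \<phi>_def)
  have len: "length (\<phi> x) = k" for x by (simp add: \<phi>_def)
  have \<phi>c: "\<phi> x \<in> carrier (RDirProd_list Rs)" if "x \<in> carrier R" for x
    unfolding RDirProd_list_carrier_iff using that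
    by (auto simp: Rs \<phi>i len matrix_ring_simps(1) coord_closed)
  have "\<phi> \<in> ring_iso R (RDirProd_list Rs)"
  proof (rule ring_iso_memI)
    fix x y assume xy: "x \<in> carrier R" "y \<in> carrier R"
    show "\<phi> (x \<otimes> y) = \<phi> x \<otimes>\<^bsub>RDirProd_list Rs\<^esub> \<phi> y"
      unfolding RDirProd_list_mult_add[OF \<phi>c[OF xy(1)] \<phi>c[OF xy(2)]]
    proof (rule nth_equalityI)
      fix i assume "i < length (\<phi> (x \<otimes> y))"
      then have i: "i < k" by (simp add: len)
      interpret Di: ring "D i" using ring_D i .
      have "\<phi> (x \<otimes> y) ! i = \<phi> x ! i \<otimes>\<^bsub>matrix_ring (n i) (D i)\<^esub> \<phi> y ! i"
        using i xy by (auto simp: \<phi>i matrix_ring_def coord_mult coord_closed fun_eq_iff intro!: Di.finsum_cong')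
      then show "\<phi> (x \<otimes> y) ! i = map (\<lambda>i. \<phi> x ! i \<otimes>\<^bsub>Rs ! i\<^esub> \<phi> y ! i) [0..<length Rs] ! i"
        using i by (simp add: Rs)
    qed (simp add: len Rs)
    show "\<phi> (x \<oplus> y) = \<phi> x \<oplus>\<^bsub>RDirProd_list Rs\<^esub> \<phi> y"
      unfolding RDirProd_list_mult_add[OF \<phi>c[OF xy(1)] \<phi>c[OF xy(2)]]
    proof (rule nth_equalityI)
      fix i assume "i < length (\<phi> (x \<oplus> y))"
      then have i: "i < k" by (simp add: len)
      have "\<phi> (x \<oplus> y) ! i = \<phi> x ! i \<oplus>\<^bsub>matrix_ring (n i) (D i)\<^esub> \<phi> y ! i"
        using i xy by (auto simp: \<phi>i matrix_ring_def coord_add fun_eq_iff)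
      then show "\<phi> (x \<oplus> y) ! i = map (\<lambda>i. \<phi> x ! i \<oplus>\<^bsub>Rs ! i\<^esub> \<phi> y ! i) [0..<length Rs] ! i"
        using i by (simp add: Rs)
    qed (simp add: len Rs)
  next
    show "\<phi> \<one> = \<one>\<^bsub>RDirProd_list Rs\<^esub>"
      unfolding RDirProd_list_one_eq
    proof (rule nth_equalityI)
      fix i assume "i < length (\<phi> \<one>)"
      then have i: "i < k" by (simp add: len)
      have "\<phi> \<one> ! i = \<one>\<^bsub>matrix_ring (n i) (D i)\<^esub>"
        using i by (auto simp: \<phi>i matrix_ring_def coord_one fun_eq_iff)
      then show "\<phi> \<one> ! i = map one Rs ! i" using i by (simp add: Rs)
    qed (simp add: len Rs)
  next
    show "bij_betw \<phi> (carrier R) (carrier (RDirProd_list Rs))"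
    proof (rule bij_betw_imageI)
      show "inj_on \<phi> (carrier R)"
      proof (rule inj_onI, rule coord_inj)
        fix x y i j l assume "\<phi> x = \<phi> y" and ijl: "i < k" "j < n i" "l < n i"
        then have "(\<phi> x ! i) (j, l) = (\<phi> y ! i) (j, l)" by simp
        then show "ent x i j l = ent y i j l" using ijl by (simp add: \<phi>i)
      qed
      show "\<phi> ` carrier R = carrier (RDirProd_list Rs)"
      proof
        show "carrier (RDirProd_list Rs) \<subseteq> \<phi> ` carrier R"
        proof
          fix as assume "as \<in> carrier (RDirProd_list Rs)"
          then have as: "length as = k" "\<And>i. i < k \<Longrightarrow> as ! i \<in> {..<n i} \<times> {..<n i} \<rightarrow>\<^sub>E carrier (D i)"
            unfolding RDirProd_list_carrier_iff Rs(1) using Rs(2) by (auto simp: matrix_ring_simps(1))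
          obtain x where x: "x \<in> carrier R" "\<forall>i<k. \<forall>j<n i. \<forall>l<n i. ent x i j l = (as ! i) (j, l)"
            using coord_surj[of "\<lambda>i j l. (as ! i) (j, l)"] as(2) by (auto simp: PiE_iff)
          have "\<phi> x = as"
          proof (rule nth_equalityI)
            fix i assume "i < length (\<phi> x)"
            then have i: "i < k" by (simp add: len)
            show "\<phi> x ! i = as ! i"
              by (rule extensionalityI[where A = "{..<n i} \<times> {..<n i}"])
                 (use i x as(2)[OF i] in \<open>auto simp: \<phi>i PiE_iff\<close>)
          qed (simp add: len as)
          then show "as \<in> \<phi> ` carrier R" using x(1) by blast
        qed
      qed (use \<phi>c in blast)
    qed
  qed (rule \<phi>c)
  then show ?thesis unfolding is_ring_iso_def Rs_def by blast
qed

lemma matrix_coordinates_of_iso: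
  fixes R :: "('a, 'r) ring_scheme" (structure)
  assumes "ring R" and iso: "R \<simeq> RDirProd_list (map (\<lambda>i. matrix_ring (n i) (D i)) [0..<k])"
    and D: "\<And>i. i < k \<Longrightarrow> ring (D i)" and n: "\<And>i. i < k \<Longrightarrow> 0 < n i"
  shows "\<exists>ent. matrix_coordinates R k n D ent"
proof -
  interpret ring R by fact
  define Rs where "Rs = map (\<lambda>i. matrix_ring (n i) (D i)) [0..<k]"
  have Rs: "length Rs = k" "\<And>i. i < k \<Longrightarrow> Rs ! i = matrix_ring (n i) (D i)" by (simp_all add: Rs_def)
  obtain \<phi> where \<phi>: "\<phi> \<in> ring_iso R (RDirProd_list Rs)" using iso unfolding is_ring_iso_def Rs_def by blast
  note \<phi>E = ring_iso_memE[OF \<phi>]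
  have \<phi>c: "length (\<phi> x) = k" "\<And>i. i < k \<Longrightarrow> \<phi> x ! i \<in> {..<n i} \<times> {..<n i} \<rightarrow>\<^sub>E carrier (D i)"
    if "x \<in> carrier R" for x
    using \<phi>E(1)[OF that] unfolding RDirProd_list_carrier_iff Rs(1) using Rs(2) by (auto simp: matrix_ring_simps(1))
  have "matrix_coordinates R k n D (\<lambda>x i j l. (\<phi> x ! i) (j, l))"
  proof (intro matrix_coordinates.intro matrix_coordinates_axioms.intro ring_axioms D n)
    fix x y i j l assume *: "x \<in> carrier R" "y \<in> carrier R" "i < k" "j < n i" "l < n i"
    show "(\<phi> (x \<otimes> y) ! i) (j, l) = (\<Oplus>\<^bsub>D i\<^esub>m\<in>{..<n i}. (\<phi> x ! i) (j, m) \<otimes>\<^bsub>D i\<^esub> (\<phi> y ! i) (m, l))"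
      unfolding \<phi>E(2)[OF *(1,2)] RDirProd_list_mult_add[OF \<phi>E(1)[OF *(1)] \<phi>E(1)[OF *(2)]]
      using * by (simp add: Rs matrix_ring_simps(2))
    show "(\<phi> (x \<oplus> y) ! i) (j, l) = (\<phi> x ! i) (j, l) \<oplus>\<^bsub>D i\<^esub> (\<phi> y ! i) (j, l)"
      unfolding \<phi>E(3)[OF *(1,2)] RDirProd_list_mult_add[OF \<phi>E(1)[OF *(1)] \<phi>E(1)[OF *(2)]]
      using * by (simp add: Rs matrix_ring_simps(3))
  next
    fix x i j l assume "x \<in> carrier R" "i < k" "j < n i" "l < n i"
    then show "(\<phi> x ! i) (j, l) \<in> carrier (D i)" using \<phi>c(2)[of x i] by (auto simp: PiE_iff)
  next
    fix i j l assume "i < k" "j < n i" "l < n i"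
    then show "(\<phi> \<one> ! i) (j, l) = (if j = l then \<one>\<^bsub>D i\<^esub> else \<zero>\<^bsub>D i\<^esub>)"
      unfolding \<phi>E(4) RDirProd_list_one_eq by (simp add: Rs matrix_ring_simps(4))
  next
    fix x y assume xy: "x \<in> carrier R" "y \<in> carrier R"
      and eq: "\<And>i j l. i < k \<Longrightarrow> j < n i \<Longrightarrow> l < n i \<Longrightarrow> (\<phi> x ! i) (j, l) = (\<phi> y ! i) (j, l)"
    have "\<phi> x = \<phi> y"
    proof (rule nth_equalityI)
      fix i assume "i < length (\<phi> x)"
      then have i: "i < k" using \<phi>c(1) xy by simp
      show "\<phi> x ! i = \<phi> y ! i"
        by (rule extensionalityI[where A = "{..<n i} \<times> {..<n i}"])
           (use i eq \<phi>c(2)[OF xy(1) i] \<phi>c(2)[OF xy(2) i] in \<open>auto simp: PiE_iff\<close>)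
    qed (simp add: \<phi>c(1) xy)
    then show "x = y" using \<phi>E(5) xy by (auto simp: bij_betw_def inj_on_def)
  next
    fix a assume a: "\<And>i j l. i < k \<Longrightarrow> j < n i \<Longrightarrow> l < n i \<Longrightarrow> a i j l \<in> carrier (D i)"
    define as where "as = map (\<lambda>i. \<lambda>(j, l)\<in>{..<n i} \<times> {..<n i}. a i j l) [0..<k]"
    have "as \<in> carrier (RDirProd_list Rs)"
      unfolding RDirProd_list_carrier_iff using a by (auto simp: as_def Rs matrix_ring_simps(1))
    then have "as \<in> \<phi> ` carrier R" using \<phi>E(5) by (simp add: bij_betw_def)
    then obtain x where x: "x \<in> carrier R" "\<phi> x = as" by blast
    have "(\<phi> x ! i) (j, l) = a i j l" if "i < k" "j < n i" "l < n i" for i j l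
      unfolding x(2) as_def using that by simp
    then show "\<exists>x\<in>carrier R. \<forall>i<k. \<forall>j<n i. \<forall>l<n i. (\<phi> x ! i) (j, l) = a i j l"
      using x(1) by blast
  qed
  then show ?thesis by blast
qed

section \<open>Matrix frames\<close>

text \<open>The matrix units of \<open>\<Prod>\<^sub>i M\<^bsub>n i\<^esub>(e\<^sub>i R e\<^sub>i)\<close> are \<open>u i j \<otimes> v i l\<close>. The last two assumptions say,
  without a sum, that the \<open>u i j \<otimes> v i j\<close> add up to the identity.\<close>

locale matrix_frame = ring R for R :: "('a, 'r) ring_scheme" (structure) +
  fixes k :: nat and n :: "nat \<Rightarrow> nat" and e :: "nat \<Rightarrow> 'a" and u v :: "nat \<Rightarrow> nat \<Rightarrow> 'a"
  assumes size_pos: "i < k \<Longrightarrow> 0 < n i"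
    and e_closed: "i < k \<Longrightarrow> e i \<in> carrier R"
    and u_closed: "\<lbrakk>i < k; j < n i\<rbrakk> \<Longrightarrow> u i j \<in> carrier R"
    and v_closed: "\<lbrakk>i < k; j < n i\<rbrakk> \<Longrightarrow> v i j \<in> carrier R"
    and u_e: "\<lbrakk>i < k; j < n i\<rbrakk> \<Longrightarrow> u i j \<otimes> e i = u i j"
    and e_v: "\<lbrakk>i < k; j < n i\<rbrakk> \<Longrightarrow> e i \<otimes> v i j = v i j"
    and v_u: "\<lbrakk>i < k; j < n i; l < n i\<rbrakk> \<Longrightarrow> v i j \<otimes> u i l = (if j = l then e i else \<zero>)"
    and separate: "\<lbrakk>i < k; i' < k; i \<noteq> i'; x \<in> carrier R\<rbrakk> \<Longrightarrow> e i \<otimes> x \<otimes> e i' = \<zero>"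
    and faithful_left: "\<lbrakk>x \<in> carrier R; \<And>i j. \<lbrakk>i < k; j < n i\<rbrakk> \<Longrightarrow> v i j \<otimes> x = \<zero>\<rbrakk> \<Longrightarrow> x = \<zero>"
    and faithful_right: "\<lbrakk>x \<in> carrier R; \<And>i j. \<lbrakk>i < k; j < n i\<rbrakk> \<Longrightarrow> x \<otimes> u i j = \<zero>\<rbrakk> \<Longrightarrow> x = \<zero>"
begin

lemma e_idem: "i < k \<Longrightarrow> e i \<otimes> e i = e i"
proof -
  assume i: "i < k"
  have e: "e i = v i 0 \<otimes> u i 0" using v_u[OF i size_pos[OF i] size_pos[OF i]] by simp
  have "e i \<otimes> (v i 0 \<otimes> u i 0) = (e i \<otimes> v i 0) \<otimes> u i 0"
    using e_closed[OF i] u_closed[OF i size_pos[OF i]] v_closed[OF i size_pos[OF i]] by (simp add: m_assoc)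
  then show "e i \<otimes> e i = e i" using e e_v[OF i size_pos[OF i]] by simp
qed

text \<open>\<open>v i j\<close> absorbs \<open>e i\<close> on its left and \<open>u i' j'\<close>
  absorbs \<open>e i'\<close> on its right, so \<open>separate\<close> applies to everything between
  them.\<close>

lemma v_mult_u_zero:
  assumes "i < k" "j < n i" "i' < k" "j' < n i'" "i \<noteq> i'" "x \<in> carrier R"
  shows "v i j \<otimes> x \<otimes> u i' j' = \<zero>"
proof -
  have c: "v i j \<in> carrier R" "u i' j' \<in> carrier R" "e i \<in> carrier R" "e i' \<in> carrier R"
    using assms v_closed u_closed e_closed by auto
  have "v i j \<otimes> x \<otimes> u i' j' = (e i \<otimes> v i j) \<otimes> x \<otimes> (u i' j' \<otimes> e i')" using assms e_v u_e by simp
  also have "\<dots> = e i \<otimes> (v i j \<otimes> x \<otimes> u i' j') \<otimes> e i'" using c assms by (simp add: m_assoc)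
  also have "\<dots> = \<zero>" using separate assms c by simp
  finally show ?thesis .
qed

lemma v_u_zero:
  assumes "i < k" "j < n i" "i' < k" "j' < n i'" "i \<noteq> i'"
  shows "v i j \<otimes> u i' j' = \<zero>"
  using v_mult_u_zero[OF assms one_closed] v_closed assms by simp

lemma eq_leftI:
  assumes "x \<in> carrier R" "y \<in> carrier R" "\<And>i j. \<lbrakk>i < k; j < n i\<rbrakk> \<Longrightarrow> v i j \<otimes> x = v i j \<otimes> y"
  shows "x = y"
proof -
  have "v i j \<otimes> (x \<ominus> y) = \<zero>" if "i < k" "j < n i" for i j
    using assms that v_closed[OF that] by (simp add: a_minus_def r_distr r_minus r_neg)
  then have "x \<ominus> y = \<zero>" using faithful_left assms(1,2) by simp
  then show ?thesis using assms(1,2) by simp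
qed

lemma eq_rightI:
  assumes "x \<in> carrier R" "y \<in> carrier R" "\<And>i j. \<lbrakk>i < k; j < n i\<rbrakk> \<Longrightarrow> x \<otimes> u i j = y \<otimes> u i j"
  shows "x = y"
proof -
  have "(x \<ominus> y) \<otimes> u i j = \<zero>" if "i < k" "j < n i" for i j
    using assms that u_closed[OF that] by (simp add: a_minus_def l_distr l_minus r_neg)
  then have "x \<ominus> y = \<zero>" using faithful_right assms(1,2) by simp
  then show ?thesis using assms(1,2) by simp
qed

lemma corner_coord:
  assumes "i < k" "j < n i" "l < n i" "x \<in> carrier R"
  shows "v i j \<otimes> x \<otimes> u i l \<in> carrier (corner R (e i))"
proof -
  have c: "v i j \<in> carrier R" "u i l \<in> carrier R" "e i \<in> carrier R"
    using assms v_closed u_closed e_closed by auto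
  have "e i \<otimes> (v i j \<otimes> x \<otimes> u i l) = (e i \<otimes> v i j) \<otimes> x \<otimes> u i l" using c assms(4) by (simp add: m_assoc)
  moreover have "v i j \<otimes> x \<otimes> u i l \<otimes> e i = v i j \<otimes> x \<otimes> (u i l \<otimes> e i)" using c assms(4) by (simp add: m_assoc)
  ultimately show ?thesis using c assms e_v u_e by simp
qed

text \<open>Inserting the identity \<open>z\<close> of block i, the sum of the
  \<open>u i m \<otimes> v i m\<close>, between \<open>x\<close> and \<open>y\<close> turns the
  product into matrix multiplication.\<close>

lemma coord_product:
  assumes "i < k" "j < n i" "l < n i" "x \<in> carrier R" "y \<in> carrier R"
  shows "v i j \<otimes> (x \<otimes> y) \<otimes> u i l = (\<Oplus>m\<in>{..<n i}. (v i j \<otimes> x \<otimes> u i m) \<otimes> (v i m \<otimes> y \<otimes> u i l))"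
proof -
  define z where "z = (\<Oplus>m\<in>{..<n i}. u i m \<otimes> v i m)"
  have uv: "u i m \<in> carrier R" "v i m \<in> carrier R" if "m < n i" for m
    using that assms(1) u_closed v_closed by auto
  have zc: "z \<in> carrier R" unfolding z_def using uv by (intro finsum_closed) auto
  have zu: "z \<otimes> u i' j' = (if i' = i then u i j' else \<zero>)" if ij': "i' < k" "j' < n i'" for i' j'
  proof -
    have uc: "u i' j' \<in> carrier R" using u_closed ij' by blast
    have "z \<otimes> u i' j' = (\<Oplus>m\<in>{..<n i}. u i m \<otimes> v i m \<otimes> u i' j')"
      unfolding z_def by (rule finsum_ldistr) (use uv uc in auto)
    also have "\<dots> = (if i' = i then u i j' else \<zero>)"
    proof (cases "i' = i")
      case True
      have "(\<Oplus>m\<in>{..<n i}. u i m \<otimes> v i m \<otimes> u i' j') = (\<Oplus>m\<in>{..<n i}. if j' = m then u i m else \<zero>)"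
        by (rule finsum_cong') (use uv uc assms(1) ij' v_u u_e True in \<open>auto simp: m_assoc\<close>)
      also have "\<dots> = u i j'" by (rule finsum_singleton) (use uv ij' True in auto)
      finally show ?thesis using True by simp
    next
      case False
      then have "(\<Oplus>m\<in>{..<n i}. u i m \<otimes> v i m \<otimes> u i' j') = (\<Oplus>m\<in>{..<n i}. \<zero>)"
        by (intro finsum_cong') (use uv uc assms(1) ij' v_u_zero in \<open>auto simp: m_assoc\<close>)
      then show ?thesis using False by simp
    qed
    finally show ?thesis .
  qed
  have vx: "v i j \<otimes> x \<in> carrier R" using v_closed assms by simp
  \<comment> \<open>Tested on all columns: \<open>z\<close> fixes those of block i, and those of
    other blocks give zero on both sides.\<close>
  have "(v i j \<otimes> x) \<otimes> z = v i j \<otimes> x"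
  proof (rule eq_rightI)
    fix i' j' assume ij': "i' < k" "j' < n i'"
    show "v i j \<otimes> x \<otimes> z \<otimes> u i' j' = v i j \<otimes> x \<otimes> u i' j'"
      using zu[OF ij'] v_mult_u_zero[of i j i' j' x] ij' assms vx zc u_closed[OF ij']
      by (auto simp: m_assoc[OF vx])
  qed (use vx zc in auto)
  then have "v i j \<otimes> (x \<otimes> y) \<otimes> u i l = (v i j \<otimes> x) \<otimes> z \<otimes> (y \<otimes> u i l)"
    using assms uv by (simp add: m_assoc)
  also have "\<dots> = (v i j \<otimes> x) \<otimes> (z \<otimes> (y \<otimes> u i l))" using m_assoc[OF vx zc] assms uv by simp
  also have "z \<otimes> (y \<otimes> u i l) = (\<Oplus>m\<in>{..<n i}. u i m \<otimes> v i m \<otimes> (y \<otimes> u i l))"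
    unfolding z_def by (rule finsum_ldistr) (use uv assms in auto)
  also have "(v i j \<otimes> x) \<otimes> (\<Oplus>m\<in>{..<n i}. u i m \<otimes> v i m \<otimes> (y \<otimes> u i l))
      = (\<Oplus>m\<in>{..<n i}. (v i j \<otimes> x) \<otimes> (u i m \<otimes> v i m \<otimes> (y \<otimes> u i l)))"
    by (rule finsum_rdistr) (use uv assms vx in auto)
  also have "\<dots> = (\<Oplus>m\<in>{..<n i}. (v i j \<otimes> x \<otimes> u i m) \<otimes> (v i m \<otimes> y \<otimes> u i l))"
    by (rule finsum_cong') (use uv assms in \<open>auto simp: m_assoc\<close>)
  finally show ?thesis .
qed

text \<open>The sum of all \<open>u i j \<otimes> a i j l \<otimes> v i l\<close> has the prescribed
  entries, since a row on the left and a column on the right select a single summand.\<close>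

lemma coord_surj:
  assumes a: "\<And>i j l. \<lbrakk>i < k; j < n i; l < n i\<rbrakk> \<Longrightarrow> a i j l \<in> carrier (corner R (e i))"
  shows "\<exists>x\<in>carrier R. \<forall>i<k. \<forall>j<n i. \<forall>l<n i. v i j \<otimes> x \<otimes> u i l = a i j l"
proof -
  define P where "P = (SIGMA i:{..<k}. {..<n i} \<times> {..<n i})"
  have finP: "finite P" by (auto simp: P_def)
  have P: "(i, j, l) \<in> P \<longleftrightarrow> i < k \<and> j < n i \<and> l < n i" for i j l by (auto simp: P_def)
  define g where "g = (\<lambda>(i, j, l). u i j \<otimes> a i j l \<otimes> v i l)"
  have ac: "a i j l \<in> carrier R" "e i \<otimes> a i j l = a i j l" "a i j l \<otimes> e i = a i j l"
    if "(i, j, l) \<in> P" for i j l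
    using a that by (auto simp: P)
  have gc: "g \<in> P \<rightarrow> carrier R" using ac(1) u_closed v_closed by (auto simp: g_def P)
  define x where "x = (\<Oplus>p\<in>P. g p)"
  have xc: "x \<in> carrier R" unfolding x_def by (rule finsum_closed[OF gc])
  have "v i j \<otimes> x \<otimes> u i l = a i j l" if ijl: "i < k" "j < n i" "l < n i" for i j l
  proof -
    have c: "v i j \<in> carrier R" "u i l \<in> carrier R" using u_closed v_closed ijl by auto
    have inP: "(i, j, l) \<in> P" using ijl by (simp add: P)
    have summand: "v i j \<otimes> g p \<otimes> u i l = (if (i, j, l) = p then a i j l else \<zero>)" if p: "p \<in> P" for p
    proof -
      obtain i' j' l' where p': "p = (i', j', l')" "i' < k" "j' < n i'" "l' < n i'"
        using p by (auto simp: P_def)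
      note ac' = ac[OF p[unfolded p'(1)]]
      have c': "u i' j' \<in> carrier R" "v i' l' \<in> carrier R" "e i \<in> carrier R"
        using p' u_closed v_closed e_closed ijl by auto
      have *: "v i j \<otimes> g p \<otimes> u i l = (v i j \<otimes> u i' j') \<otimes> a i' j' l' \<otimes> (v i' l' \<otimes> u i l)"
        unfolding g_def p'(1) using c c' ac'(1) by (simp add: m_assoc)
      show ?thesis
      proof (cases "i' = i")
        case False
        then have "v i j \<otimes> u i' j' = \<zero>" using v_u_zero[of i j i' j'] ijl p' by auto
        then show ?thesis unfolding * using c c' ac'(1) False p'(1) by simp
      next
        case True
        then show ?thesis unfolding * using v_u[of i j j'] v_u[of i l' l] ijl p' ac' c'(3) by auto
      qed
    qed
    have "v i j \<otimes> x \<otimes> u i l = (\<Oplus>p\<in>P. v i j \<otimes> g p) \<otimes> u i l"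
      unfolding x_def using finsum_rdistr[OF finP c(1) gc] by simp
    also have "\<dots> = (\<Oplus>p\<in>P. v i j \<otimes> g p \<otimes> u i l)"
      by (rule finsum_ldistr) (use finP c gc in auto)
    also have "\<dots> = (\<Oplus>p\<in>P. if (i, j, l) = p then a i j l else \<zero>)"
      by (rule finsum_cong') (use summand ac(1)[OF inP] in auto)
    also have "\<dots> = a i j l"
      by (rule finsum_singleton) (use inP finP ac(1)[OF inP] in auto)
    finally show ?thesis .
  qed
  then show ?thesis using xc by blast
qed

text \<open>An entry is taken by a row on the left and a column on the right. The entries determine
  the element because the two faithfulness axioms can be applied one after the other.\<close>

lemma matrix_coordinates_corner:
  "matrix_coordinates R k n (\<lambda>i. corner R (e i)) (\<lambda>x i j l. v i j \<otimes> x \<otimes> u i l)"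
proof (intro matrix_coordinates.intro matrix_coordinates_axioms.intro ring_axioms)
  fix i assume "i < k" then show "ring (corner R (e i))" using corner_ring e_closed e_idem by blast
next
  fix x y i j l assume *: "x \<in> carrier R" "y \<in> carrier R" "i < k" "j < n i" "l < n i"
  have "(\<Oplus>\<^bsub>corner R (e i)\<^esub>m\<in>{..<n i}. (v i j \<otimes> x \<otimes> u i m) \<otimes>\<^bsub>corner R (e i)\<^esub> (v i m \<otimes> y \<otimes> u i l))
      = (\<Oplus>m\<in>{..<n i}. (v i j \<otimes> x \<otimes> u i m) \<otimes> (v i m \<otimes> y \<otimes> u i l))"
  proof (subst finsum_corner)
    interpret C: ring "corner R (e i)" using corner_ring e_closed e_idem * by blast
    show "(\<lambda>m. (v i j \<otimes> x \<otimes> u i m) \<otimes>\<^bsub>corner R (e i)\<^esub> (v i m \<otimes> y \<otimes> u i l)) \<in> {..<n i} \<rightarrow> carrier (corner R (e i))"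
      using * corner_coord by (intro Pi_I C.m_closed) auto
  qed (use * e_closed e_idem in auto)
  then show "v i j \<otimes> (x \<otimes> y) \<otimes> u i l =
      (\<Oplus>\<^bsub>corner R (e i)\<^esub>m\<in>{..<n i}. (v i j \<otimes> x \<otimes> u i m) \<otimes>\<^bsub>corner R (e i)\<^esub> (v i m \<otimes> y \<otimes> u i l))"
    using coord_product * by simp
  show "v i j \<otimes> (x \<oplus> y) \<otimes> u i l = v i j \<otimes> x \<otimes> u i l \<oplus>\<^bsub>corner R (e i)\<^esub> v i j \<otimes> y \<otimes> u i l"
    using * u_closed v_closed by (simp add: r_distr l_distr)
next
  fix i j l assume "i < k" "j < n i" "l < n i"
  then show "v i j \<otimes> \<one> \<otimes> u i l = (if j = l then \<one>\<^bsub>corner R (e i)\<^esub> else \<zero>\<^bsub>corner R (e i)\<^esub>)"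
    using v_closed v_u by simp
next
  fix x y assume xy: "x \<in> carrier R" "y \<in> carrier R"
    and eq: "\<And>i j l. i < k \<Longrightarrow> j < n i \<Longrightarrow> l < n i \<Longrightarrow> v i j \<otimes> x \<otimes> u i l = v i j \<otimes> y \<otimes> u i l"
  show "x = y"
  proof (rule eq_leftI[OF xy])
    fix i j assume ij: "i < k" "j < n i"
    show "v i j \<otimes> x = v i j \<otimes> y"
    proof (rule eq_rightI)
      fix i' j' assume ij': "i' < k" "j' < n i'"
      show "v i j \<otimes> x \<otimes> u i' j' = v i j \<otimes> y \<otimes> u i' j'"
      proof (cases "i = i'")
        case True
        then show ?thesis using eq[of i j j'] ij ij' by simp
      next
        case False
        then show ?thesis using v_mult_u_zero[OF ij ij'] xy by simp
      qed
    qed (use xy v_closed[OF ij] in auto)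
  qed
qed (use size_pos corner_coord coord_surj in blast)+

text \<open>The passage from the corner eRe back to Re, where e is \<open>e i\<close>. Elements
  \<open>y\<close> of Re are determined by the products \<open>v i j \<otimes> y\<close>. If
  \<open>d\<close> generates the left ideal eN of the corner, then for \<open>y\<close> in
  \<open>N\<close> these are multiples of \<open>d\<close>, and reassembling the multipliers
  exhibits \<open>y\<close> as a multiple of \<open>d\<close>.\<close>

lemma virtually_simple_idem_of_corner:
  assumes i: "i < k" and D: "principal_left_ideal_domain (corner R (e i))"
  shows "virtually_simple_idem (e i)"
proof -
  interpret D: principal_left_ideal_domain "corner R (e i)" by fact
  note ec = e_closed[OF i] and ee = e_idem[OF i]
  note mI = mem_PIdl_idem_iff[OF ec ee]
  have "\<exists>d\<in>carrier R. e i \<otimes> d = d \<and> N = PIdl d \<and> (\<forall>r\<in>carrier R. r \<otimes> d = \<zero> \<longrightarrow> r \<otimes> e i = \<zero>)"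
    if N: "left_ideal N R" "N \<subseteq> PIdl (e i)" "N \<noteq> {\<zero>}" for N
  proof -
    note NI = left_idealD[OF N(1)]
    have Ne: "y \<in> carrier R" "y \<otimes> e i = y" if "y \<in> N" for y using that N(2) mI by blast+
    define L where "L = {y \<in> N. e i \<otimes> y = y}"
    have lL: "left_ideal L (corner R (e i))"
    proof (rule D.left_idealI)
      show "L \<subseteq> carrier (corner R (e i))" using Ne by (auto simp: L_def)
      show "\<zero>\<^bsub>corner R (e i)\<^esub> \<in> L" using NI(2) ec by (simp add: L_def)
      show "x \<oplus>\<^bsub>corner R (e i)\<^esub> y \<in> L" if "x \<in> L" "y \<in> L" for x y
        using that NI(3) Ne ec by (simp add: L_def r_distr)
      show "r \<otimes>\<^bsub>corner R (e i)\<^esub> x \<in> L" if "r \<in> carrier (corner R (e i))" "x \<in> L" for r x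
        using that NI(4) Ne ec by (simp add: L_def flip: m_assoc)
    qed
    obtain d where d: "d \<in> carrier (corner R (e i))"
      "L = {x \<otimes>\<^bsub>corner R (e i)\<^esub> d | x. x \<in> carrier (corner R (e i))}"
      using D.principal[OF lL] by blast
    have dc: "d \<in> carrier R" "e i \<otimes> d = d" "d \<otimes> e i = d" using d(1) by auto
    have "e i \<otimes>\<^bsub>corner R (e i)\<^esub> d = d" using dc by simp
    then have dL: "d \<in> L" unfolding d(2) using ec ee by force
    then have dN: "d \<in> N" by (simp add: L_def)
    have vzero: "v i' j' \<otimes> y = \<zero>" if "i' < k" "j' < n i'" "i' \<noteq> i" "y \<in> carrier R" "y \<otimes> e i = y" for i' j' y
    proof -
      have vc: "v i' j' \<in> carrier R" "e i' \<in> carrier R" using v_closed e_closed that by auto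
      have "v i' j' \<otimes> y = (e i' \<otimes> v i' j') \<otimes> (y \<otimes> e i)" using that e_v by simp
      also have "\<dots> = e i' \<otimes> (v i' j' \<otimes> y) \<otimes> e i" using vc that(4) ec by (simp add: m_assoc)
      also have "\<dots> = \<zero>" using separate[OF that(1) i that(3)] vc that(4) by simp
      finally show ?thesis .
    qed
    have "N = PIdl d"
    proof
      show "PIdl d \<subseteq> N" using PIdl_subset_iff[OF N(1) dc(1)] dN by blast
      show "N \<subseteq> PIdl d"
      proof
        fix y assume y: "y \<in> N"
        have "\<exists>c. c \<in> carrier (corner R (e i)) \<and> v i j \<otimes> y = c \<otimes> d" if "j < n i" for j
        proof -
          have "v i j \<otimes> y \<in> L"
            using NI(4) v_closed[OF i that] y Ne[OF y] ec e_v[OF i that] by (simp add: L_def flip: m_assoc)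
          then show ?thesis unfolding d(2) by auto
        qed
        then obtain c where c: "\<And>j. j < n i \<Longrightarrow> c j \<in> carrier (corner R (e i))"
          "\<And>j. j < n i \<Longrightarrow> v i j \<otimes> y = c j \<otimes> d" by metis
        have cc: "c j \<in> carrier R" "e i \<otimes> c j = c j" if "j < n i" for j using c(1)[OF that] by auto
        have ucc: "(\<lambda>j. u i j \<otimes> c j) \<in> {..<n i} \<rightarrow> carrier R" using cc u_closed[OF i] by auto
        \<comment> \<open>The columns \<open>u i j\<close> assemble the multipliers into one
          element, which the rows take apart again: \<open>v i j \<otimes> r = c j\<close>.\<close>
        define r where "r = (\<Oplus>j\<in>{..<n i}. u i j \<otimes> c j)"
        have rc: "r \<in> carrier R" unfolding r_def by (rule finsum_closed[OF ucc])
        have "y = r \<otimes> d"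
        proof (rule eq_leftI)
          fix i' j' assume ij: "i' < k" "j' < n i'"
          show "v i' j' \<otimes> y = v i' j' \<otimes> (r \<otimes> d)"
          proof (cases "i' = i")
            case False
            have "r \<otimes> d \<otimes> e i = r \<otimes> d" using rc dc ec by (simp add: m_assoc)
            then show ?thesis
              using vzero[OF ij False, of y] vzero[OF ij False, of "r \<otimes> d"] Ne[OF y] rc dc by simp
          next
            case True
            have vc: "v i j' \<in> carrier R" using v_closed ij True by simp
            have "v i j' \<otimes> r = (\<Oplus>j\<in>{..<n i}. v i j' \<otimes> (u i j \<otimes> c j))"
              unfolding r_def by (rule finsum_rdistr) (use ucc vc in auto)
            also have "\<dots> = (\<Oplus>j\<in>{..<n i}. if j' = j then c j else \<zero>)"
              by (rule finsum_cong') (use ij True i cc u_closed v_closed v_u in \<open>auto simp flip: m_assoc\<close>)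
            also have "\<dots> = c j'" by (rule finsum_singleton) (use ij True cc in auto)
            finally have "v i j' \<otimes> r = c j'" .
            then show ?thesis using c(2) ij True vc rc dc by (simp flip: m_assoc)
          qed
        qed (use Ne[OF y] rc dc in auto)
        then show "y \<in> PIdl d" using mem_PIdlI rc by simp
      qed
    qed
    moreover have "r \<otimes> e i = \<zero>" if r: "r \<in> carrier R" "r \<otimes> d = \<zero>" for r
    proof (rule faithful_left)
      have d0: "d \<noteq> \<zero>" using \<open>N = PIdl d\<close> N(3) PIdl_zero by auto
      fix i' j' assume ij: "i' < k" "j' < n i'"
      show "v i' j' \<otimes> (r \<otimes> e i) = \<zero>"
      proof (cases "i' = i")
        case False
        then show ?thesis using vzero[OF ij False] r(1) ec ee by (simp add: m_assoc)
      next
        case True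
        have vc: "v i j' \<in> carrier R" "e i \<otimes> v i j' = v i j'" using v_closed e_v ij True by auto
        define q where "q = v i j' \<otimes> (r \<otimes> e i)"
        have "e i \<otimes> q = q" unfolding q_def using vc r(1) ec by (simp flip: m_assoc)
        moreover have "q \<otimes> e i = q" unfolding q_def using vc r(1) ec ee by (simp add: m_assoc)
        ultimately have "q \<in> carrier (corner R (e i))" using vc r(1) ec by (simp add: q_def)
        moreover have "q \<otimes> d = \<zero>" unfolding q_def using vc r ec dc by (simp add: m_assoc)
        ultimately have "q = \<zero>" using D.integral[of q d] d(1) d0 by auto
        then show ?thesis using True by (simp add: q_def)
      qed
    qed (use r ec in auto)
    ultimately show ?thesis using dc by blast
  qed
  moreover have "e i \<noteq> \<zero>" using D.one_not_zero by simp
  ultimately show ?thesis unfolding virtually_simple_idem_def using ec ee by blast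
qed

end

text \<open>A left ideal in Rf is pulled back along \<open>u\<close> to Re, and the generator
  \<open>d\<close> found there returns as \<open>v \<otimes> d \<otimes> u\<close>.\<close>

lemma (in ring) virtually_simple_idem_iso:
  assumes e: "virtually_simple_idem e" and f: "iso_idem e f"
  shows "virtually_simple_idem f"
proof -
  note eD = virtually_simple_idemD[OF e]
  obtain u v where u: "u \<in> carrier R" "v \<in> carrier R" "e \<otimes> u = u" "u \<otimes> f = u" "f \<otimes> v = v" "v \<otimes> e = v"
    "u \<otimes> v = e" "v \<otimes> u = f" using f unfolding iso_idem_def by blast
  have fc: "f \<in> carrier R" using u by auto
  have ff: "f \<otimes> f = f" using u by (metis m_assoc fc)
  have f0: "f \<noteq> \<zero>" using u eD by (metis l_null r_null)
  have "\<exists>d\<in>carrier R. f \<otimes> d = d \<and> N = PIdl d \<and> (\<forall>r\<in>carrier R. r \<otimes> d = \<zero> \<longrightarrow> r \<otimes> f = \<zero>)"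
    if N: "left_ideal N R" "N \<subseteq> PIdl f" "N \<noteq> {\<zero>}" for N
  proof -
    note NI = left_idealD[OF N(1)]
    have Nf: "y \<in> carrier R" "y \<otimes> f = y" if "y \<in> N" for y using that N(2) mem_PIdl_idem_iff[OF fc ff] by blast+
    have yvu: "y \<otimes> v \<otimes> u = y" if "y \<in> N" for y using Nf[OF that] u by (simp add: m_assoc)
    define M where "M = {x \<in> carrier R. x \<otimes> e = x \<and> x \<otimes> u \<in> N}"
    have yvM: "y \<otimes> v \<in> M" if y: "y \<in> N" for y
    proof -
      have "y \<otimes> v \<otimes> e = y \<otimes> v" using Nf(1)[OF y] u(2,6) eD(1) by (simp add: m_assoc)
      then show ?thesis using yvu[OF y] Nf(1)[OF y] y u(2) by (simp add: M_def)
    qed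
    have lM: "left_ideal M R"
      by (rule left_idealI) (use NI(2-4) u(1) eD(1) in \<open>auto simp: M_def l_distr m_assoc\<close>)
    have Me: "M \<subseteq> PIdl e" using mem_PIdl_idem_iff[OF eD(1,2)] by (auto simp: M_def)
    obtain y where y: "y \<in> N" "y \<noteq> \<zero>" using N(3) NI(2) by blast
    then have "y \<otimes> v \<noteq> \<zero>" using yvu[OF y(1)] u(1) by auto
    then have "M \<noteq> {\<zero>}" using yvM[OF y(1)] by blast
    then obtain d where d: "d \<in> carrier R" "e \<otimes> d = d" "d \<otimes> e = d" "M = PIdl d"
      "\<And>r. r \<in> carrier R \<Longrightarrow> r \<otimes> d = \<zero> \<Longrightarrow> r \<otimes> e = \<zero>"
      using virtually_simple_idemE[OF e lM Me] by blast
    define d' where "d' = v \<otimes> d \<otimes> u"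
    have d'c: "d' \<in> carrier R" "f \<otimes> d' = d'" unfolding d'_def using d u fc by (simp_all flip: m_assoc)
    have ud': "u \<otimes> d' = d \<otimes> u" unfolding d'_def using u d by (simp flip: m_assoc)
    have "N = PIdl d'"
    proof
      have "d \<in> M" using d self_mem_PIdl by blast
      then have "d' \<in> N" using NI(4)[OF u(2)] u(1,2) d(1) by (simp add: M_def d'_def m_assoc)
      then show "PIdl d' \<subseteq> N" using PIdl_subset_iff[OF N(1) d'c(1)] by blast
      show "N \<subseteq> PIdl d'"
      proof
        fix y assume y: "y \<in> N"
        then have "y \<otimes> v \<in> PIdl d" using d(4) yvM by blast
        then obtain r where r: "r \<in> carrier R" "y \<otimes> v = r \<otimes> d" by (rule mem_PIdlE)
        have "y = y \<otimes> v \<otimes> u" using yvu[OF y] by simp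
        also have "\<dots> = r \<otimes> (d \<otimes> u)" unfolding r(2) using r(1) d u by (simp add: m_assoc)
        also have "\<dots> = (r \<otimes> u) \<otimes> d'" unfolding ud'[symmetric] using r(1) d'c u by (simp add: m_assoc)
        finally show "y \<in> PIdl d'" using mem_PIdlI r(1) u by simp
      qed
    qed
    moreover have "r \<otimes> f = \<zero>" if r: "r \<in> carrier R" "r \<otimes> d' = \<zero>" for r
    proof -
      have "r \<otimes> v \<otimes> d = r \<otimes> v \<otimes> (d \<otimes> (u \<otimes> v))" using u(7) d by simp
      also have "\<dots> = (r \<otimes> d') \<otimes> v" unfolding d'_def using r(1) u(1,2) d(1) by (simp add: m_assoc)
      also have "\<dots> = \<zero>" using r u by simp
      finally have "r \<otimes> v \<otimes> e = \<zero>" using d(5) r u by simp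
      then have "r \<otimes> v = \<zero>" using r u eD by (simp add: m_assoc)
      then have "r \<otimes> v \<otimes> u = \<zero>" using u by simp
      then show ?thesis using r u by (simp add: m_assoc)
    qed
    ultimately show ?thesis using d'c by blast
  qed
  then show ?thesis unfolding virtually_simple_idem_def using fc ff f0 by blast
qed

text \<open>Each \<open>u i j \<otimes> v i j\<close> is isomorphic to \<open>e i\<close> through
  \<open>u i j\<close> and \<open>v i j\<close> themselves. That these diagonal units add up to the
  identity is tested by multiplying with each row, which only one of them survives.\<close>

lemma (in matrix_frame) virtually_simple_decomposition:
  assumes vs: "\<And>i. i < k \<Longrightarrow> virtually_simple_idem (e i)"
  shows "virtually_simple_decomposition ((\<lambda>(i, j). u i j \<otimes> v i j) ` (SIGMA i:{..<k}. {..<n i}))"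
    (is "virtually_simple_decomposition ?E")
  unfolding virtually_simple_decomposition_def
proof (intro conjI ballI impI)
  show fin: "finite ?E" by auto
  have elem: "\<exists>i j. i < k \<and> j < n i \<and> f = u i j \<otimes> v i j" if "f \<in> ?E" for f using that by auto
  have vuv: "v i j \<otimes> (u i j \<otimes> v i j) = v i j" if "i < k" "j < n i" for i j
    using that u_closed v_closed v_u e_v by (simp flip: m_assoc)
  have v0: "v i j \<otimes> (u i' j' \<otimes> v i' j') = \<zero>" if "i < k" "j < n i" "i' < k" "j' < n i'" "(i, j) \<noteq> (i', j')" for i j i' j'
  proof -
    have c: "v i j \<in> carrier R" "u i' j' \<in> carrier R" "v i' j' \<in> carrier R" using that u_closed v_closed by auto
    have "v i j \<otimes> u i' j' = \<zero>" using that v_u[of i j j'] v_u_zero[of i j i' j'] by (cases "i = i'") auto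
    then show ?thesis using c by (simp flip: m_assoc)
  qed
  show "virtually_simple_idem f" if f: "f \<in> ?E" for f
  proof -
    obtain i j where ij: "i < k" "j < n i" "f = u i j \<otimes> v i j" using elem[OF f] by blast
    have c: "u i j \<in> carrier R" "v i j \<in> carrier R" "e i \<in> carrier R" using ij u_closed v_closed e_closed by auto
    have "v i j \<otimes> f = v i j" "f \<otimes> u i j = u i j" "v i j \<otimes> u i j = e i" "u i j \<otimes> e i = u i j" "e i \<otimes> v i j = v i j"
      using vuv[OF ij(1,2)] v_u[OF ij(1,2,2)] u_e[OF ij(1,2)] e_v[OF ij(1,2)] c unfolding ij(3)
      by (simp_all add: m_assoc)
    then have "iso_idem (e i) f" unfolding iso_idem_def using c ij(3) by blast
    then show ?thesis using virtually_simple_idem_iso vs ij(1) by blast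
  qed
  show "f \<otimes> f' = \<zero>" if f: "f \<in> ?E" "f' \<in> ?E" "f \<noteq> f'" for f f'
  proof -
    obtain i j where ij: "i < k" "j < n i" "f = u i j \<otimes> v i j" using elem[OF f(1)] by blast
    obtain i' j' where ij': "i' < k" "j' < n i'" "f' = u i' j' \<otimes> v i' j'" using elem[OF f(2)] by blast
    have c: "u i j \<in> carrier R" "v i j \<in> carrier R" "f' \<in> carrier R" using ij ij' u_closed v_closed by auto
    have "(i, j) \<noteq> (i', j')" using f(3) ij(3) ij'(3) by blast
    then have "v i j \<otimes> f' = \<zero>" using v0 ij ij' by simp
    then show ?thesis unfolding ij(3) using c by (simp add: m_assoc)
  qed
  have Ec: "(\<lambda>f. f) \<in> ?E \<rightarrow> carrier R" using u_closed v_closed by auto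
  show "(\<Oplus>f\<in>?E. f) = \<one>"
  proof (rule eq_leftI)
    fix i j assume ij: "i < k" "j < n i"
    have vc: "v i j \<in> carrier R" using ij v_closed by blast
    have "v i j \<otimes> (\<Oplus>f\<in>?E. f) = (\<Oplus>f\<in>?E. v i j \<otimes> f)"
      by (rule finsum_rdistr) (use fin Ec vc in auto)
    also have "\<dots> = (\<Oplus>f\<in>?E. if u i j \<otimes> v i j = f then v i j else \<zero>)"
    proof (rule finsum_cong'[OF refl])
      fix f assume "f \<in> ?E"
      then obtain i' j' where ij': "i' < k" "j' < n i'" "f = u i' j' \<otimes> v i' j'" using elem by blast
      show "v i j \<otimes> f = (if u i j \<otimes> v i j = f then v i j else \<zero>)"
      proof (cases "u i j \<otimes> v i j = f")
        case True then show ?thesis using vuv[OF ij] by auto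
      next
        case False
        then have "(i, j) \<noteq> (i', j')" using ij'(3) by blast
        then show ?thesis using False v0[OF ij ij'(1,2)] ij'(3) by simp
      qed
    qed (use vc in auto)
    also have "\<dots> = v i j" by (rule finsum_singleton) (use ij fin vc in auto)
    finally show "v i j \<otimes> (\<Oplus>f\<in>?E. f) = v i j \<otimes> \<one>" using vc by simp
  qed (use finsum_closed[OF Ec] in auto)
qed

section \<open>Matrix units in a ring with matrix coordinates\<close>

context matrix_coordinates
begin

text \<open>The matrix unit scaled by \<open>d\<close>. \<open>coord_surj\<close> provides such an
  element and \<open>coord_inj\<close> makes it unique, so the choice is harmless.\<close>

definition unit :: "nat \<Rightarrow> nat \<Rightarrow> nat \<Rightarrow> 'd \<Rightarrow> 'a" where
  "unit i j l d = (SOME x. x \<in> carrier R \<and> (\<forall>i'<k. \<forall>j'<n i'. \<forall>l'<n i'.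
    ent x i' j' l' = (if i' = i \<and> j' = j \<and> l' = l then d else \<zero>\<^bsub>D i'\<^esub>)))"

lemma unit:
  assumes "i < k" "j < n i" "l < n i" "d \<in> carrier (D i)"
  shows unit_closed: "unit i j l d \<in> carrier R"
    and ent_unit: "\<And>i' j' l'. \<lbrakk>i' < k; j' < n i'; l' < n i'\<rbrakk> \<Longrightarrow>
      ent (unit i j l d) i' j' l' = (if i' = i \<and> j' = j \<and> l' = l then d else \<zero>\<^bsub>D i'\<^esub>)"
proof -
  have "\<exists>x\<in>carrier R. \<forall>i'<k. \<forall>j'<n i'. \<forall>l'<n i'.
      ent x i' j' l' = (if i' = i \<and> j' = j \<and> l' = l then d else \<zero>\<^bsub>D i'\<^esub>)"
    by (rule coord_surj) (use assms ring_D ring.ring_simprules(2) in auto)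
  then have "\<exists>x. x \<in> carrier R \<and> (\<forall>i'<k. \<forall>j'<n i'. \<forall>l'<n i'.
      ent x i' j' l' = (if i' = i \<and> j' = j \<and> l' = l then d else \<zero>\<^bsub>D i'\<^esub>))" by blast
  from someI_ex[OF this] show "unit i j l d \<in> carrier R"
    "\<And>i' j' l'. \<lbrakk>i' < k; j' < n i'; l' < n i'\<rbrakk> \<Longrightarrow>
      ent (unit i j l d) i' j' l' = (if i' = i \<and> j' = j \<and> l' = l then d else \<zero>\<^bsub>D i'\<^esub>)"
    unfolding unit_def by blast+
qed

lemma ent_zero: "\<lbrakk>i < k; j < n i; l < n i\<rbrakk> \<Longrightarrow> ent \<zero> i j l = \<zero>\<^bsub>D i\<^esub>"
proof -
  assume *: "i < k" "j < n i" "l < n i"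
  interpret Di: ring "D i" using ring_D *(1) .
  have "ent \<zero> i j l = ent \<zero> i j l \<oplus>\<^bsub>D i\<^esub> ent \<zero> i j l" using coord_add[of \<zero> \<zero> i j l] * by simp
  then show ?thesis using coord_closed[of \<zero> i j l] * by (metis Di.add.l_cancel_one zero_closed)
qed

lemma ent_unit_mult:
  assumes "i < k" "j < n i" "l < n i" "d \<in> carrier (D i)" "x \<in> carrier R" "i' < k" "j' < n i'" "l' < n i'"
  shows "ent (unit i j l d \<otimes> x) i' j' l' = (if i' = i \<and> j' = j then d \<otimes>\<^bsub>D i\<^esub> ent x i l l' else \<zero>\<^bsub>D i'\<^esub>)"
proof -
  interpret Di: ring "D i'" using ring_D assms(6) .
  interpret Di0: ring "D i" using ring_D assms(1) .
  note uc = unit_closed[OF assms(1-4)] and eu = ent_unit[OF assms(1-4) assms(6,7)]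
  have c: "ent x i' m l' \<in> carrier (D i')" if "m < n i'" for m using coord_closed assms that by blast
  have "ent (unit i j l d \<otimes> x) i' j' l' = (\<Oplus>\<^bsub>D i'\<^esub>m\<in>{..<n i'}. ent (unit i j l d) i' j' m \<otimes>\<^bsub>D i'\<^esub> ent x i' m l')"
    using coord_mult[OF uc assms(5-8)] .
  also have "\<dots> = (if i' = i \<and> j' = j then d \<otimes>\<^bsub>D i\<^esub> ent x i l l' else \<zero>\<^bsub>D i'\<^esub>)"
  proof (cases "i' = i \<and> j' = j")
    case True
    have "(\<Oplus>\<^bsub>D i'\<^esub>m\<in>{..<n i'}. ent (unit i j l d) i' j' m \<otimes>\<^bsub>D i'\<^esub> ent x i' m l')
        = (\<Oplus>\<^bsub>D i'\<^esub>m\<in>{..<n i'}. if l = m then d \<otimes>\<^bsub>D i'\<^esub> ent x i' m l' else \<zero>\<^bsub>D i'\<^esub>)"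
      by (rule Di.finsum_cong') (use eu c assms(4) True in auto)
    also have "\<dots> = d \<otimes>\<^bsub>D i'\<^esub> ent x i' l l'"
      by (rule Di.finsum_singleton) (use assms c True in auto)
    finally show ?thesis using True by simp
  next
    case False
    have "(\<Oplus>\<^bsub>D i'\<^esub>m\<in>{..<n i'}. ent (unit i j l d) i' j' m \<otimes>\<^bsub>D i'\<^esub> ent x i' m l')
        = (\<Oplus>\<^bsub>D i'\<^esub>m\<in>{..<n i'}. \<zero>\<^bsub>D i'\<^esub>)"
      by (rule Di.finsum_cong') (use eu c False in auto)
    then show ?thesis using False by auto
  qed
  finally show ?thesis .
qed

lemma ent_mult_unit:
  assumes "i < k" "j < n i" "l < n i" "d \<in> carrier (D i)" "x \<in> carrier R" "i' < k" "j' < n i'" "l' < n i'"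
  shows "ent (x \<otimes> unit i j l d) i' j' l' = (if i' = i \<and> l' = l then ent x i j' j \<otimes>\<^bsub>D i\<^esub> d else \<zero>\<^bsub>D i'\<^esub>)"
proof -
  interpret Di: ring "D i'" using ring_D assms(6) .
  interpret Di0: ring "D i" using ring_D assms(1) .
  note uc = unit_closed[OF assms(1-4)] and eu = ent_unit[OF assms(1-4) assms(6) _ assms(8)]
  have c: "ent x i' j' m \<in> carrier (D i')" if "m < n i'" for m using coord_closed assms that by blast
  have "ent (x \<otimes> unit i j l d) i' j' l' = (\<Oplus>\<^bsub>D i'\<^esub>m\<in>{..<n i'}. ent x i' j' m \<otimes>\<^bsub>D i'\<^esub> ent (unit i j l d) i' m l')"
    using coord_mult[OF assms(5) uc assms(6-8)] .
  also have "\<dots> = (if i' = i \<and> l' = l then ent x i j' j \<otimes>\<^bsub>D i\<^esub> d else \<zero>\<^bsub>D i'\<^esub>)"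
  proof (cases "i' = i \<and> l' = l")
    case True
    have "(\<Oplus>\<^bsub>D i'\<^esub>m\<in>{..<n i'}. ent x i' j' m \<otimes>\<^bsub>D i'\<^esub> ent (unit i j l d) i' m l')
        = (\<Oplus>\<^bsub>D i'\<^esub>m\<in>{..<n i'}. if j = m then ent x i' j' m \<otimes>\<^bsub>D i'\<^esub> d else \<zero>\<^bsub>D i'\<^esub>)"
      by (rule Di.finsum_cong') (use eu c assms(4) True in auto)
    also have "\<dots> = ent x i' j' j \<otimes>\<^bsub>D i'\<^esub> d"
      by (rule Di.finsum_singleton) (use assms c True in auto)
    finally show ?thesis using True by simp
  next
    case False
    have "(\<Oplus>\<^bsub>D i'\<^esub>m\<in>{..<n i'}. ent x i' j' m \<otimes>\<^bsub>D i'\<^esub> ent (unit i j l d) i' m l')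
        = (\<Oplus>\<^bsub>D i'\<^esub>m\<in>{..<n i'}. \<zero>\<^bsub>D i'\<^esub>)"
      by (rule Di.finsum_cong') (use eu c False in auto)
    then show ?thesis using False by auto
  qed
  finally show ?thesis .
qed

lemma unit_mult_unit:
  assumes "i < k" "j < n i" "l < n i" "l' < n i" "m < n i" "d \<in> carrier (D i)" "d' \<in> carrier (D i)"
  shows "unit i j l d \<otimes> unit i l' m d' = (if l = l' then unit i j m (d \<otimes>\<^bsub>D i\<^esub> d') else \<zero>)"
proof -
  interpret Di: ring "D i" using ring_D assms(1) .
  have dd: "d \<otimes>\<^bsub>D i\<^esub> d' \<in> carrier (D i)" using assms by simp
  show ?thesis
    by (rule coord_inj)
       (use assms dd unit_closed ent_unit ent_unit_mult ent_zero in auto)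
qed

text \<open>Position 0 exists in every block because sizes are positive. \<open>col i j\<close> and
  \<open>row i j\<close> are the units E_j0 and E_0j; their common member E_00 becomes the
  idempotent \<open>e i\<close> of a frame.\<close>

abbreviation col :: "nat \<Rightarrow> nat \<Rightarrow> 'a" where "col i j \<equiv> unit i j 0 \<one>\<^bsub>D i\<^esub>"

abbreviation row :: "nat \<Rightarrow> nat \<Rightarrow> 'a" where "row i j \<equiv> unit i 0 j \<one>\<^bsub>D i\<^esub>"

lemma D_one_closed: "i < k \<Longrightarrow> \<one>\<^bsub>D i\<^esub> \<in> carrier (D i)"
  using ring_D ring.ring_simprules(6) by blast

lemma D_one_mult:
  "\<lbrakk>i < k; x \<in> carrier (D i)\<rbrakk> \<Longrightarrow> \<one>\<^bsub>D i\<^esub> \<otimes>\<^bsub>D i\<^esub> x = x"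
  "\<lbrakk>i < k; x \<in> carrier (D i)\<rbrakk> \<Longrightarrow> x \<otimes>\<^bsub>D i\<^esub> \<one>\<^bsub>D i\<^esub> = x"
  using ring_D[of i] by (auto simp: ring_def monoid.l_one monoid.r_one)

lemmas unit_one_closed = unit_closed[OF _ _ _ D_one_closed]

lemma matrix_frame:
  "matrix_frame R k n (\<lambda>i. col i 0) (\<lambda>i j. col i j) (\<lambda>i j. row i j)"
proof (intro matrix_frame.intro matrix_frame_axioms.intro ring_axioms size_pos)
  fix i assume i: "i < k"
  note s = size_pos[OF i]
  show "col i 0 \<in> carrier R" using unit_one_closed i s by blast
  fix j assume j: "j < n i"
  show "col i j \<in> carrier R" "row i j \<in> carrier R" using unit_one_closed i s j by blast+
  note um = unit_mult_unit[OF i _ _ _ _ D_one_closed[OF i] D_one_closed[OF i],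
      unfolded D_one_mult(1)[OF i D_one_closed[OF i]]]
  show "col i j \<otimes> col i 0 = col i j" "col i 0 \<otimes> row i j = row i j" by (simp_all add: um s j)
  fix l assume l: "l < n i"
  show "row i j \<otimes> col i l = (if j = l then col i 0 else \<zero>)" using l by (simp add: um s j)
next
  fix i i' x assume *: "i < k" "i' < k" "i \<noteq> i'" "x \<in> carrier R"
  note s = size_pos[OF *(1)] size_pos[OF *(2)]
  have ui: "col i 0 \<in> carrier R" "col i' 0 \<in> carrier R" using unit_one_closed * s by auto
  interpret D': ring "D i'" using ring_D *(2) .
  show "col i 0 \<otimes> x \<otimes> col i' 0 = \<zero>"
  proof (rule coord_inj)
    fix a b c assume abc: "a < k" "b < n a" "c < n a"
    have ux: "col i 0 \<otimes> x \<in> carrier R" using ui * by simp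
    show "ent (col i 0 \<otimes> x \<otimes> col i' 0) a b c = ent \<zero> a b c"
      unfolding ent_mult_unit[OF *(2) s(2) s(2) D_one_closed[OF *(2)] ux abc] ent_zero[OF abc]
      using ent_unit_mult[OF *(1) s(1) s(1) D_one_closed[OF *(1)] *(4) *(2) _ s(2), of b] * abc by auto
  qed (use ui * in auto)
next
  fix x assume x: "x \<in> carrier R"
  show "x = \<zero>" if h: "\<And>i j. i < k \<Longrightarrow> j < n i \<Longrightarrow> row i j \<otimes> x = \<zero>"
  proof (rule coord_inj)
    fix i j l assume *: "i < k" "j < n i" "l < n i"
    have "ent x i j l = ent (row i j \<otimes> x) i 0 l"
      using ent_unit_mult[OF *(1) size_pos[OF *(1)] *(2) D_one_closed[OF *(1)] x *(1) size_pos[OF *(1)] *(3)]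
        D_one_mult[OF *(1) coord_closed[OF x *]] by simp
    then show "ent x i j l = ent \<zero> i j l" using h[OF *(1,2)] ent_zero * size_pos by simp
  qed (use x in auto)
  show "x = \<zero>" if h: "\<And>i j. i < k \<Longrightarrow> j < n i \<Longrightarrow> x \<otimes> col i j = \<zero>"
  proof (rule coord_inj)
    fix i j l assume *: "i < k" "j < n i" "l < n i"
    have "ent x i j l = ent (x \<otimes> col i l) i j 0"
      using ent_mult_unit[OF *(1,3) size_pos[OF *(1)] D_one_closed[OF *(1)] x *(1,2) size_pos[OF *(1)]]
        D_one_mult[OF *(1) coord_closed[OF x *]] by simp
    then show "ent x i j l = ent \<zero> i j l" using h[OF *(1,3)] ent_zero * size_pos by simp
  qed (use x in auto)
qed

lemma iso_corner:
  assumes i: "i < k"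
  shows "D i \<simeq> corner R (col i 0)"
proof -
  interpret Di: ring "D i" using ring_D i .
  note s = size_pos[OF i]
  define e where "e = col i 0"
  have uc: "unit i 0 0 d \<in> carrier R" if "d \<in> carrier (D i)" for d using unit_closed[OF i s s that] .
  have um: "unit i 0 0 d \<otimes> unit i 0 0 d' = unit i 0 0 (d \<otimes>\<^bsub>D i\<^esub> d')"
    if "d \<in> carrier (D i)" "d' \<in> carrier (D i)" for d d'
    using unit_mult_unit[OF i s s s s that] by simp
  have ue: "ent (unit i 0 0 d) i 0 0 = d" if "d \<in> carrier (D i)" for d
    using ent_unit[OF i s s that i s s] by simp
  have "(\<lambda>d. unit i 0 0 d) \<in> ring_iso (D i) (corner R e)"
  proof (rule ring_iso_memI)
    show cl: "unit i 0 0 d \<in> carrier (corner R e)" if "d \<in> carrier (D i)" for d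
      using uc um that by (simp add: e_def)
    show "unit i 0 0 (d \<otimes>\<^bsub>D i\<^esub> d') = unit i 0 0 d \<otimes>\<^bsub>corner R e\<^esub> unit i 0 0 d'"
      if "d \<in> carrier (D i)" "d' \<in> carrier (D i)" for d d'
      using um that by simp
    show "unit i 0 0 (d \<oplus>\<^bsub>D i\<^esub> d') = unit i 0 0 d \<oplus>\<^bsub>corner R e\<^esub> unit i 0 0 d'"
      if d: "d \<in> carrier (D i)" "d' \<in> carrier (D i)" for d d'
    proof -
      have dd: "d \<oplus>\<^bsub>D i\<^esub> d' \<in> carrier (D i)" using d by simp
      have "unit i 0 0 (d \<oplus>\<^bsub>D i\<^esub> d') = unit i 0 0 d \<oplus> unit i 0 0 d'"
      proof (rule coord_inj)
        fix a b c assume abc: "a < k" "b < n a" "c < n a"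
        interpret Da: ring "D a" using ring_D abc(1) .
        show "ent (unit i 0 0 (d \<oplus>\<^bsub>D i\<^esub> d')) a b c = ent (unit i 0 0 d \<oplus> unit i 0 0 d') a b c"
          unfolding coord_add[OF uc[OF d(1)] uc[OF d(2)] abc] ent_unit[OF i s s dd abc]
            ent_unit[OF i s s d(1) abc] ent_unit[OF i s s d(2) abc] by simp
      qed (use uc d dd in auto)
      then show ?thesis by simp
    qed
    show "col i 0 = \<one>\<^bsub>corner R e\<^esub>" by (simp add: e_def)
    show "bij_betw (\<lambda>d. unit i 0 0 d) (carrier (D i)) (carrier (corner R e))"
    proof (rule bij_betw_imageI)
      show "inj_on (\<lambda>d. unit i 0 0 d) (carrier (D i))" using ue by (metis inj_onI)
      show "(\<lambda>d. unit i 0 0 d) ` carrier (D i) = carrier (corner R e)"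
      proof
        show "carrier (corner R e) \<subseteq> (\<lambda>d. unit i 0 0 d) ` carrier (D i)"
        proof
          fix x assume "x \<in> carrier (corner R e)"
          then have x: "x \<in> carrier R" "e \<otimes> x = x" "x \<otimes> e = x" by auto
          have dc: "ent x i 0 0 \<in> carrier (D i)" using coord_closed[OF x(1) i s s] .
          have "x = unit i 0 0 (ent x i 0 0)"
          proof (rule coord_inj)
            fix a b c assume abc: "a < k" "b < n a" "c < n a"
            \<comment> \<open>Being fixed by \<open>e\<close> on the left confines \<open>x\<close>
              to row 0 of block i; being fixed on the right confines it to column 0.\<close>
            have 1: "ent x a b c = (if a = i \<and> b = 0 then ent x i 0 c else \<zero>\<^bsub>D a\<^esub>)"
              using ent_unit_mult[OF i s s Di.one_closed x(1) abc] coord_closed[OF x(1) i s, of c] abc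
              unfolding e_def[symmetric] x(2) by auto
            have 2: "ent x a b c = (if a = i \<and> c = 0 then ent x i b 0 else \<zero>\<^bsub>D a\<^esub>)"
              using ent_mult_unit[OF i s s Di.one_closed x(1) abc] coord_closed[OF x(1) i _ s, of b] abc
              unfolding e_def[symmetric] x(3) by auto
            show "ent x a b c = ent (unit i 0 0 (ent x i 0 0)) a b c"
              unfolding ent_unit[OF i s s dc abc] using 1 2 by auto
          qed (use x uc dc in auto)
          then show "x \<in> (\<lambda>d. unit i 0 0 d) ` carrier (D i)" using dc by blast
        qed
      qed (use cl in blast)
    qed
  qed
  then show ?thesis unfolding is_ring_iso_def e_def by blast
qed

end

text \<open>Blocks are isomorphism classes of idempotents in \<open>E\<close>, and rows and columns
  are the isomorphisms with a chosen representative. Different classes are separated because a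
  nonzero map between the representatives would make them isomorphic.\<close>

lemma (in ring) decomposition_imp_matrix_frame:
  assumes E: "virtually_simple_decomposition E" and "\<one> \<noteq> \<zero>"
  obtains k n e u v where "matrix_frame R k n e u v" "0 < k" "\<And>i. i < k \<Longrightarrow> virtually_simple_idem (e i)"
proof -
  note ED = virtually_simple_decompositionD[OF E]
  have Ec: "b \<in> carrier R" "b \<otimes> b = b" if "b \<in> E" for b
    using virtually_simple_idemD[OF ED(2)[OF that]] by auto
  \<comment> \<open>The predicate under \<open>SOME\<close> depends only on the isomorphism class of
    \<open>a\<close>, hence so does \<open>rep a\<close>.\<close>
  define rep where "rep a = (SOME c. c \<in> E \<and> iso_idem a c)" for a
  have rep: "rep a \<in> E" "iso_idem a (rep a)" if "a \<in> E" for a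
    using someI[of "\<lambda>c. c \<in> E \<and> iso_idem a c" a] that Ec iso_idem_refl unfolding rep_def by auto
  have rep_eq: "rep a = rep c" if "iso_idem a c" for a c
  proof -
    have "iso_idem a x \<longleftrightarrow> iso_idem c x" for x using that iso_idem_sym iso_idem_trans by blast
    then show ?thesis by (simp add: rep_def)
  qed
  define k where "k = card (rep ` E)"
  obtain e where e: "bij_betw e {0..<k} (rep ` E)"
    using ex_bij_betw_nat_finite[OF finite_imageI[OF ED(1)]] unfolding k_def by blast
  have eE: "e i \<in> E" and rep_e: "rep (e i) = e i" if "i < k" for i
  proof -
    have "e i \<in> rep ` E" using bij_betwE[OF e] \<open>i < k\<close> by simp
    then obtain a where a: "a \<in> E" "e i = rep a" by blast
    then show "e i \<in> E" "rep (e i) = e i" using rep[OF a(1)] rep_eq[of a "rep a"] by simp_all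
  qed
  define C where "C i = {a \<in> E. rep a = e i}" for i
  have finC: "finite (C i)" for i using ED(1) by (simp add: C_def)
  define n where "n i = card (C i)" for i
  have "\<exists>b. bij_betw b {0..<n i} (C i)" for i
    using ex_bij_betw_nat_finite[OF finC] unfolding n_def .
  then obtain b where b: "\<And>i. bij_betw (b i) {0..<n i} (C i)" by metis
  have bE: "b i j \<in> E" "rep (b i j) = e i" if "j < n i" for i j
    using bij_betwE[OF b[of i]] that by (auto simp: C_def)
  have np: "0 < n i" if "i < k" for i
    using eE[OF that] rep_e[OF that] finC[of i] by (auto simp: n_def card_gt_0_iff C_def)
  have binj: "j = l" if "j < n i" "l < n i" "b i j = b i l" for i j l
    using b[of i] that by (auto simp: bij_betw_def inj_on_def)
  have "\<exists>p q. p \<in> carrier R \<and> q \<in> carrier R \<and> b i j \<otimes> p = p \<and> p \<otimes> e i = p \<and> e i \<otimes> q = q \<and> q \<otimes> b i j = q \<and>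
      p \<otimes> q = b i j \<and> q \<otimes> p = e i" if "i < k" "j < n i" for i j
    using rep(2)[OF bE(1)[OF that(2)]] unfolding bE(2)[OF that(2)] iso_idem_def by blast
  then obtain u v where uv: "\<And>i j. i < k \<Longrightarrow> j < n i \<Longrightarrow> u i j \<in> carrier R \<and> v i j \<in> carrier R \<and>
      b i j \<otimes> u i j = u i j \<and> u i j \<otimes> e i = u i j \<and> e i \<otimes> v i j = v i j \<and> v i j \<otimes> b i j = v i j \<and>
      u i j \<otimes> v i j = b i j \<and> v i j \<otimes> u i j = e i" by metis
  have cover: "\<exists>i j. i < k \<and> j < n i \<and> f = b i j" if f: "f \<in> E" for f
  proof -
    have "rep f \<in> e ` {0..<k}" using f e by (simp add: bij_betw_def)
    then obtain i where i: "i < k" "rep f = e i" by auto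
    then have "f \<in> b i ` {0..<n i}" using b[of i] f by (simp add: bij_betw_def C_def)
    then obtain j where "j < n i" "f = b i j" by auto
    then show ?thesis using i(1) by blast
  qed
  have idE: "(\<lambda>e. e) \<in> E \<rightarrow> carrier R" using ED(3) by auto
  have "matrix_frame R k n e u v"
  proof (intro matrix_frame.intro matrix_frame_axioms.intro ring_axioms np)
    fix i assume i: "i < k"
    show "e i \<in> carrier R" using eE[OF i] Ec by blast
    fix j assume j: "j < n i"
    show "u i j \<in> carrier R" "v i j \<in> carrier R" "u i j \<otimes> e i = u i j" "e i \<otimes> v i j = v i j"
      using uv[OF i j] by auto
    fix l assume l: "l < n i"
    show "v i j \<otimes> u i l = (if j = l then e i else \<zero>)"
    proof (cases "j = l")
      case True then show ?thesis using uv[OF i j] by simp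
    next
      case False
      then have bb: "b i j \<otimes> b i l = \<zero>" using ED(4)[OF bE(1)[OF j] bE(1)[OF l]] binj[OF j l] by auto
      have c: "b i j \<in> carrier R" "b i l \<in> carrier R" using bE(1) j l Ec by auto
      have uc: "v i j \<in> carrier R" "u i l \<in> carrier R" using uv[OF i j] uv[OF i l] by auto
      have "v i j \<otimes> u i l = (v i j \<otimes> b i j) \<otimes> (b i l \<otimes> u i l)" using uv[OF i j] uv[OF i l] by simp
      also have "\<dots> = v i j \<otimes> (b i j \<otimes> b i l) \<otimes> u i l" using c uc by (simp only: m_assoc m_closed)
      also have "\<dots> = \<zero>" unfolding bb using uv[OF i j] uv[OF i l] by simp
      finally show ?thesis using False by simp
    qed
  next
    fix i i' x assume *: "i < k" "i' < k" "i \<noteq> i'" "x \<in> carrier R"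
    show "e i \<otimes> x \<otimes> e i' = \<zero>"
    proof (rule ccontr)
      assume nz: "e i \<otimes> x \<otimes> e i' \<noteq> \<zero>"
      note ei = Ec[OF eE[OF *(1)]] and ei' = Ec[OF eE[OF *(2)]]
      have "e i \<otimes> (e i \<otimes> x \<otimes> e i') = e i \<otimes> x \<otimes> e i'" using ei ei' *(4) by (simp flip: m_assoc)
      moreover have "e i \<otimes> x \<otimes> e i' \<otimes> e i' = e i \<otimes> x \<otimes> e i'" using ei ei' *(4) by (simp add: m_assoc)
      ultimately have "iso_idem (e i) (e i')"
        using virtually_simple_idem_hom(1)[OF ED(2)[OF eE[OF *(1)]] ED(2)[OF eE[OF *(2)]] _ _ _ nz]
          ei ei' *(4) by simp
      then have "e i = e i'" using rep_eq rep_e *(1,2) by metis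
      then show False using e *(1-3) by (auto simp: bij_betw_def inj_on_def)
    qed
  next
    fix x assume x: "x \<in> carrier R"
    show "x = \<zero>" if h: "\<And>i j. i < k \<Longrightarrow> j < n i \<Longrightarrow> v i j \<otimes> x = \<zero>"
    proof (rule sum_left_zeroI[OF ED(5) ED(1) idE x])
      fix f assume "f \<in> E"
      then obtain i j where ij: "i < k" "j < n i" "f = b i j" using cover by blast
      then have "f \<otimes> x = u i j \<otimes> (v i j \<otimes> x)" using uv[OF ij(1,2)] x by (metis m_assoc)
      then show "f \<otimes> x = \<zero>" using h[OF ij(1,2)] uv[OF ij(1,2)] by simp
    qed
    show "x = \<zero>" if h: "\<And>i j. i < k \<Longrightarrow> j < n i \<Longrightarrow> x \<otimes> u i j = \<zero>"
    proof (rule sum_right_zeroI[OF ED(5) ED(1) idE x])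
      fix f assume "f \<in> E"
      then obtain i j where ij: "i < k" "j < n i" "f = b i j" using cover by blast
      then have "x \<otimes> f = x \<otimes> u i j \<otimes> v i j" using uv[OF ij(1,2)] x by (metis m_assoc)
      then show "x \<otimes> f = \<zero>" using h[OF ij(1,2)] uv[OF ij(1,2)] by simp
    qed
  qed
  moreover have "0 < k"
  proof -
    have "E \<noteq> {}" using ED(5) \<open>\<one> \<noteq> \<zero>\<close> by auto
    then show ?thesis using cover by fastforce
  qed
  ultimately show thesis using that ED(2) eE by blast
qed

section \<open>Transport of principal left ideal domains and of corners along isomorphisms\<close>

lemma principal_left_ideal_domain_iso:
  assumes "principal_left_ideal_domain S" "ring T" "S \<simeq> T"
  shows "principal_left_ideal_domain T"
proof -
  interpret S: principal_left_ideal_domain S by fact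
  interpret T: ring T by fact
  obtain h where h: "h \<in> ring_iso S T" using assms(3) unfolding is_ring_iso_def by blast
  note hE = ring_iso_memE[OF h]
  have surj: "\<exists>s\<in>carrier S. t = h s" if "t \<in> carrier T" for t
    using hE(5) that by (auto simp: bij_betw_def image_iff)
  have h0: "h \<zero>\<^bsub>S\<^esub> = \<zero>\<^bsub>T\<^esub>"
    using hE(3)[of "\<zero>\<^bsub>S\<^esub>" "\<zero>\<^bsub>S\<^esub>"] hE(1)[of "\<zero>\<^bsub>S\<^esub>"] by (simp add: T.add.l_cancel_one)
  have inj0: "s = \<zero>\<^bsub>S\<^esub>" if "s \<in> carrier S" "h s = \<zero>\<^bsub>T\<^esub>" for s
    using hE(5) that h0 S.zero_closed unfolding bij_betw_def inj_on_def by metis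
  show ?thesis
  proof (intro principal_left_ideal_domain.intro principal_left_ideal_domain_axioms.intro T.ring_axioms)
    show "\<one>\<^bsub>T\<^esub> \<noteq> \<zero>\<^bsub>T\<^esub>" using hE(4) inj0[OF S.one_closed] S.one_not_zero by auto
  next
    fix a b assume *: "a \<otimes>\<^bsub>T\<^esub> b = \<zero>\<^bsub>T\<^esub>" "a \<in> carrier T" "b \<in> carrier T"
    then obtain s t where "s \<in> carrier S" "a = h s" "t \<in> carrier S" "b = h t" using surj by metis
    then show "a = \<zero>\<^bsub>T\<^esub> \<or> b = \<zero>\<^bsub>T\<^esub>"
      using *(1) inj0[of "s \<otimes>\<^bsub>S\<^esub> t"] S.integral[of s t] hE(2)[of s t] h0 by auto
  next
    fix J assume "left_ideal J T"
    note J = T.left_idealD[OF this]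
    have "left_ideal {s \<in> carrier S. h s \<in> J} S"
      by (rule S.left_idealI) (use J(2-4) h0 hE(1-3) in auto)
    then obtain a where a: "a \<in> carrier S"
      "{s \<in> carrier S. h s \<in> J} = {x \<otimes>\<^bsub>S\<^esub> a | x. x \<in> carrier S}" using S.principal by blast
    have "J = {x \<otimes>\<^bsub>T\<^esub> h a | x. x \<in> carrier T}"
    proof (intro Set.set_eqI iffI)
      fix y assume y: "y \<in> J"
      then obtain s where s: "s \<in> carrier S" "y = h s" using J(1) surj by blast
      then have "s \<in> {x \<otimes>\<^bsub>S\<^esub> a | x. x \<in> carrier S}" using y a(2) by blast
      then show "y \<in> {x \<otimes>\<^bsub>T\<^esub> h a | x. x \<in> carrier T}" using s(2) hE(1,2) a(1) by auto
    next
      fix y assume "y \<in> {x \<otimes>\<^bsub>T\<^esub> h a | x. x \<in> carrier T}"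
      then obtain s where s: "s \<in> carrier S" "y = h s \<otimes>\<^bsub>T\<^esub> h a" using surj by blast
      then have "s \<otimes>\<^bsub>S\<^esub> a \<in> {s \<in> carrier S. h s \<in> J}" unfolding a(2) by blast
      then show "y \<in> J" using s hE(2) a(1) by simp
    qed
    then show "\<exists>a\<in>carrier T. J = {x \<otimes>\<^bsub>T\<^esub> a | x. x \<in> carrier T}" using a(1) hE(1) by blast
  qed
qed

text \<open>The map x \<mapsto> vxu with inverse y \<mapsto> uyv; it is multiplicative since the
  inner factor uv = e is absorbed by elements of the corner.\<close>

lemma (in ring) corner_iso:
  assumes "iso_idem e f" shows "corner R e \<simeq> corner R f"
proof -
  obtain u v where u: "u \<in> carrier R" "v \<in> carrier R" "e \<otimes> u = u" "u \<otimes> f = u" "f \<otimes> v = v" "v \<otimes> e = v"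
    "u \<otimes> v = e" "v \<otimes> u = f" using assms unfolding iso_idem_def by blast
  have ec: "e \<in> carrier R" "f \<in> carrier R" using u by auto
  have cl: "p \<otimes> x \<otimes> q \<in> carrier (corner R g)"
    if "p \<in> carrier R" "g \<otimes> p = p" "q \<in> carrier R" "q \<otimes> g = q" "x \<in> carrier R" "g \<in> carrier R" for p g q x
  proof -
    have "g \<otimes> (p \<otimes> x \<otimes> q) = (g \<otimes> p) \<otimes> x \<otimes> q" "p \<otimes> x \<otimes> q \<otimes> g = p \<otimes> x \<otimes> (q \<otimes> g)"
      using that(1,3,5,6) by (simp_all only: m_assoc m_closed)
    then show ?thesis using that by simp
  qed
  have "(\<lambda>x. v \<otimes> x \<otimes> u) \<in> ring_iso (corner R e) (corner R f)"
  proof (rule ring_iso_memI)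
    show "v \<otimes> x \<otimes> u \<in> carrier (corner R f)" if "x \<in> carrier (corner R e)" for x
      using cl[of v f u x] that u ec by simp
    show "v \<otimes> (x \<otimes>\<^bsub>corner R e\<^esub> y) \<otimes> u = (v \<otimes> x \<otimes> u) \<otimes>\<^bsub>corner R f\<^esub> (v \<otimes> y \<otimes> u)"
      if "x \<in> carrier (corner R e)" "y \<in> carrier (corner R e)" for x y
    proof -
      have x: "x \<in> carrier R" "x \<otimes> e = x" "y \<in> carrier R" using that by auto
      have "(v \<otimes> x \<otimes> u) \<otimes> (v \<otimes> y \<otimes> u) = v \<otimes> (x \<otimes> (u \<otimes> v)) \<otimes> y \<otimes> u"
        using u(1,2) x(1,3) by (simp only: m_assoc m_closed)
      then show ?thesis using u x by (simp add: m_assoc)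
    qed
    show "v \<otimes> (x \<oplus>\<^bsub>corner R e\<^esub> y) \<otimes> u = (v \<otimes> x \<otimes> u) \<oplus>\<^bsub>corner R f\<^esub> (v \<otimes> y \<otimes> u)"
      if "x \<in> carrier (corner R e)" "y \<in> carrier (corner R e)" for x y
      using that u by (simp add: l_distr r_distr)
    show "v \<otimes> \<one>\<^bsub>corner R e\<^esub> \<otimes> u = \<one>\<^bsub>corner R f\<^esub>" using u by simp
    show "bij_betw (\<lambda>x. v \<otimes> x \<otimes> u) (carrier (corner R e)) (carrier (corner R f))"
    proof (rule bij_betw_byWitness[where f' = "\<lambda>y. u \<otimes> y \<otimes> v"])
      have "u \<otimes> (v \<otimes> x \<otimes> u) \<otimes> v = (u \<otimes> v) \<otimes> x \<otimes> (u \<otimes> v)" if "x \<in> carrier R" for x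
        using u(1,2) that by (simp only: m_assoc m_closed)
      then show "\<forall>x\<in>carrier (corner R e). u \<otimes> (v \<otimes> x \<otimes> u) \<otimes> v = x" using u by simp
      have "v \<otimes> (u \<otimes> x \<otimes> v) \<otimes> u = (v \<otimes> u) \<otimes> x \<otimes> (v \<otimes> u)" if "x \<in> carrier R" for x
        using u(1,2) that by (simp only: m_assoc m_closed)
      then show "\<forall>y\<in>carrier (corner R f). v \<otimes> (u \<otimes> y \<otimes> v) \<otimes> u = y" using u by simp
      show "(\<lambda>x. v \<otimes> x \<otimes> u) ` carrier (corner R e) \<subseteq> carrier (corner R f)"
        using cl[of v f u] u ec by auto
      show "(\<lambda>y. u \<otimes> y \<otimes> v) ` carrier (corner R f) \<subseteq> carrier (corner R e)"
        using cl[of u e v] u ec by auto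
    qed
  qed
  then show ?thesis unfolding is_ring_iso_def by blast
qed

section \<open>Uniqueness of the decomposition\<close>

context ring
begin

text \<open>Writing the rows \<open>v i a\<close> of one frame in the columns \<open>w j b\<close> of the other gives \<open>n i\<close> independent
  vectors of length \<open>m j\<close> over \<open>e\<^sub>i R e\<^sub>i\<close>.\<close>

lemma matrix_frame_size_le:
  assumes F: "matrix_frame R k n e u v" and G: "matrix_frame R l m f w z"
    and vs: "virtually_simple_idem (e i)" and i: "i < k" and j: "j < l" and iso: "iso_idem (e i) (f j)"
  shows "n i \<le> m j"
proof (rule ccontr)
  interpret F: matrix_frame R k n e u v by fact
  interpret G: matrix_frame R l m f w z by fact
  assume "\<not> n i \<le> m j"
  then have lt: "m j < card {..<n i}" by simp
  note eD = virtually_simple_idemD[OF vs]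
  interpret C: principal_left_ideal_domain "corner R (e i)"
    using corner_principal_left_ideal_domain[OF vs] .
  obtain s t where st: "s \<in> carrier R" "t \<in> carrier R" "e i \<otimes> s = s" "s \<otimes> f j = s" "f j \<otimes> t = t" "t \<otimes> e i = t"
    "s \<otimes> t = e i" "t \<otimes> s = f j" using iso unfolding iso_idem_def by blast
  have fc: "f b \<in> carrier R" if "b < l" for b using G.e_closed that .
  have vc: "v i a \<in> carrier R" "e i \<otimes> v i a = v i a" if "a < n i" for a
    using F.v_closed F.e_v i that by auto
  have wc: "w b c \<in> carrier R" "w b c \<otimes> f b = w b c" if "b < l" "c < m b" for b c
    using G.u_closed G.u_e that by auto
  \<comment> \<open>\<open>w j b\<close> ends in \<open>f j\<close>; the factor \<open>t\<close>
    from \<open>f j\<close> to \<open>e i\<close> moves the products into the corner at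
    \<open>e i\<close>, where they form a matrix with \<open>n i\<close> rows and \<open>m j\<close>
    columns.\<close>
  define A where "A a b = v i a \<otimes> (w j b \<otimes> t)" for a b
  have Ac: "A a b \<in> carrier (corner R (e i))" if "a < n i" "b < m j" for a b
  proof -
    note c = vc[OF that(1)] wc(1)[OF j that(2)]
    have "e i \<otimes> A a b = (e i \<otimes> v i a) \<otimes> (w j b \<otimes> t)"
      unfolding A_def using c(1,3) eD(1) st(2) by (simp only: m_assoc m_closed)
    then have 1: "e i \<otimes> A a b = A a b" unfolding c(2) A_def .
    have "A a b \<otimes> e i = v i a \<otimes> (w j b \<otimes> (t \<otimes> e i))"
      unfolding A_def using c(1,3) eD(1) st(2) by (simp only: m_assoc m_closed)
    then have 2: "A a b \<otimes> e i = A a b" unfolding st(6) A_def .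
    have "A a b \<in> carrier R" unfolding A_def using c st by simp
    then show ?thesis using 1 2 by simp
  qed
  obtain x where x: "x \<in> {..<n i} \<rightarrow> carrier (corner R (e i))" "\<exists>a\<in>{..<n i}. x a \<noteq> \<zero>\<^bsub>corner R (e i)\<^esub>"
    "\<forall>b<m j. (\<Oplus>\<^bsub>corner R (e i)\<^esub>a\<in>{..<n i}. x a \<otimes>\<^bsub>corner R (e i)\<^esub> A a b) = \<zero>\<^bsub>corner R (e i)\<^esub>"
    using C.linear_dependence[of "{..<n i}" "m j" A] lt Ac by auto
  have xc: "x a \<in> carrier R" "e i \<otimes> x a = x a" "x a \<otimes> e i = x a" if "a < n i" for a
    using x(1) that by auto
  have xv: "(\<lambda>a. x a \<otimes> v i a) \<in> {..<n i} \<rightarrow> carrier R" using xc vc by auto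
  \<comment> \<open>The relation between the rows of \<open>A\<close>, read as a combination of the
    \<open>v i a\<close>. It vanishes by faithfulness of the second frame, while the columns
    \<open>u i a\<close> of the first recover its coefficients.\<close>
  define y where "y = (\<Oplus>a\<in>{..<n i}. x a \<otimes> v i a)"
  have yc: "y \<in> carrier R" unfolding y_def by (rule finsum_closed[OF xv])
  have ymult: "y \<otimes> q = (\<Oplus>a\<in>{..<n i}. x a \<otimes> (v i a \<otimes> q))" if "q \<in> carrier R" for q
  proof -
    have "y \<otimes> q = (\<Oplus>a\<in>{..<n i}. x a \<otimes> v i a \<otimes> q)"
      unfolding y_def by (rule finsum_ldistr) (use xv that in auto)
    also have "\<dots> = (\<Oplus>a\<in>{..<n i}. x a \<otimes> (v i a \<otimes> q))"
      by (rule finsum_cong') (use xc vc that in \<open>auto simp: m_assoc\<close>)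
    finally show ?thesis .
  qed
  have "e i \<otimes> y = (\<Oplus>a\<in>{..<n i}. e i \<otimes> (x a \<otimes> v i a))"
    unfolding y_def by (rule finsum_rdistr) (use xv eD in auto)
  also have "\<dots> = y" unfolding y_def
    by (rule finsum_cong') (use xc vc eD in \<open>auto simp flip: m_assoc\<close>)
  finally have ey: "e i \<otimes> y = y" .
  have "y = \<zero>"
  proof (rule G.faithful_right[OF yc])
    fix b c assume bc: "b < l" "c < m b"
    note wbc = wc[OF bc]
    show "y \<otimes> w b c = \<zero>"
    proof (cases "b = j")
      case False
      \<comment> \<open>Since \<open>e i\<close> = st passes through \<open>f j\<close>, the product
        with a column of another block contains a factor killed by \<open>separate\<close>.\<close>
      have "y \<otimes> w b c = (s \<otimes> (f j \<otimes> t)) \<otimes> y \<otimes> (w b c \<otimes> f b)" using ey st(5,7) wbc(2) by simp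
      also have "\<dots> = s \<otimes> (f j \<otimes> (t \<otimes> y \<otimes> w b c) \<otimes> f b)"
        using st(1,2) fc[OF j] fc[OF bc(1)] yc wbc(1) by (simp only: m_assoc m_closed)
      also have "\<dots> = \<zero>" using G.separate[OF j bc(1), of "t \<otimes> y \<otimes> w b c"] False st yc wbc by simp
      finally show ?thesis .
    next
      case True
      have wt: "w b c \<otimes> t \<in> carrier R" using wbc st by simp
      have "y \<otimes> (w b c \<otimes> t) = (\<Oplus>a\<in>{..<n i}. x a \<otimes> A a c)"
        using ymult[OF wt] by (simp add: A_def True)
      also have "\<dots> = (\<Oplus>\<^bsub>corner R (e i)\<^esub>a\<in>{..<n i}. x a \<otimes> A a c)"
      proof (rule finsum_corner[symmetric])
        have "x a \<otimes>\<^bsub>corner R (e i)\<^esub> A a c \<in> carrier (corner R (e i))" if "a < n i" for a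
          using x(1) that bc True by (intro C.m_closed Ac) auto
        then show "(\<lambda>a. x a \<otimes> A a c) \<in> {..<n i} \<rightarrow> carrier (corner R (e i))"
          unfolding corner_simps(2) by blast
      qed (use eD in auto)
      also have "\<dots> = \<zero>" using x(3) bc True by simp
      finally have 0: "y \<otimes> (w b c \<otimes> t) = \<zero>" .
      have "y \<otimes> w b c = y \<otimes> (w b c \<otimes> t) \<otimes> s"
        using wbc st(1,2,8) yc True by (simp add: m_assoc)
      then show ?thesis using 0 st by simp
    qed
  qed
  obtain a where a: "a < n i" "x a \<noteq> \<zero>" using x(2) by auto
  have uc: "u i a \<in> carrier R" using F.u_closed i a by blast
  have "y \<otimes> u i a = (\<Oplus>c\<in>{..<n i}. if a = c then x c else \<zero>)"
    unfolding ymult[OF uc]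
    by (rule finsum_cong') (use F.v_u i a xc in auto)
  also have "\<dots> = x a" by (rule finsum_singleton) (use a xc in auto)
  finally show False using \<open>y = \<zero>\<close> uc a by simp
qed

text \<open>If \<open>e i\<close> were isomorphic to no \<open>f j\<close>, it would kill every
  column \<open>w j b\<close>, since a nonzero product is a nonzero map between virtually simple
  modules. By faithfulness \<open>e i\<close> would be 0.\<close>

lemma matrix_frames_match:
  assumes F: "matrix_frame R k n e u v" and G: "matrix_frame R l m f w z"
    and vs: "virtually_simple_idem (e i)" "\<And>j. j < l \<Longrightarrow> virtually_simple_idem (f j)" and i: "i < k"
  shows "\<exists>j<l. iso_idem (e i) (f j)"
proof (rule ccontr)
  interpret F: matrix_frame R k n e u v by fact
  interpret G: matrix_frame R l m f w z by fact
  note eD = virtually_simple_idemD[OF vs(1)]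
  assume no: "\<not> (\<exists>j<l. iso_idem (e i) (f j))"
  have "e i = \<zero>"
  proof (rule G.faithful_right[OF eD(1)])
    fix j b assume jb: "j < l" "b < m j"
    have w: "w j b \<in> carrier R" "w j b \<otimes> f j = w j b" "f j \<in> carrier R"
      using G.u_closed G.u_e G.e_closed jb by auto
    have "e i \<otimes> (e i \<otimes> w j b) = e i \<otimes> w j b" using eD w by (simp flip: m_assoc)
    moreover have "e i \<otimes> w j b \<otimes> f j = e i \<otimes> w j b" using eD w by (simp add: m_assoc)
    ultimately show "e i \<otimes> w j b = \<zero>"
      using virtually_simple_idem_hom(1)[OF vs(1) vs(2)[OF jb(1)]] no jb(1) eD(1) w(1) by blast
  qed
  then show False using eD by simp
qed

text \<open>An isomorphism between different blocks would be an element of the form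
  \<open>e i \<otimes> s \<otimes> e i'\<close>, which is 0.\<close>

lemma matrix_frame_iso_eq:
  assumes F: "matrix_frame R k n e u v" and vs: "virtually_simple_idem (e i)"
    and i: "i < k" "i' < k" and iso: "iso_idem (e i) (e i')"
  shows "i = i'"
proof (rule ccontr)
  interpret F: matrix_frame R k n e u v by fact
  assume "i \<noteq> i'"
  obtain s t where st: "s \<in> carrier R" "t \<in> carrier R" "e i \<otimes> s = s" "s \<otimes> e i' = s" "s \<otimes> t = e i"
    using iso unfolding iso_idem_def by blast
  have "s = e i \<otimes> s \<otimes> e i'" using st by simp
  then have "s = \<zero>" using F.separate[OF i \<open>i \<noteq> i'\<close> st(1)] by simp
  then show False using st virtually_simple_idemD(3)[OF vs] by simp
qed

text \<open>Here the given domains turn into corners of R, whatever type they live on; comparisons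
  can then be made inside R.\<close>

lemma matrix_frame_of_plid_decomposition:
  fixes D :: "nat \<Rightarrow> 'd ring"
  assumes "plid_matrix_decomposition R k n D"
  obtains e u v where "matrix_frame R k n e u v" "\<And>i. i < k \<Longrightarrow> virtually_simple_idem (e i)"
    "\<And>i. i < k \<Longrightarrow> D i \<simeq> corner R (e i)"
proof -
  have D: "\<And>i. i < k \<Longrightarrow> principal_left_ideal_domain (D i)" and np: "\<And>i. i < k \<Longrightarrow> 0 < n i"
    and iso: "R \<simeq> RDirProd_list (map (\<lambda>i. matrix_ring (n i) (D i)) [0..<k])"
    using assms unfolding plid_matrix_decomposition_def by auto
  have rD: "ring (D i)" if "i < k" for i using D[OF that] by (simp add: principal_left_ideal_domain_def)
  obtain ent where "matrix_coordinates R k n D ent"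
    using matrix_coordinates_of_iso[OF ring_axioms iso rD np] by blast
  then interpret X: matrix_coordinates R k n D ent .
  interpret F: matrix_frame R k n "\<lambda>i. X.col i 0" "\<lambda>i j. X.col i j" "\<lambda>i j. X.row i j"
    by (rule X.matrix_frame)
  have "virtually_simple_idem (X.col i 0)" if i: "i < k" for i
    by (intro F.virtually_simple_idem_of_corner[OF i] principal_left_ideal_domain_iso[OF D[OF i] _ X.iso_corner[OF i]]
        corner_ring F.e_closed[OF i] F.e_idem[OF i])
  then show thesis using that[OF F.matrix_frame_axioms] X.iso_corner by blast
qed

lemma plid_decomposition_imp_decomposition:
  fixes D :: "nat \<Rightarrow> 'd ring"
  assumes "plid_matrix_decomposition R k n D"
  shows "\<exists>E. virtually_simple_decomposition E"
proof -
  obtain e u v where *: "matrix_frame R k n e u v" "\<And>i. i < k \<Longrightarrow> virtually_simple_idem (e i)"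
    using matrix_frame_of_plid_decomposition[OF assms] by metis
  show ?thesis using matrix_frame.virtually_simple_decomposition[OF *] by blast
qed

lemma decomposition_imp_plid_decomposition:
  assumes "virtually_simple_decomposition E" "\<one> \<noteq> \<zero>"
  shows "\<exists>k n (D :: nat \<Rightarrow> 'a ring). plid_matrix_decomposition R k n D"
proof -
  obtain k n e u v where F: "matrix_frame R k n e u v" "0 < k" "\<And>i. i < k \<Longrightarrow> virtually_simple_idem (e i)"
    using decomposition_imp_matrix_frame[OF assms] by metis
  interpret F: matrix_frame R k n e u v by fact
  interpret X: matrix_coordinates R k n "\<lambda>i. corner R (e i)" "\<lambda>x i j l. v i j \<otimes> x \<otimes> u i l"
    by (rule F.matrix_coordinates_corner)
  have "plid_matrix_decomposition R k n (\<lambda>i. corner R (e i))"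
    unfolding plid_matrix_decomposition_def
    using F(2) F.size_pos corner_principal_left_ideal_domain F(3) X.iso_matrix_product by blast
  then show ?thesis by blast
qed

lemma plid_decomposition_unique:
  fixes D :: "nat \<Rightarrow> 'd ring" and E :: "nat \<Rightarrow> 'e ring"
  assumes D: "plid_matrix_decomposition R k n D" and E: "plid_matrix_decomposition R l m E"
  shows "k = l \<and> (\<exists>p. bij_betw p {..<k} {..<l} \<and> (\<forall>i<k. n i = m (p i) \<and> D i \<simeq> E (p i)))"
proof -
  obtain e u v where F: "matrix_frame R k n e u v" "\<And>i. i < k \<Longrightarrow> virtually_simple_idem (e i)"
    "\<And>i. i < k \<Longrightarrow> D i \<simeq> corner R (e i)"
    using matrix_frame_of_plid_decomposition[OF D] by metis
  obtain f w z where G: "matrix_frame R l m f w z" "\<And>j. j < l \<Longrightarrow> virtually_simple_idem (f j)"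
    "\<And>j. j < l \<Longrightarrow> E j \<simeq> corner R (f j)"
    using matrix_frame_of_plid_decomposition[OF E] by metis
  \<comment> \<open>\<open>p\<close> matches isomorphism classes. It is injective because distinct
    blocks belong to distinct classes, and surjective because the matching also works in the
    opposite direction.\<close>
  obtain p where p: "\<And>i. i < k \<Longrightarrow> p i < l" "\<And>i. i < k \<Longrightarrow> iso_idem (e i) (f (p i))"
    using matrix_frames_match[OF F(1) G(1) F(2) G(2)] by metis
  have bij: "bij_betw p {..<k} {..<l}"
  proof (rule bij_betw_imageI)
    show "inj_on p {..<k}"
    proof (rule inj_onI)
      fix i i' assume i: "i \<in> {..<k}" "i' \<in> {..<k}" "p i = p i'"
      then have "iso_idem (e i) (f (p i))" "iso_idem (f (p i)) (e i')"
        using p(2)[of i] iso_idem_sym[OF p(2)[of i']] by auto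
      then have "iso_idem (e i) (e i')" by (rule iso_idem_trans)
      then show "i = i'" using matrix_frame_iso_eq[OF F(1) F(2)] i by blast
    qed
    show "p ` {..<k} = {..<l}"
    proof
      show "{..<l} \<subseteq> p ` {..<k}"
      proof
        fix j assume j: "j \<in> {..<l}"
        then obtain i where i: "i < k" "iso_idem (f j) (e i)"
          using matrix_frames_match[OF G(1) F(1) G(2) F(2), of j] by auto
        have "iso_idem (f j) (f (p i))" using iso_idem_trans[OF i(2) p(2)[OF i(1)]] .
        then have "j = p i" using matrix_frame_iso_eq[OF G(1) G(2)] j p(1)[OF i(1)] by blast
        then show "j \<in> p ` {..<k}" using i(1) by blast
      qed
    qed (use p(1) in auto)
  qed
  moreover have "n i = m (p i) \<and> D i \<simeq> E (p i)" if i: "i < k" for i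
  proof -
    note pi = p(1)[OF i] p(2)[OF i]
    have "n i = m (p i)"
      using matrix_frame_size_le[OF F(1) G(1) F(2)[OF i] i pi]
        matrix_frame_size_le[OF G(1) F(1) G(2)[OF pi(1)] pi(1) i iso_idem_sym[OF pi(2)]] by simp
    moreover have "ring (E (p i))"
      using E pi(1) by (simp add: plid_matrix_decomposition_def principal_left_ideal_domain_def)
    then have "D i \<simeq> E (p i)"
      using ring_iso_trans[OF ring_iso_trans[OF F(3)[OF i] corner_iso[OF pi(2)]] ring_iso_sym[OF _ G(3)[OF pi(1)]]]
      by blast
    ultimately show ?thesis by blast
  qed
  moreover have "k = l" using bij_betw_same_card[OF bij] by simp
  ultimately show ?thesis by blast
qed

end

theorem theorem2p7:
  fixes R :: "('a, 'r) ring_scheme"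
  assumes "ring R" and "carrier R \<noteq> {\<zero>\<^bsub>R\<^esub>}"
  shows
    "(direct_sum_of_virtually_simples R (regular_module R) \<longleftrightarrow>
        left_completely_virtually_semisimple_ring R) \<and>
     (left_completely_virtually_semisimple_ring R \<longleftrightarrow>
        (\<exists>k n (D :: nat \<Rightarrow> 'a ring). plid_matrix_decomposition R k n D)) \<and>
     (\<forall>k n (D :: nat \<Rightarrow> 'd ring). plid_matrix_decomposition R k n D \<longrightarrow>
        left_completely_virtually_semisimple_ring R) \<and>
     (\<forall>k n (D :: nat \<Rightarrow> 'd ring) l m (E :: nat \<Rightarrow> 'e ring).
        plid_matrix_decomposition R k n D \<and> plid_matrix_decomposition R l m E \<longrightarrow>
        k = l \<and> (\<exists>p. bij_betw p {..<k} {..<l} \<and>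
          (\<forall>i < k. n i = m (p i) \<and> D i \<simeq> E (p i))))"
proof -
  interpret ring R by fact
  have ne: "\<one>\<^bsub>R\<^esub> \<noteq> \<zero>\<^bsub>R\<^esub>" using assms(2) one_zeroD by blast
  have "direct_sum_of_virtually_simples R (regular_module R) \<longleftrightarrow> (\<exists>E. virtually_simple_decomposition E)"
    using direct_sum_imp_decomposition decomposition_imp_direct_sum by blast
  moreover have "left_completely_virtually_semisimple_ring R \<longleftrightarrow> (\<exists>E. virtually_simple_decomposition E)"
    using left_completely_virtually_semisimple_ring_imp_decomposition
      decomposition_imp_left_completely_virtually_semisimple_ring by blast
  moreover have "(\<exists>k n (D :: nat \<Rightarrow> 'a ring). plid_matrix_decomposition R k n D) \<longleftrightarrow>
      (\<exists>E. virtually_simple_decomposition E)"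
    using plid_decomposition_imp_decomposition decomposition_imp_plid_decomposition ne by blast
  moreover have "\<forall>k n (D :: nat \<Rightarrow> 'd ring). plid_matrix_decomposition R k n D \<longrightarrow>
      (\<exists>E. virtually_simple_decomposition E)"
    using plid_decomposition_imp_decomposition by blast
  ultimately show ?thesis using plid_decomposition_unique by blast
qed

end
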